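(* For any $\gamma_\infty>0$, $\gamma>0$, $N\in\mathbb N$, any $S>\frac{\pi}{\gamma_\infty}$ and any $\varepsilon>0$, there is a constant $C=C(\gamma_\infty,\gamma,N,S,\varepsilon)>0$ such that for any real sequence $(\beta_n)_{n\in\mathbb N^*}$ satisfying (1) $\beta_{n+1}-\beta_n\ge\gamma$ for all $n\in\mathbb N^*$, and $\beta_1\ge\gamma$, (2) $\beta_{n+1}-\beta_n\ge\gamma_\infty$ for all $n\in\mathbb N^*$ with $n\ge N$, and for any $0<T\le1$, there exists a sequence of functions $(u_n)_{n\in\mathbb N^*}$ in $L^2(0,T)$ such that: (i) for all $l,n\in\mathbb N^*$, $\int_0^Tu_n(t)e^{-\beta_l^2t}\,dt=\delta_{n,l}$; (ii) for any sequence $(a_n)_{n\in\mathbb N^*}$ such that $(\beta_n^2e^{\beta_n^2T}a_n)_{n}\in\ell^2(\mathbb N^* )$, one has, with $z(t)=\sum_{n\in\mathbb N^*}a_nu_n(t)$, $$\|z\|_{L^2(0,T)}^2\ \le\ \frac{C}{T^3}\,e^{\frac{(16+\varepsilon)S^2}{T}}\sum_{n\in\mathbb N^*}\beta_n^2\,e^{2\beta_n^2T}\,|a_n|^2 .$$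
   Context: $\mathbb N^*=\{1,2,3,\dots\}$; $\delta_{n,l}$ is the Kronecker symbol. *)

theory Defs
  imports "HOL-Analysis.Analysis"
begin

text \<open>Elements of \<open>L\<^sup>2(0,T)\<close> are represented by functions on the whole real line; only their values
  almost everywhere on \<open>(0,T)\<close> matter.\<close>

definition L2 :: "real \<Rightarrow> (real \<Rightarrow> 'a::{banach, second_countable_topology}) set" where
  "L2 T = {f. f \<in> borel_measurable (lebesgue_on {0<..<T}) \<and>
              integrable (lebesgue_on {0<..<T}) (\<lambda>t. (norm (f t))\<^sup>2)}"

definition L2_norm :: "real \<Rightarrow> (real \<Rightarrow> 'a::{banach, second_countable_topology}) \<Rightarrow> real" where
  "L2_norm T f = sqrt (LINT t|lebesgue_on {0<..<T}. (norm (f t))\<^sup>2)"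

text \<open>\<open>z\<close> is the sum of the series \<open>\<Sum>n\<ge>1. f n\<close> in \<open>L\<^sup>2(0,T)\<close>: the partial sums
  converge to \<open>z\<close> in norm and also pointwise almost everywhere.\<close>

definition L2_series_sum ::
  "real \<Rightarrow> (nat \<Rightarrow> real \<Rightarrow> 'a::{banach, second_countable_topology}) \<Rightarrow> (real \<Rightarrow> 'a) \<Rightarrow> bool" where
  "L2_series_sum T f z \<longleftrightarrow>
     z \<in> L2 T \<and>
     (\<lambda>M. L2_norm T (\<lambda>t. (\<Sum>n=1..M. f n t) - z t)) \<longlonglongrightarrow> 0 \<and>
     (AE t in lebesgue_on {0<..<T}. (\<lambda>M. \<Sum>n=1..M. f n t) \<longlonglongrightarrow> z t)"

end

theory Submission
  imports Defs "HOL-Complex_Analysis.Cauchy_Integral_Formula"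
begin

text \<open>Transmutation from waves to heat. Let \<open>g(t) = exp (- a (1/t + 1/(T - t)))\<close> with \<open>a = 3 S\<^sup>2 / 2\<close>. The kernel
  \<open>k(t,s) = \<Sum>j. (-1)\<^sup>j s\<^bsup>2j+1\<^esup> / (2j+1)! g\<^bsup>(j)\<^esup>(t)\<close> converges and is bounded by \<open>S\<close> for \<open>\<bar>s\<bar> \<le> S\<close>, by Cauchy's
  estimates for \<open>g\<^bsup>(j)\<^esup>\<close>, and repeated integration by parts gives
  \<open>\<integral> k(t,s) e\<^bsup>- b\<^sup>2 t\<^esup> dt = A(b) sin (b s) / b\<close> with \<open>A(b) \<ge> T/2 e\<^bsup>- 8 S\<^sup>2 / T\<^esup> e\<^bsup>- b\<^sup>2 T\<^esup>\<close>. Hence, if the \<open>V\<^sub>n\<close> are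
  supported in \<open>[-S, S]\<close> and biorthogonal to the functions \<open>sin (\<beta>\<^sub>l s)\<close>, then
  \<open>u\<^sub>n(t) = \<beta>\<^sub>n / A(\<beta>\<^sub>n) \<integral> V\<^sub>n(s) k(t,s) ds\<close> is biorthogonal to \<open>e\<^bsup>- \<beta>\<^sub>l\<^sup>2 t\<^esup>\<close>, and \<open>1 / A(\<beta>\<^sub>n)\<^sup>2\<close> produces both the
  weight \<open>e\<^bsup>2 \<beta>\<^sub>n\<^sup>2 T\<^esup>\<close> and the constant \<open>16 S\<^sup>2\<close>. Since \<open>k\<close> is bounded, the series for \<open>z\<close> converges uniformly,
  so that completeness of \<open>L\<^sup>2\<close> is not needed.

  The \<open>V\<^sub>n\<close> with bounds uniform in \<open>\<beta>\<close> come from the dual form of Ingham's inequality: for frequencies with gap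
  larger than \<open>\<pi> / S\<close> the Gram matrix of the exponentials against a cosine window is a small
  perturbation of the identity, both in \<open>\<ell>\<^sup>1\<close> and in \<open>\<ell>\<^sup>2\<close>. The boundedly many frequencies in the part with small
  gaps are then added one at a time by Haraux's averaging argument, at the cost of an
  arbitrarily small enlargement of the support.\<close>

section \<open>Neumann series in \<open>\<ell>\<^sup>1\<close>\<close>

text \<open>The constant may not depend on the sequence, so each existence lemma fixes its constant
  before the frequencies are given; only gaps, support radius and the number of exceptional
  frequencies enter. Two bounds on the dual functions are carried along: a sup bound, obtained in
  l1, so that infinite sums converge uniformly and stay continuous with bounded support; and a
  Bessel bound for finite combinations, obtained in l2, which produces the sum over |a_n|^2 in (ii).
  The kernel formally solves k_ss + k_t = 0 with k = 0 and k_s = g on s = 0. Tested against exp(-b^2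
  t) this becomes y'' = -b^2 y with y(0) = 0, whence the sine; A(b) = y'(0) is the Laplace transform
  of g at b^2. The value of a balances two estimates. On discs of radius r/2, with r the distance
  from t to the nearer endpoint, Cauchy's estimates bound the j-th term by a Poisson weight with
  parameter S^2/r once 2a/3 = S^2. On the middle half of (0,T) one has 1/t + 1/(T-t) \<le> 16/(3T),
  so this a costs the factor exp(-8 S^2/T) in A.\<close>

lemma has_sum_sum:
  fixes f :: "'a \<Rightarrow> 'b \<Rightarrow> 'c::topological_comm_monoid_add"
  assumes "finite F" and "\<And>z. z \<in> F \<Longrightarrow> (f z has_sum s z) A"
  shows "((\<lambda>y. \<Sum>z\<in>F. f z y) has_sum (\<Sum>z\<in>F. s z)) A"
  using assms by (induction F rule: finite_induct) (auto intro!: has_sum_add)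

lemma abs_summable_on_finite_bound:
  fixes f :: "'a \<Rightarrow> 'b::real_normed_vector"
  assumes "\<And>F. finite F \<Longrightarrow> F \<subseteq> A \<Longrightarrow> (\<Sum>x\<in>F. norm (f x)) \<le> B"
  shows "(\<lambda>x. norm (f x)) summable_on A" and "(\<Sum>\<^sub>\<infinity>x\<in>A. norm (f x)) \<le> B"
proof -
  show *: "(\<lambda>x. norm (f x)) summable_on A"
    by (rule nonneg_bdd_above_summable_on) (use assms in \<open>auto intro!: bdd_aboveI2[where M=B]\<close>)
  show "(\<Sum>\<^sub>\<infinity>x\<in>A. norm (f x)) \<le> B"
    by (rule infsum_le_finite_sums[OF *]) (use assms in auto)
qed

lemma norm_le_infsum_norm:
  fixes f :: "'a \<Rightarrow> 'b::real_normed_vector"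
  assumes "(\<lambda>x. norm (f x)) summable_on A" "x \<in> A"
  shows "norm (f x) \<le> (\<Sum>\<^sub>\<infinity>x\<in>A. norm (f x))"
  using finite_sum_le_infsum[OF assms(1), of "{x}"] assms(2) by simp

text \<open>Column sums bounded by q control an operator on l1: the finite sum over z is moved
  inside the sum over y. Finite sets F keep summability of the image a conclusion rather than an
  assumption.\<close>

lemma l1_operator_bound:
  fixes D :: "'a \<Rightarrow> 'a \<Rightarrow> complex" and d :: "'a \<Rightarrow> complex"
  assumes D: "\<And>y F. y \<in> A \<Longrightarrow> finite F \<Longrightarrow> F \<subseteq> A \<Longrightarrow> (\<Sum>z\<in>F. cmod (D z y)) \<le> q"
    and d: "(\<lambda>y. cmod (d y)) summable_on A"
  shows "z \<in> A \<Longrightarrow> (\<lambda>y. cmod (D z y * d y)) summable_on A"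
    and "finite F \<Longrightarrow> F \<subseteq> A \<Longrightarrow>
      (\<Sum>z\<in>F. cmod (\<Sum>\<^sub>\<infinity>y\<in>A. D z y * d y)) \<le> q * (\<Sum>\<^sub>\<infinity>y\<in>A. cmod (d y))"
proof -
  have D1: "cmod (D z y) \<le> q" if "z \<in> A" "y \<in> A" for z y
    using D[of y "{z}"] that by simp
  have qd: "(\<lambda>y. q * cmod (d y)) summable_on A"
    using d by (rule summable_on_cmult_right)
  show *: "(\<lambda>y. cmod (D z y * d y)) summable_on A" if "z \<in> A" for z
    by (rule summable_on_comparison_test[OF qd])
      (auto simp: norm_mult intro!: mult_right_mono D1 that)
  show "(\<Sum>z\<in>F. cmod (\<Sum>\<^sub>\<infinity>y\<in>A. D z y * d y)) \<le> q * (\<Sum>\<^sub>\<infinity>y\<in>A. cmod (d y))"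
    if F: "finite F" "F \<subseteq> A"
  proof -
    have "(\<Sum>z\<in>F. cmod (\<Sum>\<^sub>\<infinity>y\<in>A. D z y * d y)) \<le> (\<Sum>z\<in>F. \<Sum>\<^sub>\<infinity>y\<in>A. cmod (D z y * d y))"
      by (intro sum_mono norm_infsum_bound *) (use F in auto)
    also have "((\<lambda>y. \<Sum>z\<in>F. cmod (D z y * d y)) has_sum (\<Sum>z\<in>F. \<Sum>\<^sub>\<infinity>y\<in>A. cmod (D z y * d y))) A"
      by (intro has_sum_sum has_sum_infsum *) (use F in auto)
    then have "(\<Sum>z\<in>F. \<Sum>\<^sub>\<infinity>y\<in>A. cmod (D z y * d y)) \<le> (\<Sum>\<^sub>\<infinity>y\<in>A. q * cmod (d y))"
      by (rule has_sum_mono[OF _ has_sum_infsum[OF qd]])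
        (auto simp: norm_mult simp flip: sum_distrib_right intro!: mult_right_mono D F)
    also have "\<dots> = q * (\<Sum>\<^sub>\<infinity>y\<in>A. cmod (d y))"
      by (rule infsum_cmult_right')
    finally show ?thesis .
  qed
qed

text \<open>Since D has l1 norm at most q < 1, the iterates (-D)^k b decay geometrically in l1 and
  their sum inverts I + D. The explicit factor 1/(1-q) later makes the bounds uniform in the
  frequencies.\<close>

lemma neumann_series_l1:
  fixes D :: "'a \<Rightarrow> 'a \<Rightarrow> complex" and b :: "'a \<Rightarrow> complex"
  assumes D: "\<And>y F. y \<in> A \<Longrightarrow> finite F \<Longrightarrow> F \<subseteq> A \<Longrightarrow> (\<Sum>z\<in>F. cmod (D z y)) \<le> q"
    and q: "0 \<le> q" "q < 1"
    and b: "(\<lambda>y. cmod (b y)) summable_on A"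
  obtains x where "(\<lambda>y. cmod (x y)) summable_on A"
    "(\<Sum>\<^sub>\<infinity>y\<in>A. cmod (x y)) \<le> (\<Sum>\<^sub>\<infinity>y\<in>A. cmod (b y)) / (1 - q)"
    "\<And>z. z \<in> A \<Longrightarrow> x z + (\<Sum>\<^sub>\<infinity>y\<in>A. D z y * x y) = b z"
proof -
  define B where "B = (\<Sum>\<^sub>\<infinity>y\<in>A. cmod (b y))"
  \<comment> \<open>\<open>d k\<close> is (-D)^k b.\<close>
  define d where "d = rec_nat b (\<lambda>_ f z. - (\<Sum>\<^sub>\<infinity>y\<in>A. D z y * f y))"
  have d0: "d 0 = b" and dS: "d (Suc k) z = - (\<Sum>\<^sub>\<infinity>y\<in>A. D z y * d k y)" for k z
    by (simp_all add: d_def)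
  have ds: "(\<lambda>y. cmod (d k y)) summable_on A \<and> (\<Sum>\<^sub>\<infinity>y\<in>A. cmod (d k y)) \<le> q ^ k * B" for k
  proof (induction k)
    case 0
    then show ?case using b by (simp add: d0 B_def)
  next
    case (Suc k)
    have "(\<Sum>z\<in>F. cmod (d (Suc k) z)) \<le> q ^ Suc k * B" if F: "finite F" "F \<subseteq> A" for F
    proof -
      have "(\<Sum>z\<in>F. cmod (d (Suc k) z)) \<le> q * (\<Sum>\<^sub>\<infinity>y\<in>A. cmod (d k y))"
        using l1_operator_bound(2)[of A D q "d k" F] Suc F D by (simp add: dS)
      also have "\<dots> \<le> q * (q ^ k * B)"
        using Suc q by (intro mult_left_mono) auto
      finally show ?thesis by simp
    qed
    then show ?case using abs_summable_on_finite_bound[of A "d (Suc k)" "q ^ Suc k * B"] by blast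
  qed
  have dF: "(\<Sum>z\<in>F. cmod (d k z)) \<le> q ^ k * B" if "finite F" "F \<subseteq> A" for F k
    using finite_sum_le_infsum[of "\<lambda>z. cmod (d k z)" A F] ds[of k] that by auto
  have d1: "cmod (d k z) \<le> q ^ k * B" if "z \<in> A" for z k
    using dF[of "{z}" k] that by simp
  have gs: "summable (\<lambda>k. q ^ (k + K) * B)" for K
    using q by (intro summable_mult2) (simp add: power_add summable_mult2 summable_geometric)
  have sd: "summable (\<lambda>k. cmod (d (k + K) z))" if "z \<in> A" for z K
    by (rule summable_comparison_test[OF _ gs[of K]]) (use d1 that in auto)
  define x where "x z = (\<Sum>k. d k z)" for z
  have gsum: "(\<Sum>k. q ^ (k + K) * B) = q ^ K * (B / (1 - q))" for K
  proof -
    have "(\<lambda>k. (q ^ K * B) * q ^ k) sums (q ^ K * B * (1 / (1 - q)))"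
      by (intro sums_mult geometric_sums) (use q in auto)
    then show ?thesis by (simp add: sums_iff power_add mult_ac)
  qed
  have tail: "(\<Sum>z\<in>F. cmod (x z - (\<Sum>k<K. d k z))) \<le> q ^ K * (B / (1 - q))"
    if F: "finite F" "F \<subseteq> A" for F K
  proof -
    have "(\<Sum>z\<in>F. cmod (x z - (\<Sum>k<K. d k z))) \<le> (\<Sum>z\<in>F. \<Sum>k. cmod (d (k + K) z))"
    proof (rule sum_mono)
      fix z assume "z \<in> F"
      then have z: "z \<in> A" using F by auto
      have "summable (\<lambda>k. d k z)" using sd[OF z, of 0] by (simp add: summable_norm_cancel)
      then have "x z - (\<Sum>k<K. d k z) = (\<Sum>k. d (k + K) z)"
        unfolding x_def by (subst suminf_minus_initial_segment) auto
      then show "cmod (x z - (\<Sum>k<K. d k z)) \<le> (\<Sum>k. cmod (d (k + K) z))"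
        using summable_norm[OF sd[OF z, of K]] by simp
    qed
    also have "\<dots> = (\<Sum>k. \<Sum>z\<in>F. cmod (d (k + K) z))"
      by (rule suminf_sum[symmetric]) (use sd F in auto)
    also have "\<dots> \<le> (\<Sum>k. q ^ (k + K) * B)"
      by (rule suminf_le[OF _ summable_sum gs]) (use sd F dF in auto)
    finally show ?thesis by (simp add: gsum)
  qed
  have tl: "(\<lambda>z. cmod (x z - (\<Sum>k<K. d k z))) summable_on A"
    "(\<Sum>\<^sub>\<infinity>z\<in>A. cmod (x z - (\<Sum>k<K. d k z))) \<le> q ^ K * (B / (1 - q))" for K
    using abs_summable_on_finite_bound[of A "\<lambda>z. x z - (\<Sum>k<K. d k z)", OF tail] by auto
  have xs: "(\<lambda>z. cmod (x z)) summable_on A" using tl[of 0] by simp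
  show thesis
  proof (rule that[of x])
    show "(\<lambda>z. cmod (x z)) summable_on A" by (rule xs)
    show "(\<Sum>\<^sub>\<infinity>y\<in>A. cmod (x y)) \<le> (\<Sum>\<^sub>\<infinity>y\<in>A. cmod (b y)) / (1 - q)"
      using tl[of 0] by (simp add: B_def)
    fix z assume z: "z \<in> A"
    have sum1: "(\<lambda>y. D z y * e y) summable_on A" if "(\<lambda>y. cmod (e y)) summable_on A" for e
      by (rule abs_summable_summable) (rule l1_operator_bound(1)[where q=q, OF D that z])
    define R where "R K = (\<Sum>\<^sub>\<infinity>y\<in>A. D z y * (x y - (\<Sum>k<K. d k y)))" for K
    have R: "cmod (R K) \<le> q * (q ^ K * (B / (1 - q)))" for K
    proof -
      have "cmod (R K) \<le> q * (\<Sum>\<^sub>\<infinity>y\<in>A. cmod (x y - (\<Sum>k<K. d k y)))"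
        using l1_operator_bound(2)[where q=q and F="{z}" and A=A and D=D, OF D tl(1)[of K]] z
        by (simp add: R_def)
      also have "\<dots> \<le> q * (q ^ K * (B / (1 - q)))"
        using tl(2) q by (intro mult_left_mono) auto
      finally show ?thesis .
    qed
    \<comment> \<open>The residual on the left does not depend on K, while each of the three terms
      on the right tends to 0 as K grows; the terms \<open>d k\<close> telescope because D applied
      to \<open>d k\<close> is minus \<open>d (Suc k)\<close>.\<close>
    have eq: "x z + (\<Sum>\<^sub>\<infinity>y\<in>A. D z y * x y) - b z = (x z - (\<Sum>k<K. d k z)) - d K z + R K" for K
    proof -
      have "((\<lambda>y. \<Sum>k<K. D z y * d k y) has_sum (\<Sum>k<K. (\<Sum>\<^sub>\<infinity>y\<in>A. D z y * d k y))) A"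
        using ds by (intro has_sum_sum has_sum_infsum sum1) auto
      then have h: "((\<lambda>y. D z y * (\<Sum>k<K. d k y)) has_sum (\<Sum>k<K. - d (Suc k) z)) A"
        by (simp add: sum_distrib_left dS)
      have h2: "((\<lambda>y. D z y * x y) has_sum (R K + (\<Sum>k<K. - d (Suc k) z))) A"
        using has_sum_add[OF has_sum_infsum[OF sum1[OF tl(1)[of K]]] h]
        by (simp add: R_def algebra_simps)
      have tele: "(\<Sum>k<K. d k z) - (\<Sum>k<K. d (Suc k) z) = d 0 z - d K z"
        using sum_lessThan_telescope'[of "\<lambda>k. d k z" K] by (simp add: sum_subtractf)
      show ?thesis using infsumI[OF h2] tele by (simp add: sum_negf d0 algebra_simps)
    qed
    have "(\<lambda>K. q ^ K) \<longlonglongrightarrow> 0" using q by (intro LIMSEQ_realpow_zero) auto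
    note q0 = this
    have 1: "(\<lambda>K. q ^ K * (B / (1 - q))) \<longlonglongrightarrow> 0"
      using tendsto_mult_right[OF q0, of "B / (1 - q)"] by simp
    have 2: "(\<lambda>K. q ^ K * B) \<longlonglongrightarrow> 0"
      using tendsto_mult_right[OF q0, of B] by simp
    have 3: "(\<lambda>K. q * (q ^ K * (B / (1 - q)))) \<longlonglongrightarrow> 0"
      using tendsto_mult_left[OF 1, of q] by simp
    have l1: "(\<lambda>K. x z - (\<Sum>k<K. d k z)) \<longlonglongrightarrow> 0"
      by (rule Lim_null_comparison[OF _ 1]) (use tail[of "{z}"] z in auto)
    have l2: "(\<lambda>K. d K z) \<longlonglongrightarrow> 0"
      by (rule Lim_null_comparison[OF _ 2]) (use d1 z in auto)
    have l3: "R \<longlonglongrightarrow> 0"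
      by (rule Lim_null_comparison[OF _ 3]) (use R in auto)
    have "(\<lambda>K. (x z - (\<Sum>k<K. d k z)) - d K z + R K) \<longlonglongrightarrow> 0 - 0 + 0"
      by (intro tendsto_intros l1 l2 l3)
    then have "x z + (\<Sum>\<^sub>\<infinity>y\<in>A. D z y * x y) - b z = 0"
      by (simp add: LIMSEQ_const_iff flip: eq)
    then show "x z + (\<Sum>\<^sub>\<infinity>y\<in>A. D z y * x y) = b z" by simp
  qed
qed

text \<open>Pairing \<open>x + D x = b\<close> with \<open>x\<close> bounds \<open>x\<close> in \<open>\<ell>\<^sup>2\<close> although it was constructed in \<open>\<ell>\<^sup>1\<close>.\<close>

lemma energy_bound_l1:
  fixes D :: "'a \<Rightarrow> 'a \<Rightarrow> complex" and b x :: "'a \<Rightarrow> complex"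
  assumes D: "\<And>y F. y \<in> A \<Longrightarrow> finite F \<Longrightarrow> F \<subseteq> A \<Longrightarrow> (\<Sum>z\<in>F. cmod (D z y)) \<le> q"
    and sym: "\<And>y z. y \<in> A \<Longrightarrow> z \<in> A \<Longrightarrow> cmod (D z y) = cmod (D y z)"
    and q: "0 \<le> q" "q < 1"
    and x: "(\<lambda>y. cmod (x y)) summable_on A"
    and b: "(\<lambda>y. (cmod (b y))\<^sup>2) summable_on A"
    and eq: "\<And>z. z \<in> A \<Longrightarrow> x z + (\<Sum>\<^sub>\<infinity>y\<in>A. D z y * x y) = b z"
  shows "(\<lambda>y. cmod (x y) * cmod (b y)) summable_on A"
    and "(\<Sum>\<^sub>\<infinity>y\<in>A. cmod (x y) * cmod (b y)) \<le> (\<Sum>\<^sub>\<infinity>y\<in>A. (cmod (b y))\<^sup>2) / (1 - q)"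
proof -
  define X where "X = (\<Sum>\<^sub>\<infinity>y\<in>A. cmod (x y))"
  have xX: "cmod (x y) \<le> X" if "y \<in> A" for y
    unfolding X_def by (rule norm_le_infsum_norm[OF x that])
  have D1: "cmod (D z y) \<le> q" if "z \<in> A" "y \<in> A" for z y
    using D[of y "{z}"] that by simp
  \<comment> \<open>An l1 sequence is bounded, hence square summable. So the energy \<open>P\<close>
    is finite and may be absorbed later.\<close>
  have x2: "(\<lambda>y. (cmod (x y))\<^sup>2) summable_on A"
    by (rule summable_on_comparison_test[OF summable_on_cmult_right[OF x, of X]])
      (auto simp: power2_eq_square intro!: mult_right_mono xX)
  define P Q where "P = (\<Sum>\<^sub>\<infinity>y\<in>A. (cmod (x y))\<^sup>2)" and "Q = (\<Sum>\<^sub>\<infinity>y\<in>A. (cmod (b y))\<^sup>2)"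
  have amgm: "u * v \<le> (t * u\<^sup>2 + v\<^sup>2 / t) / 2" if "t > 0" for t u v :: real
  proof -
    have "0 \<le> (t * u - v)\<^sup>2 / t" using that by simp
    also have "\<dots> = t * u\<^sup>2 + v\<^sup>2 / t - 2 * (u * v)"
      using that by (simp add: field_simps power2_eq_square)
    finally show ?thesis by simp
  qed
  have sxb: "(\<lambda>y. (t * (cmod (x y))\<^sup>2 + (cmod (b y))\<^sup>2 / t) / 2) summable_on A" for t
    using summable_on_cmult_right[OF summable_on_add[OF summable_on_cmult_right[OF x2, of t]
       summable_on_cmult_right[OF b, of "1 / t"]], of "1 / 2"] by (simp add: add_divide_distrib)
  show xb: "(\<lambda>y. cmod (x y) * cmod (b y)) summable_on A"
    by (rule summable_on_comparison_test[OF sxb[of 1]]) (use amgm[of 1] in auto)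
  define W where "W = (\<Sum>\<^sub>\<infinity>y\<in>A. cmod (x y) * cmod (b y))"
  have W: "W \<le> (t * P + Q / t) / 2" if "t > 0" for t
  proof -
    have "((\<lambda>y. (1/2) * (t * (cmod (x y))\<^sup>2 + (1/t) * (cmod (b y))\<^sup>2)) has_sum (1/2) * (t * P + (1/t) * Q)) A"
      unfolding P_def Q_def by (intro has_sum_cmult_right has_sum_add has_sum_infsum x2 b)
    then show ?thesis unfolding W_def
      using has_sum_mono[OF has_sum_infsum[OF xb]] amgm[OF that] by fastforce
  qed
  \<comment> \<open>Pairing the equation with x. The quadratic form of D is at most
    \<open>q * P\<close>: each product |x z| |x y| is split into half squares, and the row sums and
    the column sums, equal by symmetry of |D|, contribute q/2 each.\<close>
  have key: "P \<le> W + q * P"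
  proof -
    have sx: "(\<lambda>y. cmod (D z y) * (cmod (x y))\<^sup>2) summable_on A" if "z \<in> A" for z
      by (rule summable_on_comparison_test[OF summable_on_cmult_right[OF x2, of q]])
        (auto intro!: mult_right_mono D1 that)
    have Dz: "(\<lambda>y. cmod (D z y)) summable_on A" "(\<Sum>\<^sub>\<infinity>y\<in>A. cmod (D z y)) \<le> q" if z: "z \<in> A" for z
    proof -
      have "(\<Sum>y\<in>F. cmod (D z y)) \<le> q" if "finite F" "F \<subseteq> A" for F
      proof -
        have "(\<Sum>y\<in>F. cmod (D z y)) = (\<Sum>y\<in>F. cmod (D y z))"
          by (rule sum.cong) (use that z sym in auto)
        then show ?thesis using D[OF z that] by simp
      qed
      then show "(\<lambda>y. cmod (D z y)) summable_on A" "(\<Sum>\<^sub>\<infinity>y\<in>A. cmod (D z y)) \<le> q"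
        using abs_summable_on_finite_bound[of A "D z" q] by auto
    qed
    have pt: "(cmod (x z))\<^sup>2 \<le> cmod (x z) * cmod (b z) + (q / 2) * (cmod (x z))\<^sup>2
        + (1/2) * (\<Sum>\<^sub>\<infinity>y\<in>A. cmod (D z y) * (cmod (x y))\<^sup>2)" if z: "z \<in> A" for z
    proof -
      have s: "(\<lambda>y. cmod (D z y * x y)) summable_on A"
        by (rule l1_operator_bound(1)[where q=q, OF D x z])
      have "cmod (x z) \<le> cmod (b z) + (\<Sum>\<^sub>\<infinity>y\<in>A. cmod (D z y * x y))"
        using norm_infsum_bound[OF s] norm_triangle_ineq4[of "b z" "\<Sum>\<^sub>\<infinity>y\<in>A. D z y * x y"]
        by (simp flip: eq[OF z])
      then have "cmod (x z) * cmod (x z) \<le> cmod (x z) * (cmod (b z) + (\<Sum>\<^sub>\<infinity>y\<in>A. cmod (D z y * x y)))"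
        by (intro mult_left_mono) auto
      also have "\<dots> = cmod (x z) * cmod (b z) + (\<Sum>\<^sub>\<infinity>y\<in>A. cmod (x z) * cmod (D z y * x y))"
        by (simp add: algebra_simps infsum_cmult_right')
      also have "(\<Sum>\<^sub>\<infinity>y\<in>A. cmod (x z) * cmod (D z y * x y)) \<le>
        (1/2) * ((\<Sum>\<^sub>\<infinity>y\<in>A. cmod (D z y)) * (cmod (x z))\<^sup>2 + (\<Sum>\<^sub>\<infinity>y\<in>A. cmod (D z y) * (cmod (x y))\<^sup>2))"
      proof (rule has_sum_mono[OF has_sum_infsum])
        show "(\<lambda>y. cmod (x z) * cmod (D z y * x y)) summable_on A"
          by (rule summable_on_cmult_right[OF s])
        show "((\<lambda>y. (1/2) * (cmod (D z y) * (cmod (x z))\<^sup>2 + cmod (D z y) * (cmod (x y))\<^sup>2)) has_sum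
          (1/2) * ((\<Sum>\<^sub>\<infinity>y\<in>A. cmod (D z y)) * (cmod (x z))\<^sup>2 + (\<Sum>\<^sub>\<infinity>y\<in>A. cmod (D z y) * (cmod (x y))\<^sup>2))) A"
          by (intro has_sum_cmult_right has_sum_add has_sum_cmult_left has_sum_infsum Dz sx z)
        fix y
        have "cmod (D z y) * (cmod (x z) * cmod (x y)) \<le> cmod (D z y) * ((1 * (cmod (x z))\<^sup>2 + (cmod (x y))\<^sup>2 / 1) / 2)"
          by (intro mult_left_mono amgm) auto
        then show "cmod (x z) * cmod (D z y * x y) \<le> (1/2) * (cmod (D z y) * (cmod (x z))\<^sup>2 + cmod (D z y) * (cmod (x y))\<^sup>2)"
          by (simp add: norm_mult algebra_simps)
      qed
      also have "\<dots> \<le> (1/2) * (q * (cmod (x z))\<^sup>2 + (\<Sum>\<^sub>\<infinity>y\<in>A. cmod (D z y) * (cmod (x y))\<^sup>2))"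
        by (intro mult_left_mono add_mono mult_right_mono Dz z) auto
      finally show ?thesis by (simp add: power2_eq_square algebra_simps)
    qed
    show ?thesis unfolding P_def
    proof (rule infsum_le_finite_sums[OF x2])
      fix F assume F: "finite F" "F \<subseteq> A"
      have "(\<Sum>z\<in>F. (cmod (x z))\<^sup>2) \<le> (\<Sum>z\<in>F. cmod (x z) * cmod (b z)) + (q / 2) * (\<Sum>z\<in>F. (cmod (x z))\<^sup>2)
        + (1/2) * (\<Sum>z\<in>F. \<Sum>\<^sub>\<infinity>y\<in>A. cmod (D z y) * (cmod (x y))\<^sup>2)"
        unfolding sum_distrib_left sum.distrib[symmetric]
        by (rule sum_mono) (use pt F in auto)
      moreover have "(\<Sum>z\<in>F. cmod (x z) * cmod (b z)) \<le> W" unfolding W_def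
        by (rule finite_sum_le_infsum[OF xb]) (use F in auto)
      moreover have "(\<Sum>z\<in>F. (cmod (x z))\<^sup>2) \<le> P" unfolding P_def
        by (rule finite_sum_le_infsum[OF x2]) (use F in auto)
      then have "(q / 2) * (\<Sum>z\<in>F. (cmod (x z))\<^sup>2) \<le> (q / 2) * P"
        using q by (intro mult_left_mono) auto
      moreover have "(\<Sum>z\<in>F. \<Sum>\<^sub>\<infinity>y\<in>A. cmod (D z y) * (cmod (x y))\<^sup>2) \<le> q * P"
      proof (rule has_sum_mono)
        show "((\<lambda>y. \<Sum>z\<in>F. cmod (D z y) * (cmod (x y))\<^sup>2) has_sum (\<Sum>z\<in>F. \<Sum>\<^sub>\<infinity>y\<in>A. cmod (D z y) * (cmod (x y))\<^sup>2)) A"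
          by (intro has_sum_sum has_sum_infsum sx) (use F in auto)
        show "((\<lambda>y. q * (cmod (x y))\<^sup>2) has_sum q * P) A"
          unfolding P_def by (intro has_sum_cmult_right has_sum_infsum x2)
      qed (auto simp flip: sum_distrib_right intro!: mult_right_mono D F)
      ultimately show "(\<Sum>z\<in>F. (cmod (x z))\<^sup>2) \<le> W + q * (\<Sum>\<^sub>\<infinity>y\<in>A. (cmod (x y))\<^sup>2)"
        by (simp add: P_def)
    qed
  qed
  \<comment> \<open>With the weight t = 1 - q the first half is at most W/2 by \<open>key\<close>,
    which absorbs into the left side.\<close>
  have "W \<le> ((1 - q) * P + Q / (1 - q)) / 2" using W[of "1 - q"] q by simp
  with key have "W \<le> Q / (1 - q)" by (simp add: algebra_simps)
  then show "(\<Sum>\<^sub>\<infinity>y\<in>A. cmod (x y) * cmod (b y)) \<le> (\<Sum>\<^sub>\<infinity>y\<in>A. (cmod (b y))\<^sup>2) / (1 - q)"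
    by (simp add: W_def Q_def)
qed

section \<open>Fourier transforms of compactly supported functions\<close>

text \<open>Continuity with bounded support makes every product with an exponential integrable, so
  all integrals can run over the whole line.\<close>

definition csupp :: "real \<Rightarrow> (real \<Rightarrow> complex) set" where
  "csupp R = {f. continuous_on UNIV f \<and> (\<forall>s. R < \<bar>s\<bar> \<longrightarrow> f s = 0)}"

text \<open>Positive sign and no normalisation: the value at z is the pairing with exp(i z s)
  itself, so biorthogonality is a statement about values of \<open>FT\<close>.\<close>

definition FT :: "(real \<Rightarrow> complex) \<Rightarrow> real \<Rightarrow> complex" where
  "FT f z = (LINT s|lborel. f s * cis (z * s))"

lemma integrable_bounded_support:
  fixes f :: "real \<Rightarrow> 'b::{banach, second_countable_topology}"
  assumes "continuous_on UNIV f" and "\<And>s. R < \<bar>s\<bar> \<Longrightarrow> f s = 0"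
  shows "integrable lborel f"
proof -
  have "integrable lborel (\<lambda>x. indicator {-R..R} x *\<^sub>R f x)"
    by (rule borel_integrable_compact) (use continuous_on_subset[OF assms(1)] in auto)
  also have "(\<lambda>x. indicator {-R..R} x *\<^sub>R f x) = f"
    using assms(2) by (force simp: indicator_def fun_eq_iff)
  finally show ?thesis .
qed

lemma csupp_mult: "f \<in> csupp R \<Longrightarrow> continuous_on UNIV g \<Longrightarrow> (\<lambda>s. f s * g s) \<in> csupp R"
  by (auto simp: csupp_def intro!: continuous_intros)

lemma csupp_scale: "f \<in> csupp R \<Longrightarrow> (\<lambda>s. c * f s) \<in> csupp R"
  by (auto simp: csupp_def intro!: continuous_intros)

lemma csupp_add: "f \<in> csupp R \<Longrightarrow> g \<in> csupp R \<Longrightarrow> (\<lambda>s. f s + g s) \<in> csupp R"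
  by (auto simp: csupp_def intro!: continuous_intros)

lemma csupp_diff: "f \<in> csupp R \<Longrightarrow> g \<in> csupp R \<Longrightarrow> (\<lambda>s. f s - g s) \<in> csupp R"
  by (auto simp: csupp_def intro!: continuous_intros)

lemma csupp_sum: "(\<And>x. x \<in> F \<Longrightarrow> f x \<in> csupp R) \<Longrightarrow> (\<lambda>s. \<Sum>x\<in>F. f x s) \<in> csupp R"
  by (auto simp: csupp_def intro!: continuous_intros sum.neutral)

lemma csupp_mono: "f \<in> csupp R \<Longrightarrow> R \<le> R' \<Longrightarrow> f \<in> csupp R'"
  by (auto simp: csupp_def)

lemma csupp_integrable: "f \<in> csupp R \<Longrightarrow> integrable lborel f"
  by (rule integrable_bounded_support[of _ R]) (auto simp: csupp_def)

lemma csupp_integrable_cis: "f \<in> csupp R \<Longrightarrow> integrable lborel (\<lambda>s. f s * cis (z * s))"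
  by (rule csupp_integrable[of _ R], rule csupp_mult) (auto intro!: continuous_intros)

lemma csupp_integrable_norm2: "f \<in> csupp R \<Longrightarrow> integrable lborel (\<lambda>s. (cmod (f s))\<^sup>2)"
  by (rule integrable_bounded_support[of _ R]) (auto simp: csupp_def intro!: continuous_intros)

lemma FT_scale: "FT (\<lambda>s. c * f s) z = c * FT f z"
  by (simp add: FT_def mult.assoc)

lemma FT_diff: "f \<in> csupp R \<Longrightarrow> g \<in> csupp R \<Longrightarrow> FT (\<lambda>s. f s - g s) z = FT f z - FT g z"
  by (simp add: FT_def left_diff_distrib csupp_integrable_cis)

text \<open>A summable majorant gives uniform convergence, which preserves continuity. All summands
  vanish outside the same interval, so uniform convergence also passes to the transforms.\<close>

lemma csupp_series:
  fixes f :: "'a \<Rightarrow> real \<Rightarrow> complex"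
  assumes f: "\<And>y. y \<in> A \<Longrightarrow> f y \<in> csupp R"
    and M: "\<And>y s. y \<in> A \<Longrightarrow> cmod (f y s) \<le> M y" "M summable_on A"
  defines "g \<equiv> \<lambda>s. \<Sum>\<^sub>\<infinity>y\<in>A. f y s"
  shows "g \<in> csupp R" and "cmod (g s) \<le> infsum M A"
    and "((\<lambda>y. FT (f y) z) has_sum FT g z) A"
proof -
  have ul: "uniform_limit UNIV (\<lambda>F s. \<Sum>y\<in>F. f y s) g (finite_subsets_at_top A)"
    unfolding g_def by (rule Weierstrass_m_test_general[OF _ M(2)]) (use M(1) in auto)
  have fin: "eventually (\<lambda>F. finite F \<and> F \<subseteq> A) (finite_subsets_at_top A)"
    by (rule eventually_finite_subsets_at_top_weakI) auto
  have cont: "continuous_on UNIV g"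
    by (rule uniform_limit_theorem[OF _ ul finite_subsets_at_top_neq_bot])
      (rule eventually_mono[OF fin], use f in \<open>auto simp: csupp_def intro!: continuous_intros\<close>)
  moreover have "g s = 0" if "R < \<bar>s\<bar>" for s
    using f that by (auto simp: g_def csupp_def intro!: infsum_0)
  ultimately show g: "g \<in> csupp R" by (auto simp: csupp_def)
  have s: "(\<lambda>y. cmod (f y s)) summable_on A" for s
    by (rule summable_on_comparison_test[OF M(2)]) (use M(1) in auto)
  show "cmod (g s) \<le> infsum M A"
    unfolding g_def using M(1) by (intro order_trans[OF norm_infsum_bound[OF s] infsum_mono[OF s M(2)]])
  show "((\<lambda>y. FT (f y) z) has_sum FT g z) A"
    unfolding has_sum_def
  proof (rule tendstoI)
    fix e :: real assume e: "e > 0"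
    \<comment> \<open>A function below K on an interval of length 2|R| has integral at most 2|R|K,
      which is below e; the added 1 covers R = 0.\<close>
    define K where "K = e / (2 * (\<bar>R\<bar> + 1))"
    have K: "K > 0" using e by (auto simp: K_def)
    have "\<forall>\<^sub>F F in finite_subsets_at_top A. \<forall>s. dist (\<Sum>y\<in>F. f y s) (g s) < K"
      using uniform_limitD[OF ul K] by simp
    with fin show "\<forall>\<^sub>F F in finite_subsets_at_top A. dist (\<Sum>y\<in>F. FT (f y) z) (FT g z) < e"
    proof eventually_elim
      case (elim F)
      define h where "h s = (\<Sum>y\<in>F. f y s) - g s" for s
      have h: "h \<in> csupp R" unfolding h_def
        by (intro csupp_diff csupp_sum g f) (use elim in auto)
      have hF: "(\<Sum>y\<in>F. FT (f y) z) - FT g z = FT h z"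
      proof -
        have "FT h z = FT (\<lambda>s. \<Sum>y\<in>F. f y s) z - FT g z"
          unfolding h_def by (rule FT_diff[OF csupp_sum g]) (use elim f in auto)
        also have "FT (\<lambda>s. \<Sum>y\<in>F. f y s) z = (\<Sum>y\<in>F. FT (f y) z)"
          unfolding FT_def sum_distrib_right
          by (rule Bochner_Integration.integral_sum) (use elim f csupp_integrable_cis in blast)
        finally show ?thesis by simp
      qed
      have "cmod (FT h z) \<le> (LINT s|lborel. indicator {-\<bar>R\<bar>..\<bar>R\<bar>} s * K)"
        unfolding FT_def
      proof (rule Bochner_Integration.integral_norm_bound_integral)
        show "integrable lborel (\<lambda>s. h s * cis (z * s))" by (rule csupp_integrable_cis[OF h])
        show "integrable lborel (\<lambda>s. indicator {-\<bar>R\<bar>..\<bar>R\<bar>} s * K)"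
          by (auto intro!: integrable_mult_left)
        fix s
        have "cmod (h s) \<le> K" using elim by (simp add: h_def dist_norm less_imp_le)
        moreover have "h s = 0" if "s \<notin> {-\<bar>R\<bar>..\<bar>R\<bar>}" using h that by (auto simp: csupp_def)
        ultimately show "cmod (h s * cis (z * s)) \<le> indicator {-\<bar>R\<bar>..\<bar>R\<bar>} s * K"
          by (cases "s \<in> {-\<bar>R\<bar>..\<bar>R\<bar>}") (auto simp: norm_mult)
      qed
      also have "\<dots> = 2 * \<bar>R\<bar> * K" by simp
      also have "\<dots> < e"
        using e by (simp add: K_def field_simps)
      finally show ?case by (simp add: dist_norm hF)
    qed
  qed
qed

subsection \<open>The cosine window\<close>

text \<open>Clamping \<open>s\<close> to \<open>[-R, R]\<close> makes the window vanish continuously outside; the factor normalises its integral to 1.\<close>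

definition cos_window :: "real \<Rightarrow> real \<Rightarrow> real" where
  "cos_window R s = pi / (4 * R) * cos (pi / (2 * R) * max (-R) (min s R))"

lemma cos_window_range:
  assumes "R > 0"
  shows "0 \<le> cos_window R s" "cos_window R s \<le> pi / (4 * R)"
proof -
  define u where "u = max (-R) (min s R)"
  have u: "-R \<le> u" "u \<le> R" using assms by (auto simp: u_def)
  have "pi / (2 * R) * u \<le> pi / 2" "- (pi / 2) \<le> pi / (2 * R) * u"
    using assms u mult_left_mono[of "-R" u pi] mult_left_mono[of u R pi] by (auto simp: field_simps)
  then have "cos (pi / (2 * R) * u) \<ge> 0" by (intro cos_ge_zero) auto
  then show "0 \<le> cos_window R s" "cos_window R s \<le> pi / (4 * R)"
    using assms mult_left_mono[of "cos (pi / (2 * R) * u)" 1 "pi / (4 * R)"]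
    by (auto simp: cos_window_def simp flip: u_def)
qed

lemma cos_window_csupp:
  assumes "R > 0"
  shows "(\<lambda>s. complex_of_real (cos_window R s)) \<in> csupp R"
proof -
  have "cos_window R s = 0" if "\<bar>s\<bar> > R" for s
  proof -
    have "max (-R) (min s R) = R \<or> max (-R) (min s R) = -R" using that assms by auto
    then have "pi / (2 * R) * max (-R) (min s R) = pi / 2 \<or> pi / (2 * R) * max (-R) (min s R) = - (pi / 2)"
      using assms by (auto simp: field_simps)
    then show ?thesis unfolding cos_window_def
      by (elim disjE) (simp_all only: cos_minus cos_pi_half mult_zero_right)
  qed
  moreover have "continuous_on UNIV (cos_window R)"
    unfolding cos_window_def[abs_def] by (intro continuous_intros)
  ultimately show ?thesis
    by (auto simp: csupp_def intro!: continuous_intros)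
qed

lemma FT_cos_window:
  assumes R: "R > 0"
  defines "a \<equiv> pi / (2 * R)"
  assumes u: "u\<^sup>2 \<noteq> a\<^sup>2"
  shows "FT (\<lambda>s. complex_of_real (cos_window R s)) u = complex_of_real (a\<^sup>2 * cos (u * R) / (a\<^sup>2 - u\<^sup>2))"
proof -
  \<comment> \<open>An explicit antiderivative of \<open>f\<close>: differentiating the bracket
    cancels the mixed terms with sin and leaves (a^2 - u^2) cos(a s) cis(u s).\<close>
  define F :: "real \<Rightarrow> complex" where "F s = complex_of_real (pi / (4 * R) / (a\<^sup>2 - u\<^sup>2)) *
    (complex_of_real (a * sin (a * s)) * cis (u * s) + \<i> * complex_of_real (u * cos (a * s)) * cis (u * s))" for s
  define f :: "real \<Rightarrow> complex" where "f s = complex_of_real (pi / (4 * R) * cos (a * s)) * cis (u * s)" for s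
  have au: "a\<^sup>2 - u\<^sup>2 \<noteq> 0" using u by simp
  have "FT (\<lambda>s. complex_of_real (cos_window R s)) u = (LINT s|lborel. indicator {-R..R} s *\<^sub>R f s)"
    unfolding FT_def
  proof (rule Bochner_Integration.integral_cong[OF refl])
    fix s
    have "complex_of_real (cos_window R s) = 0" if "s \<notin> {-R..R}"
      using cos_window_csupp[OF R] that by (auto simp: csupp_def)
    moreover have "cos_window R s = pi / (4 * R) * cos (a * s)" if "s \<in> {-R..R}"
      using that by (simp add: cos_window_def a_def)
    ultimately show "complex_of_real (cos_window R s) * cis (u * s) = indicator {-R..R} s *\<^sub>R f s"
      by (cases "s \<in> {-R..R}") (auto simp: f_def)
  qed
  also have "\<dots> = F R - F (-R)"
  proof (rule integral_FTC_Icc)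
    show "continuous_on {-R..R} f" unfolding f_def by (intro continuous_intros)
    fix s assume "-R \<le> s" "s \<le> R"
    have d1: "((\<lambda>s. complex_of_real (a * sin (a * s))) has_vector_derivative complex_of_real (a * (a * cos (a * s)))) (at s within {-R..R})"
      by (intro has_vector_derivative_of_real has_real_derivative_iff_has_vector_derivative[THEN iffD1])
        (auto intro!: derivative_eq_intros)
    have d2: "((\<lambda>s. complex_of_real (u * cos (a * s))) has_vector_derivative complex_of_real (u * (- (a * sin (a * s))))) (at s within {-R..R})"
      by (intro has_vector_derivative_of_real has_real_derivative_iff_has_vector_derivative[THEN iffD1])
        (auto intro!: derivative_eq_intros)
    have d3: "((\<lambda>s. cis (u * s)) has_vector_derivative u *\<^sub>R (\<i> * cis (u * s))) (at s within {-R..R})"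
      unfolding has_vector_derivative_def by (auto intro!: derivative_eq_intros simp: mult.commute)
    have gen: "complex_of_real k *
        ((complex_of_real (a * sin (a * s)) * (u *\<^sub>R (\<i> * cis (u * s))) + complex_of_real (a * (a * cos (a * s))) * cis (u * s))
        + (\<i> * complex_of_real (u * cos (a * s)) * (u *\<^sub>R (\<i> * cis (u * s))) + \<i> * complex_of_real (u * (- (a * sin (a * s)))) * cis (u * s)))
      = complex_of_real k * complex_of_real (a\<^sup>2 - u\<^sup>2) * (complex_of_real (cos (a * s)) * cis (u * s))" for k
      by (simp add: scaleR_conv_of_real power2_eq_square algebra_simps)
    have "(F has_vector_derivative (complex_of_real (pi / (4 * R) / (a\<^sup>2 - u\<^sup>2)) *
        ((complex_of_real (a * sin (a * s)) * (u *\<^sub>R (\<i> * cis (u * s))) + complex_of_real (a * (a * cos (a * s))) * cis (u * s))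
        + (\<i> * complex_of_real (u * cos (a * s)) * (u *\<^sub>R (\<i> * cis (u * s))) + \<i> * complex_of_real (u * (- (a * sin (a * s)))) * cis (u * s))))) (at s within {-R..R})"
      unfolding F_def
      by (intro has_vector_derivative_mult_right has_vector_derivative_add has_vector_derivative_mult d1 d2 d3)
    also note gen[of "pi / (4 * R) / (a\<^sup>2 - u\<^sup>2)"]
    also have "complex_of_real (pi / (4 * R) / (a\<^sup>2 - u\<^sup>2)) * complex_of_real (a\<^sup>2 - u\<^sup>2) * (complex_of_real (cos (a * s)) * cis (u * s))
        = complex_of_real (pi / (4 * R) / (a\<^sup>2 - u\<^sup>2) * (a\<^sup>2 - u\<^sup>2) * cos (a * s)) * cis (u * s)"
      by (simp only: of_real_mult mult.assoc)
    also have "pi / (4 * R) / (a\<^sup>2 - u\<^sup>2) * (a\<^sup>2 - u\<^sup>2) = pi / (4 * R)" using au by simp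
    also have "complex_of_real (pi / (4 * R) * cos (a * s)) * cis (u * s) = f s" by (simp add: f_def)
    finally show "(F has_vector_derivative f s) (at s within {-R..R})" .
  qed (use R in auto)
  finally have FT: "FT (\<lambda>s. complex_of_real (cos_window R s)) u = F R - F (-R)" .
  have aR: "a * R = pi / 2" using R by (simp add: a_def)
  have F: "F R = c * (complex_of_real a * cis (u * R))" "F (-R) = - (c * (complex_of_real a * cis (-(u * R))))"
    if "c = complex_of_real (pi / (4 * R) / (a\<^sup>2 - u\<^sup>2))" for c
    unfolding F_def that[symmetric] by (simp_all add: aR)
  have "F R - F (-R) = complex_of_real (pi / (4 * R) / (a\<^sup>2 - u\<^sup>2)) * (complex_of_real a * (cis (u * R) + cis (-(u * R))))"
    by (simp only: F[OF refl] right_diff_distrib distrib_left minus_minus diff_minus_eq_add)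
  also have "cis (u * R) + cis (-(u * R)) = complex_of_real (2 * cos (u * R))"
    by (simp add: complex_eq_iff)
  also have "complex_of_real (pi / (4 * R) / (a\<^sup>2 - u\<^sup>2)) * (complex_of_real a * complex_of_real (2 * cos (u * R))) =
     complex_of_real (pi / (4 * R) / (a\<^sup>2 - u\<^sup>2) * (a * (2 * cos (u * R))))"
    by (simp only: of_real_mult)
  also have "pi / (4 * R) / (a\<^sup>2 - u\<^sup>2) * (a * (2 * cos (u * R))) = a\<^sup>2 * cos (u * R) / (a\<^sup>2 - u\<^sup>2)"
  proof -
    have p: "pi / (4 * R) = a / 2" by (simp add: a_def)
    show ?thesis unfolding p power2_eq_square using au by (simp add: field_simps power2_eq_square)
  qed
  finally show ?thesis by (simp add: FT)
qed

lemma FT_cos_window_0: "R > 0 \<Longrightarrow> FT (\<lambda>s. complex_of_real (cos_window R s)) 0 = 1"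
  by (subst FT_cos_window) auto

text \<open>The first bound is precise enough for the threshold R > pi/g. The second, cruder by a
  constant, reaches down to every nonzero u, because for 2 a^2 > u^2 it exceeds the trivial bound 1.
  The third makes the moduli of the Gram matrix symmetric.\<close>

lemma FT_cos_window_bounds:
  assumes R: "R > 0"
  defines "a \<equiv> pi / (2 * R)"
  shows "a < \<bar>u\<bar> \<Longrightarrow> cmod (FT (\<lambda>s. complex_of_real (cos_window R s)) u) \<le> a\<^sup>2 / (u\<^sup>2 - a\<^sup>2)"
    and "u \<noteq> 0 \<Longrightarrow> cmod (FT (\<lambda>s. complex_of_real (cos_window R s)) u) \<le> 2 * a\<^sup>2 / u\<^sup>2"
    and "cmod (FT (\<lambda>s. complex_of_real (cos_window R s)) (-u)) = cmod (FT (\<lambda>s. complex_of_real (cos_window R s)) u)"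
proof -
  have a: "a > 0" using R by (simp add: a_def)
  let ?H = "FT (\<lambda>s. complex_of_real (cos_window R s))"
  show 1: "cmod (?H u) \<le> a\<^sup>2 / (u\<^sup>2 - a\<^sup>2)" if "a < \<bar>u\<bar>"
  proof -
    have "a\<^sup>2 < u\<^sup>2" using that a by (metis abs_of_pos power2_abs power_strict_mono abs_ge_zero zero_less_numeral less_imp_le)
    then have "cmod (?H u) = a\<^sup>2 * \<bar>cos (u * R)\<bar> / (u\<^sup>2 - a\<^sup>2)"
      by (subst FT_cos_window[OF R]) (auto simp: a_def[symmetric] abs_mult norm_mult norm_divide simp del: of_real_mult of_real_divide of_real_diff)
    also have "\<dots> \<le> a\<^sup>2 * 1 / (u\<^sup>2 - a\<^sup>2)"
      using \<open>a\<^sup>2 < u\<^sup>2\<close> by (intro divide_right_mono mult_left_mono) auto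
    finally show ?thesis by simp
  qed
  have le1: "cmod (?H u) \<le> 1"
  proof -
    have i: "integrable lborel (\<lambda>s. complex_of_real (cos_window R s))"
      by (rule csupp_integrable[OF cos_window_csupp[OF R]])
    have "cmod (?H u) \<le> (LINT s|lborel. cos_window R s)" unfolding FT_def
      by (rule Bochner_Integration.integral_norm_bound_integral)
        (use i csupp_integrable_cis[OF cos_window_csupp[OF R]] cos_window_range[OF R] in
          \<open>auto simp: norm_mult complex_of_real_integrable_eq\<close>)
    also have "complex_of_real \<dots> = ?H 0" by (simp add: FT_def)
    then have "(LINT s|lborel. cos_window R s) = 1" using FT_cos_window_0[OF R]
      by (metis of_real_eq_1_iff)
    finally show ?thesis .
  qed
  show "cmod (?H u) \<le> 2 * a\<^sup>2 / u\<^sup>2" if u: "u \<noteq> 0"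
  proof (cases "2 * a\<^sup>2 \<le> u\<^sup>2")
    case True
    have a2: "a\<^sup>2 > 0" using a by simp
    have "a\<^sup>2 < u\<^sup>2" using True a2 by linarith
    then have "a < \<bar>u\<bar>" using a by (metis abs_of_pos power2_abs power_less_imp_less_base abs_ge_zero)
    then have "cmod (?H u) \<le> a\<^sup>2 / (u\<^sup>2 - a\<^sup>2)" by (rule 1)
    also have "\<dots> \<le> a\<^sup>2 / (u\<^sup>2 / 2)"
      using True u a2 \<open>a\<^sup>2 < u\<^sup>2\<close> by (intro divide_left_mono mult_pos_pos) auto
    finally show ?thesis by (simp add: mult.commute)
  next
    case False
    then have "1 \<le> 2 * a\<^sup>2 / u\<^sup>2" using u by (simp add: field_simps)
    with le1 show ?thesis by linarith
  qed
  have "cnj (?H u) = (LINT s|lborel. cnj (complex_of_real (cos_window R s) * cis (u * s)))"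
    unfolding FT_def by (rule Bochner_Integration.integral_cnj[symmetric])
  also have "\<dots> = ?H (-u)"
    unfolding FT_def by (rule Bochner_Integration.integral_cong) (simp_all add: cis_cnj)
  finally have "?H (-u) = cnj (?H u)" by simp
  then show "cmod (?H (-u)) = cmod (?H u)" by simp
qed

subsection \<open>Sums over separated sets\<close>

definition separated :: "real \<Rightarrow> real set \<Rightarrow> bool" where
  "separated g A \<longleftrightarrow> (\<forall>x\<in>A. \<forall>y\<in>A. x \<noteq> y \<longrightarrow> g \<le> \<bar>x - y\<bar>)"

lemma separated_subset: "separated g A \<Longrightarrow> B \<subseteq> A \<Longrightarrow> separated g B"
  by (auto simp: separated_def)

text \<open>Rounding (y - x)/g down sends distinct points to distinct positive integers, and h is
  decreasing; so the sum is dominated by one over the lattice of multiples of g.\<close>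

lemma separated_sum_right:
  fixes h :: "real \<Rightarrow> real"
  assumes g: "g > 0" and F: "finite F" "separated g F" "\<And>y. y \<in> F \<Longrightarrow> x + g \<le> y"
    and h: "\<And>u v. g \<le> u \<Longrightarrow> u \<le> v \<Longrightarrow> h v \<le> h u"
    and B: "\<And>K. finite K \<Longrightarrow> 0 \<notin> K \<Longrightarrow> (\<Sum>k\<in>K. h (real k * g)) \<le> B"
  shows "(\<Sum>y\<in>F. h (y - x)) \<le> B"
proof -
  define k where "k y = nat \<lfloor>(y - x) / g\<rfloor>" for y
  have k: "real (k y) * g \<le> y - x" "y - x < real (k y) * g + g" "1 \<le> k y" if "y \<in> F" for y
  proof -
    have "1 \<le> (y - x) / g" using F(3)[OF that] g by (simp add: field_simps)
    then have f1: "1 \<le> \<lfloor>(y - x) / g\<rfloor>" by simp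
    then have "real (k y) = of_int \<lfloor>(y - x) / g\<rfloor>" by (simp add: k_def)
    then have "real (k y) \<le> (y - x) / g" "(y - x) / g < real (k y) + 1" by linarith+
    then show "real (k y) * g \<le> y - x" "y - x < real (k y) * g + g" using g by (simp_all add: field_simps)
    show "1 \<le> k y" unfolding k_def using f1 by linarith
  qed
  have inj: "inj_on k F"
  proof (rule inj_onI, rule ccontr)
    fix y z assume yz: "y \<in> F" "z \<in> F" "k y = k z" "y \<noteq> z"
    then have "g \<le> \<bar>y - z\<bar>" using F by (auto simp: separated_def)
    then show False using k(1,2)[OF yz(1)] k(1,2)[OF yz(2)] yz(3) by (auto simp: abs_if split: if_splits)
  qed
  have "(\<Sum>y\<in>F. h (y - x)) \<le> (\<Sum>y\<in>F. h (real (k y) * g))"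
  proof (rule sum_mono)
    fix y assume y: "y \<in> F"
    have "1 * g \<le> real (k y) * g" using k(3)[OF y] g by (intro mult_right_mono) auto
    then show "h (y - x) \<le> h (real (k y) * g)" using k(1)[OF y] by (intro h) auto
  qed
  also have "\<dots> = (\<Sum>j\<in>k ` F. h (real j * g))" by (simp add: sum.reindex[OF inj])
  also have "\<dots> \<le> B" by (rule B) (use F k(3) in force)+
  finally show ?thesis .
qed

lemma separated_sum:
  fixes h :: "real \<Rightarrow> real"
  assumes g: "g > 0" and F: "finite F" "separated g F" "\<And>y. y \<in> F \<Longrightarrow> g \<le> \<bar>y - x\<bar>"
    and h: "\<And>u v. g \<le> u \<Longrightarrow> u \<le> v \<Longrightarrow> h v \<le> h u"
    and B: "\<And>K. finite K \<Longrightarrow> 0 \<notin> K \<Longrightarrow> (\<Sum>k\<in>K. h (real k * g)) \<le> B"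
  shows "(\<Sum>y\<in>F. h \<bar>y - x\<bar>) \<le> 2 * B"
proof -
  let ?P = "{y\<in>F. y \<ge> x}" and ?N = "{y\<in>F. y < x}"
  have "(\<Sum>y\<in>?P. h (y - x)) \<le> B"
    by (rule separated_sum_right[OF g _ separated_subset[OF F(2)] _ h B]) (use F in force)+
  \<comment> \<open>The points to the left of x are reflected, so that the one-sided estimate
    applies to them as well.\<close>
  moreover have "(\<Sum>y\<in>uminus ` ?N. h (y - (-x))) \<le> B"
    by (rule separated_sum_right[OF g _ _ _ h B]) (use F in \<open>force simp: separated_def\<close>)+
  then have "(\<Sum>y\<in>?N. h (x - y)) \<le> B" by (simp add: sum.reindex)
  moreover have "(\<Sum>y\<in>F. h \<bar>y - x\<bar>) = (\<Sum>y\<in>?P. h \<bar>y - x\<bar>) + (\<Sum>y\<in>?N. h \<bar>y - x\<bar>)"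
    using F(1) by (subst sum.union_disjoint[symmetric]) (auto intro!: sum.cong)
  moreover have "(\<Sum>y\<in>?P. h \<bar>y - x\<bar>) = (\<Sum>y\<in>?P. h (y - x))" "(\<Sum>y\<in>?N. h \<bar>y - x\<bar>) = (\<Sum>y\<in>?N. h (x - y))"
    by (auto intro!: sum.cong)
  ultimately show ?thesis by linarith
qed

lemma sum_le_partial_sums:
  fixes f :: "nat \<Rightarrow> real"
  assumes "\<And>n. (\<Sum>k=1..n. f k) \<le> B" "\<And>k. 0 < k \<Longrightarrow> 0 \<le> f k" "finite K" "0 \<notin> K"
  shows "sum f K \<le> B"
proof -
  have "sum f K \<le> sum f {1..Max (insert 0 K)}"
    by (rule sum_mono2) (use assms Max_ge[of "insert 0 K"] in \<open>auto simp: Suc_le_eq intro: gr0I\<close>)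
  also have "\<dots> \<le> B" by (rule assms(1))
  finally show ?thesis .
qed

text \<open>The terms are half the differences of 1/(2k-1) and 1/(2k+1), so the series telescopes;
  1/2 is its exact value, and this exactness yields the threshold pi/g.\<close>

lemma sum_inverse_4k2_1: "finite K \<Longrightarrow> 0 \<notin> K \<Longrightarrow> (\<Sum>k\<in>K. 1 / (4 * (real k)\<^sup>2 - 1)) \<le> 1 / 2"
proof (rule sum_le_partial_sums)
  show "(\<Sum>k=1..n. 1 / (4 * (real k)\<^sup>2 - 1)) \<le> 1 / 2" for n
  proof -
    have "(\<Sum>k=1..n. 1 / (4 * (real k)\<^sup>2 - 1)) = (1 - 1 / (2 * real n + 1)) / 2"
    proof (induction n)
      case (Suc n)
      have "1 / (p * (p + 2)) = (1 / p - 1 / (p + 2)) / 2" if "p > 0" for p :: real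
        using that by (simp add: diff_frac_eq)
      from this[of "2 * real n + 1"]
      have "1 / ((2 * real n + 1) * (2 * real n + 3)) = (1 / (2 * real n + 1) - 1 / (2 * real n + 3)) / 2"
        by (simp add: add.commute)
      also have "(2 * real n + 1) * (2 * real n + 3) = 4 * (real (Suc n))\<^sup>2 - 1"
        by (simp add: power2_eq_square algebra_simps)
      finally show ?case using Suc by simp
    qed auto
    then show ?thesis by simp
  qed
  show "0 \<le> 1 / (4 * (real k)\<^sup>2 - 1)" if "0 < k" for k
  proof -
    have "1 \<le> (real k)\<^sup>2" using that by simp
    then show ?thesis by simp
  qed
qed

lemma sum_inverse_squares: "finite K \<Longrightarrow> 0 \<notin> K \<Longrightarrow> (\<Sum>k\<in>K. 1 / (real k)\<^sup>2) \<le> 2"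
proof (rule sum_le_partial_sums)
  show "(\<Sum>k=1..n. 1 / (real k)\<^sup>2) \<le> 2" for n
  proof -
    have "(\<Sum>k=1..Suc n. 1 / (real k)\<^sup>2) \<le> 2 - 1 / real (Suc n)" for n
    proof (induction n)
      case (Suc n)
      have "1 / (real (Suc (Suc n)))\<^sup>2 \<le> 1 / (real (Suc n) * real (Suc (Suc n)))"
        by (intro divide_left_mono) (auto simp: power2_eq_square)
      also have "\<dots> = 1 / real (Suc n) - 1 / real (Suc (Suc n))"
        by (simp add: field_simps)
      finally show ?case using Suc by simp
    qed auto
    from this[of "n - 1"] show ?thesis by (cases n) (auto intro: order_trans)
  qed
qed auto

text \<open>This is where Ingham's condition enters. R > pi/g means 4 a^2 < g^2, so (k g)^2 - a^2 is
  at least g^2 (4 k^2 - 1)/4; both sides of x together contribute 2 (4 a^2/g^2)(1/2), which equals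
  (pi/(R g))^2 and is below 1.\<close>

lemma cos_window_row_sum:
  assumes g: "g > 0" and R: "R > pi / g" and F: "finite F" "separated g F" "\<And>y. y \<in> F \<Longrightarrow> g \<le> \<bar>y - x\<bar>"
  shows "(\<Sum>y\<in>F. cmod (FT (\<lambda>s. complex_of_real (cos_window R s)) (y - x))) \<le> (pi / (R * g))\<^sup>2"
proof -
  define a where "a = pi / (2 * R)"
  have R0: "R > 0" using R g by (meson divide_pos_pos less_trans pi_gt_zero)
  have a: "a > 0" "2 * a < g" using R R0 g by (auto simp: a_def field_simps)
  have a2: "4 * a\<^sup>2 < g\<^sup>2" using power_strict_mono[OF a(2), of 2] a by simp
  have "(\<Sum>y\<in>F. cmod (FT (\<lambda>s. complex_of_real (cos_window R s)) (y - x))) \<le> (\<Sum>y\<in>F. a\<^sup>2 / (\<bar>y - x\<bar>\<^sup>2 - a\<^sup>2))"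
  proof (rule sum_mono)
    fix y assume "y \<in> F"
    then have "a < \<bar>y - x\<bar>" using F(3)[of y] a by linarith
    then show "cmod (FT (\<lambda>s. complex_of_real (cos_window R s)) (y - x)) \<le> a\<^sup>2 / (\<bar>y - x\<bar>\<^sup>2 - a\<^sup>2)"
      using FT_cos_window_bounds(1)[OF R0, of "y - x"] by (simp add: a_def)
  qed
  also have "\<dots> \<le> 2 * ((4 * a\<^sup>2 / g\<^sup>2) * (1 / 2))"
  proof (rule separated_sum[OF g F])
    fix u v assume uv: "g \<le> u" "u \<le> v"
    have "a\<^sup>2 < u\<^sup>2" using uv a by (intro power_strict_mono) auto
    moreover have "u\<^sup>2 \<le> v\<^sup>2" using uv g by (intro power_mono) auto
    ultimately show "a\<^sup>2 / (v\<^sup>2 - a\<^sup>2) \<le> a\<^sup>2 / (u\<^sup>2 - a\<^sup>2)"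
      by (intro divide_left_mono) (auto intro!: mult_pos_pos)
  next
    fix K :: "nat set" assume K: "finite K" "0 \<notin> K"
    have "(\<Sum>k\<in>K. a\<^sup>2 / ((real k * g)\<^sup>2 - a\<^sup>2)) \<le> (\<Sum>k\<in>K. (4 * a\<^sup>2 / g\<^sup>2) * (1 / (4 * (real k)\<^sup>2 - 1)))"
    proof (rule sum_mono)
      fix k assume "k \<in> K"
      then have "k \<ge> 1" using K by (cases k) auto
      then have k: "(real k)\<^sup>2 \<ge> 1" by simp
      have "g\<^sup>2 * (4 * (real k)\<^sup>2 - 1) / 4 \<le> (real k * g)\<^sup>2 - a\<^sup>2"
        using a2 by (simp add: power_mult_distrib algebra_simps diff_divide_distrib)
      moreover have "g\<^sup>2 * (4 * (real k)\<^sup>2 - 1) / 4 > 0" using k g by simp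
      ultimately have "a\<^sup>2 / ((real k * g)\<^sup>2 - a\<^sup>2) \<le> a\<^sup>2 / (g\<^sup>2 * (4 * (real k)\<^sup>2 - 1) / 4)"
        by (intro divide_left_mono) (auto intro!: mult_pos_pos)
      then show "a\<^sup>2 / ((real k * g)\<^sup>2 - a\<^sup>2) \<le> (4 * a\<^sup>2 / g\<^sup>2) * (1 / (4 * (real k)\<^sup>2 - 1))"
        by (simp add: mult.commute)
    qed
    also have "\<dots> \<le> (4 * a\<^sup>2 / g\<^sup>2) * (1 / 2)"
      unfolding sum_distrib_left[symmetric] by (intro mult_left_mono sum_inverse_4k2_1 K) auto
    finally show "(\<Sum>k\<in>K. a\<^sup>2 / ((real k * g)\<^sup>2 - a\<^sup>2)) \<le> (4 * a\<^sup>2 / g\<^sup>2) * (1 / 2)" .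
  qed
  also have "\<dots> = (pi / (R * g))\<^sup>2" by (simp add: a_def power2_eq_square)
  finally show ?thesis .
qed

text \<open>Meant for the small gap g, where R may lie below pi/g. Quadratic decay of the transform
  then still gives a finite bound, though not a small one; it controls the correction of a newly
  added frequency.\<close>

lemma cos_window_summable:
  assumes g: "g > 0" and R: "R > 0" and A: "separated g A" "\<And>y. y \<in> A \<Longrightarrow> g \<le> \<bar>y - x\<bar>"
  defines "H \<equiv> \<lambda>y. cmod (FT (\<lambda>s. complex_of_real (cos_window R s)) (y - x))"
  shows "H summable_on A" and "infsum H A \<le> 2 * (pi / (R * g))\<^sup>2"
proof -
  define a where "a = pi / (2 * R)"
  have "sum H F \<le> 2 * (pi / (R * g))\<^sup>2" if F: "finite F" "F \<subseteq> A" for F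
  proof -
    have "sum H F \<le> (\<Sum>y\<in>F. 2 * a\<^sup>2 / \<bar>y - x\<bar>\<^sup>2)"
    proof (rule sum_mono)
      fix y assume "y \<in> F"
      then have "y - x \<noteq> 0" using F A(2)[of y] g by auto
      then show "H y \<le> 2 * a\<^sup>2 / \<bar>y - x\<bar>\<^sup>2"
        using FT_cos_window_bounds(2)[OF R, of "y - x"] by (simp add: a_def H_def)
    qed
    also have "\<dots> \<le> 2 * (2 * a\<^sup>2 / g\<^sup>2 * 2)"
    proof (rule separated_sum[OF g F(1) separated_subset[OF A(1) F(2)]])
      show "g \<le> \<bar>y - x\<bar>" if "y \<in> F" for y using A F that by auto
      show "2 * a\<^sup>2 / v\<^sup>2 \<le> 2 * a\<^sup>2 / u\<^sup>2" if "g \<le> u" "u \<le> v" for u v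
        using that g by (intro divide_left_mono power_mono) auto
      fix K :: "nat set" assume K: "finite K" "0 \<notin> K"
      have "(\<Sum>k\<in>K. 2 * a\<^sup>2 / (real k * g)\<^sup>2) = 2 * a\<^sup>2 / g\<^sup>2 * (\<Sum>k\<in>K. 1 / (real k)\<^sup>2)"
        by (simp add: sum_distrib_left sum_divide_distrib power_mult_distrib mult.commute)
      also have "\<dots> \<le> 2 * a\<^sup>2 / g\<^sup>2 * 2" by (intro mult_left_mono sum_inverse_squares K) auto
      finally show "(\<Sum>k\<in>K. 2 * a\<^sup>2 / (real k * g)\<^sup>2) \<le> 2 * a\<^sup>2 / g\<^sup>2 * 2" .
    qed
    also have "\<dots> = 2 * (pi / (R * g))\<^sup>2" by (simp add: a_def power2_eq_square)
    finally show ?thesis .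
  qed
  then show "H summable_on A" "infsum H A \<le> 2 * (pi / (R * g))\<^sup>2"
    using abs_summable_on_finite_bound[of A H "2 * (pi / (R * g))\<^sup>2"] by (auto simp: H_def)
qed

section \<open>Frequencies with a large gap\<close>

text \<open>Functions are indexed by the frequency itself, so that a point can be inserted into the
  set without renumbering. One constant C serves both the sup bound and the Bessel bound.\<close>

definition biorthogonal_family :: "real set \<Rightarrow> real \<Rightarrow> real \<Rightarrow> (real \<Rightarrow> real \<Rightarrow> complex) \<Rightarrow> bool" where
  "biorthogonal_family A R C v \<longleftrightarrow>
     (\<forall>x\<in>A. v x \<in> csupp R \<and> (\<forall>s. cmod (v x s) \<le> C)) \<and>
     (\<forall>x\<in>A. \<forall>y\<in>A. FT (v x) y = (if x = y then 1 else 0)) \<and>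
     (\<forall>F b. finite F \<longrightarrow> F \<subseteq> A \<longrightarrow>
        (LINT s|lborel. (cmod (\<Sum>x\<in>F. b x * v x s))\<^sup>2) \<le> C * (\<Sum>x\<in>F. (cmod (b x))\<^sup>2))"

text \<open>The dual functions are sought as the window times a series of x_y exp(-i y s). The
  transform at z is the sum of x_y H(z - y), so biorthogonality is the linear system (I + D) x =
  e_n, where D is the off-diagonal Gram matrix with column sums at most q < 1. With c the maximum of
  the window, c/(1-q) comes out for both bounds.\<close>

lemma biorthogonal_family_large_gap:
  assumes g: "g > 0" and R: "R > pi / g"
  obtains C where "C > 0" "\<And>A. separated g A \<Longrightarrow> \<exists>v. biorthogonal_family A R C v"
proof -
  have R0: "R > 0" using R g by (meson divide_pos_pos less_trans pi_gt_zero)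
  define q where "q = (pi / (R * g))\<^sup>2"
  have q: "0 \<le> q" "q < 1"
  proof -
    have "pi / (R * g) < 1" using R R0 g by (simp add: field_simps)
    then show "0 \<le> q" "q < 1" using R0 g by (auto simp: q_def power_less_one_iff)
  qed
  define c where "c = pi / (4 * R)"
  have c: "c > 0" using R0 by (simp add: c_def)
  define \<Phi> where "\<Phi> = cos_window R"
  note \<Phi> = cos_window_range[OF R0, folded \<Phi>_def c_def]
  note \<Phi>s = cos_window_csupp[OF R0, folded \<Phi>_def]
  define H where "H = FT (\<lambda>s. complex_of_real (\<Phi> s))"
  have H0: "H 0 = 1" unfolding H_def \<Phi>_def by (rule FT_cos_window_0[OF R0])
  have main: "\<exists>v. biorthogonal_family A R (c / (1 - q)) v" if A: "separated g A" for A
  proof -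
    \<comment> \<open>The diagonal is removed because H(0) = 1 supplies the identity matrix.\<close>
    define D where "D z y = (if z = y then 0 else H (z - y))" for z y
    have D: "(\<Sum>z\<in>F. cmod (D z y)) \<le> q" if "y \<in> A" "finite F" "F \<subseteq> A" for y F
    proof -
      have "(\<Sum>z\<in>F. cmod (D z y)) = (\<Sum>z\<in>F - {y}. cmod (H (z - y)))"
        using that by (intro sum.mono_neutral_cong_right) (auto simp: D_def)
      also have "\<dots> \<le> q" unfolding H_def \<Phi>_def q_def
        by (rule cos_window_row_sum[OF g R])
          (use that A in \<open>auto simp: separated_def subset_iff\<close>)
      finally show ?thesis .
    qed
    have sym: "cmod (D z y) = cmod (D y z)" for y z
      using FT_cos_window_bounds(3)[OF R0, of "y - z"] by (auto simp: D_def H_def \<Phi>_def)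
    define e where "e n y = (if y = n then 1 else 0 :: complex)" for n y :: real
    have e: "((\<lambda>y. cmod (e n y)) has_sum 1) A" if "n \<in> A" for n
      by (rule has_sum_finite_neutralI[of "{n}"]) (use that in \<open>auto simp: e_def\<close>)
    have "\<exists>x. (\<lambda>y. cmod (x y)) summable_on A \<and> (\<Sum>\<^sub>\<infinity>y\<in>A. cmod (x y)) \<le> 1 / (1 - q) \<and>
        (\<forall>z\<in>A. x z + (\<Sum>\<^sub>\<infinity>y\<in>A. D z y * x y) = e n z)" if n: "n \<in> A" for n
    proof -
      have "(\<lambda>y. cmod (e n y)) summable_on A" "(\<Sum>\<^sub>\<infinity>y\<in>A. cmod (e n y)) = 1"
        using e[OF n] by (auto simp: has_sum_iff)
      note en = this
      show ?thesis
        by (rule neumann_series_l1[OF D q en(1)]) (use en(2) in auto)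
    qed
    then obtain X where X: "\<And>n. n \<in> A \<Longrightarrow> (\<lambda>y. cmod (X n y)) summable_on A"
      "\<And>n. n \<in> A \<Longrightarrow> (\<Sum>\<^sub>\<infinity>y\<in>A. cmod (X n y)) \<le> 1 / (1 - q)"
      "\<And>n z. n \<in> A \<Longrightarrow> z \<in> A \<Longrightarrow> X n z + (\<Sum>\<^sub>\<infinity>y\<in>A. D z y * X n y) = e n z"
      by metis
    define f where "f x y s = complex_of_real (\<Phi> s) * (x y * cis (- (y * s)))" for x :: "real \<Rightarrow> complex" and y s
    define V where "V x s = (\<Sum>\<^sub>\<infinity>y\<in>A. f x y s)" for x s
    have fs: "f x y \<in> csupp R" for x y
      unfolding f_def by (intro csupp_mult \<Phi>s continuous_intros)
    have fM: "cmod (f x y s) \<le> c * cmod (x y)" for x y s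
      using \<Phi>[of s] by (auto simp: f_def norm_mult intro!: mult_right_mono)
    have V: "V x \<in> csupp R" "cmod (V x s) \<le> c * (\<Sum>\<^sub>\<infinity>y\<in>A. cmod (x y))"
      "z \<in> A \<Longrightarrow> FT (V x) z = x z + (\<Sum>\<^sub>\<infinity>y\<in>A. D z y * x y)"
      if x: "(\<lambda>y. cmod (x y)) summable_on A" for x s z
    proof -
      note ser = csupp_series[of A "f x" R "\<lambda>y. c * cmod (x y)", OF fs fM summable_on_cmult_right[OF x], folded V_def]
      show "V x \<in> csupp R" by (rule ser(1))
      show "cmod (V x s) \<le> c * (\<Sum>\<^sub>\<infinity>y\<in>A. cmod (x y))"
        using ser(2)[of s] by (simp add: infsum_cmult_right')
      assume z: "z \<in> A"
      have "FT (f x y) z = x y * H (z - y)" for y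
        unfolding FT_def H_def f_def
        by (subst Bochner_Integration.integral_mult_right_zero[symmetric])
          (simp add: mult_ac cis_mult algebra_simps)
      then have "((\<lambda>y. x y * H (z - y)) has_sum FT (V x) z) A" using ser(3)[of z] by simp
      moreover have "((\<lambda>y. (if y = z then x z else 0) + D z y * x y) has_sum (x z + (\<Sum>\<^sub>\<infinity>y\<in>A. D z y * x y))) A"
      proof (intro has_sum_add has_sum_infsum)
        show "((\<lambda>y. if y = z then x z else 0) has_sum x z) A"
          by (rule has_sum_finite_neutralI[of "{z}"]) (use z in auto)
        show "(\<lambda>y. D z y * x y) summable_on A"
          by (rule abs_summable_summable) (rule l1_operator_bound(1)[where q=q, OF D x z])
      qed
      moreover have "(if y = z then x z else 0) + D z y * x y = x y * H (z - y)" for y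
        by (auto simp: D_def H0)
      ultimately show "FT (V x) z = x z + (\<Sum>\<^sub>\<infinity>y\<in>A. D z y * x y)"
        using has_sum_unique by fastforce
    qed
    have q1: "1 / (1 - q) > 0" using q by simp
    show ?thesis
    proof (intro exI[of _ "\<lambda>n. V (X n)"], unfold biorthogonal_family_def, intro conjI ballI allI impI)
      fix n assume n: "n \<in> A"
      show "V (X n) \<in> csupp R" by (rule V(1)[OF X(1)[OF n]])
      show "cmod (V (X n) s) \<le> c / (1 - q)" for s
        using V(2)[OF X(1)[OF n], of s] mult_left_mono[OF X(2)[OF n], of c] c by simp
      show "FT (V (X n)) z = (if n = z then 1 else 0)" if "z \<in> A" for z
        using V(3)[OF X(1)[OF n] that] X(3)[OF n that] by (simp add: e_def)
    next
      fix F and b :: "real \<Rightarrow> complex" assume F: "finite F" "F \<subseteq> A"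
      define x where "x y = (\<Sum>n\<in>F. b n * X n y)" for y
      \<comment> \<open>By linearity the combination of the solutions solves the system with
        right-hand side \<open>b'\<close>, the coefficients extended by zero.\<close>
      define b' where "b' z = (if z \<in> F then b z else 0)" for z
      have x: "(\<lambda>y. cmod (x y)) summable_on A"
      proof (rule Infinite_Sum.abs_summable_on_comparison_test')
        show "(\<lambda>y. \<Sum>n\<in>F. cmod (b n) * cmod (X n y)) summable_on A"
          by (rule has_sum_imp_summable[OF has_sum_sum[where s="\<lambda>n. cmod (b n) * (\<Sum>\<^sub>\<infinity>y\<in>A. cmod (X n y))"]])
            (use X(1) F in \<open>auto intro!: has_sum_cmult_right has_sum_infsum\<close>)
        show "cmod (x y) \<le> (\<Sum>n\<in>F. cmod (b n) * cmod (X n y))" for y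
          unfolding x_def by (rule order_trans[OF norm_sum]) (simp add: norm_mult)
      qed
      have fsum: "(\<lambda>y. f (X n) y s) summable_on A" if "n \<in> A" for n s
        by (rule abs_summable_summable, rule Infinite_Sum.abs_summable_on_comparison_test'[OF summable_on_cmult_right[OF X(1)[OF that], of c]])
          (rule fM)
      have Vx: "V x s = (\<Sum>n\<in>F. b n * V (X n) s)" for s
      proof -
        have "((\<lambda>y. \<Sum>n\<in>F. b n * f (X n) y s) has_sum (\<Sum>n\<in>F. b n * V (X n) s)) A"
          unfolding V_def by (intro has_sum_sum has_sum_cmult_right has_sum_infsum fsum) (use F in auto)
        moreover have "(\<Sum>n\<in>F. b n * f (X n) y s) = f x y s" for y
          by (simp add: f_def x_def sum_distrib_left sum_distrib_right mult_ac)
        ultimately show ?thesis by (simp add: V_def infsumI)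
      qed
      have eq: "x z + (\<Sum>\<^sub>\<infinity>y\<in>A. D z y * x y) = b' z" if z: "z \<in> A" for z
      proof -
        have "FT (V x) z = (\<Sum>n\<in>F. b n * FT (V (X n)) z)"
        proof -
          have "FT (V x) z = (LINT s|lborel. (\<Sum>n\<in>F. b n * (V (X n) s * cis (z * s))))"
            by (simp add: FT_def Vx sum_distrib_right mult.assoc)
          also have "\<dots> = (\<Sum>n\<in>F. (LINT s|lborel. b n * (V (X n) s * cis (z * s))))"
            using F V(1)[OF X(1)]
            by (intro Bochner_Integration.integral_sum integrable_mult_right csupp_integrable_cis) auto
          finally show ?thesis by (simp add: FT_def)
        qed
        also have "\<dots> = (\<Sum>n\<in>F. b n * e n z)"
          using F V(3)[OF X(1)] X(3) z by (intro sum.cong) (auto simp: subset_iff)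
        also have "\<dots> = b' z" using F by (simp add: e_def b'_def if_distrib sum.delta cong: if_cong)
        finally show ?thesis using V(3)[OF x z] by simp
      qed
      have b'2: "((\<lambda>y. (cmod (b' y))\<^sup>2) has_sum (\<Sum>y\<in>F. (cmod (b y))\<^sup>2)) A"
        by (rule has_sum_finite_neutralI[OF F]) (auto simp: b'_def)
      note en = energy_bound_l1[of A D q x b', OF D sym q x _ eq]
      have en1: "(\<lambda>y. cmod (x y) * cmod (b' y)) summable_on A"
        and en2: "(\<Sum>\<^sub>\<infinity>y\<in>A. cmod (x y) * cmod (b' y)) \<le> (\<Sum>y\<in>F. (cmod (b y))\<^sup>2) / (1 - q)"
        using en b'2 by (auto simp: has_sum_iff)
      \<comment> \<open>From here \<open>g\<close> is a family of functions, no longer the gap.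
        Writing \<open>V x\<close> as window times P, the sum \<open>G\<close> of this family is
        \<open>V x\<close> times the conjugate of P, so |V x|^2 is the window times G. Integrating G
        gives the pairing of x with \<open>b'\<close>, which the energy estimate bounds.\<close>
      define g where "g y s = V x s * (cnj (x y) * cis (y * s))" for y s
      define B where "B = c * (\<Sum>\<^sub>\<infinity>y\<in>A. cmod (x y))"
      have g: "g y \<in> csupp R" for y unfolding g_def by (intro csupp_mult V(1) x continuous_intros)
      have gM: "cmod (g y s) \<le> B * cmod (x y)" for y s
        using V(2)[OF x, of s] by (auto simp: g_def B_def norm_mult intro!: mult_right_mono)
      have Bs: "(\<lambda>y. B * cmod (x y)) summable_on A" by (rule summable_on_cmult_right[OF x])
      note gser = csupp_series[of A g R "\<lambda>y. B * cmod (x y)", OF g gM Bs]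
      define G where "G s = (\<Sum>\<^sub>\<infinity>y\<in>A. g y s)" for s
      have GF: "((\<lambda>y. FT (g y) 0) has_sum FT G 0) A" and G: "G \<in> csupp R"
        using gser(3)[of 0] gser(1) unfolding G_def by auto
      have Gs: "complex_of_real ((cmod (V x s))\<^sup>2) = complex_of_real (\<Phi> s) * G s" for s
      proof -
        define P where "P = (\<Sum>\<^sub>\<infinity>y\<in>A. x y * cis (- (y * s)))"
        have 1: "V x s = complex_of_real (\<Phi> s) * P"
          unfolding V_def f_def P_def by (rule infsum_cmult_right')
        have "G s = V x s * (\<Sum>\<^sub>\<infinity>y\<in>A. cnj (x y * cis (- (y * s))))"
          unfolding G_def g_def by (subst infsum_cmult_right') (simp add: cis_cnj)
        also have "\<dots> = V x s * cnj P" unfolding P_def infsum_cnj ..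
        finally have "complex_of_real (\<Phi> s) * G s = V x s * cnj (V x s)"
          by (simp add: 1)
        then show ?thesis by (simp only: complex_norm_square[symmetric] mult.commute)
      qed
      \<comment> \<open>Where the window vanishes the identity says nothing about \<open>G\<close>,
        but there \<open>V x\<close> is 0 and hence so is \<open>G\<close>.\<close>
      have ReG: "0 \<le> Re (G s) \<and> (cmod (V x s))\<^sup>2 \<le> c * Re (G s)" for s
      proof (cases "\<Phi> s = 0")
        case True
        then have "V x s = 0" using Gs[of s] by simp
        then have "G s = 0" by (simp add: G_def g_def)
        then show ?thesis using \<open>V x s = 0\<close> by simp
      next
        case False
        have "(cmod (V x s))\<^sup>2 = \<Phi> s * Re (G s)" using arg_cong[OF Gs[of s], of Re] by simp
        then have *: "(cmod (V x s))\<^sup>2 = \<Phi> s * Re (G s)" .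
        have p: "\<Phi> s > 0" using False \<Phi>[of s] by simp
        have "0 \<le> \<Phi> s * Re (G s)" using *[symmetric] by simp
        then have "0 \<le> Re (G s)" using p by (simp add: zero_le_mult_iff)
        then show ?thesis using * \<Phi>(2)[of s] by (auto intro: mult_right_mono)
      qed
      have "(LINT s|lborel. (cmod (V x s))\<^sup>2) \<le> (LINT s|lborel. c * Re (G s))"
        by (rule integral_mono) (use ReG csupp_integrable_norm2[OF V(1)[OF x]] csupp_integrable[OF G] in auto)
      also have "\<dots> = c * Re (FT G 0)"
        using csupp_integrable[OF G] by (simp add: FT_def)
      also have "Re (FT G 0) \<le> (\<Sum>\<^sub>\<infinity>y\<in>A. cmod (x y) * cmod (b' y))"
      proof (rule has_sum_mono[OF has_sum_Re[OF GF] has_sum_infsum[OF en1]])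
        fix y assume y: "y \<in> A"
        have "FT (g y) 0 = cnj (x y) * FT (V x) y"
          unfolding FT_def g_def by (subst Bochner_Integration.integral_mult_right_zero[symmetric]) (simp add: mult_ac)
        also have "FT (V x) y = b' y" using V(3)[OF x y] eq[OF y] by simp
        finally show "Re (FT (g y) 0) \<le> cmod (x y) * cmod (b' y)"
          using complex_Re_le_cmod[of "cnj (x y) * b' y"] by (simp add: norm_mult)
      qed
      also note en2
      finally show "(LINT s|lborel. (cmod (\<Sum>n\<in>F. b n * V (X n) s))\<^sup>2) \<le> c / (1 - q) * (\<Sum>n\<in>F. (cmod (b n))\<^sup>2)"
        using c by (simp add: Vx)
    qed
  qed
  show thesis by (rule that[of "c / (1 - q)"]) (use c q main in auto)
qed

subsection \<open>Adding one frequency\<close>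

text \<open>\<open>f \<mapsto> f - local_avg w d f\<close> multiplies \<open>FT f z\<close> by a factor that vanishes at \<open>z = w\<close> and is bounded
  away from 0 when \<open>\<bar>z - w\<bar>\<close> is.\<close>

definition local_avg :: "real \<Rightarrow> real \<Rightarrow> (real \<Rightarrow> complex) \<Rightarrow> real \<Rightarrow> complex" where
  "local_avg w d f s =
     (LINT h|lborel. indicator {-d..d} h *\<^sub>R (complex_of_real (1 / (2 * d)) * cis (- (w * h)) * f (s - h)))"

lemma csupp_bounded:
  assumes "f \<in> csupp R"
  obtains B where "B \<ge> 0" "\<And>s. cmod (f s) \<le> B"
proof -
  have "compact (f ` {-\<bar>R\<bar>..\<bar>R\<bar>})"
    using assms by (intro compact_continuous_image) (auto simp: csupp_def intro: continuous_on_subset)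
  then obtain B where B: "B > 0" "\<And>s. s \<in> {-\<bar>R\<bar>..\<bar>R\<bar>} \<Longrightarrow> cmod (f s) \<le> B"
    by (metis bounded_pos compact_imp_bounded imageI)
  have "cmod (f s) \<le> B" for s
    using B assms by (cases "s \<in> {-\<bar>R\<bar>..\<bar>R\<bar>}") (auto simp: csupp_def)
  then show thesis using that[of B] B by auto
qed

lemma local_avg_integrable:
  assumes d: "d > 0" and f: "continuous_on UNIV f"
  shows "integrable lborel (\<lambda>h. indicator {-d..d} h *\<^sub>R (complex_of_real (1 / (2 * d)) * cis (- (w * h)) * f (s - h)))"
  by (rule borel_integrable_compact)
    (use d in \<open>auto intro!: continuous_intros continuous_on_compose2[OF f]\<close>)

lemma local_avg_sum:
  assumes d: "d > 0" and f: "\<And>x. x \<in> F \<Longrightarrow> continuous_on UNIV (f x)"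
  shows "local_avg w d (\<lambda>s. \<Sum>x\<in>F. b x * f x s) s = (\<Sum>x\<in>F. b x * local_avg w d (f x) s)"
proof -
  have "local_avg w d (\<lambda>s. \<Sum>x\<in>F. b x * f x s) s =
    (LINT h|lborel. (\<Sum>x\<in>F. b x * (indicator {-d..d} h *\<^sub>R (complex_of_real (1 / (2 * d)) * cis (- (w * h)) * f x (s - h)))))"
    unfolding local_avg_def
    by (rule Bochner_Integration.integral_cong) (simp_all only: sum_distrib_left scaleR_sum_right mult_scaleR_right mult_scaleR_left mult_ac)
  also have "\<dots> = (\<Sum>x\<in>F. (LINT h|lborel. b x * (indicator {-d..d} h *\<^sub>R (complex_of_real (1 / (2 * d)) * cis (- (w * h)) * f x (s - h)))))"
    by (intro Bochner_Integration.integral_sum integrable_mult_right local_avg_integrable d f)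
  finally show ?thesis
    by (simp only: local_avg_def Bochner_Integration.integral_mult_right_zero)
qed

lemma integral_box:
  assumes "d > 0"
  shows "integrable lborel (\<lambda>h. indicator {-d..d} h * (1 / (2 * d)) :: real)"
    and "(LINT h|lborel. indicator {-d..d} h * (1 / (2 * d))) = (1::real)"
  using assms by (auto intro!: integrable_mult_left)

text \<open>\<open>local_avg\<close> is a mean, for the uniform probability on [-d,d], of translates
  of f multiplied by unimodular factors. The second bound is Cauchy-Schwarz for that
  probability.\<close>

lemma local_avg_norm:
  assumes d: "d > 0" and f: "f \<in> csupp R"
  shows "(\<And>s. cmod (f s) \<le> C) \<Longrightarrow> cmod (local_avg w d f s) \<le> C"
    and "(cmod (local_avg w d f s))\<^sup>2 \<le> (LINT h|lborel. indicator {-d..d} h *\<^sub>R ((1 / (2 * d)) * (cmod (f (s - h)))\<^sup>2))"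
proof -
  have cf: "continuous_on UNIV f" using f by (simp add: csupp_def)
  define \<phi> where "\<phi> h = cmod (f (s - h))" for h
  have c\<phi>: "continuous_on A \<phi>" for A
    unfolding \<phi>_def by (intro continuous_intros continuous_on_compose2[OF cf]) auto
  have i: "integrable lborel (\<lambda>h. indicator {-d..d} h *\<^sub>R ((1 / (2 * d)) * g h))" if "continuous_on {-d..d} g" for g :: "real \<Rightarrow> real"
    by (rule borel_integrable_compact) (use that d in \<open>auto intro!: continuous_intros\<close>)
  define m where "m = (LINT h|lborel. indicator {-d..d} h *\<^sub>R ((1 / (2 * d)) * \<phi> h))"
  have le: "cmod (local_avg w d f s) \<le> m"
    unfolding local_avg_def m_def
    by (rule Bochner_Integration.integral_norm_bound_integral[OF local_avg_integrable[OF d cf] i[OF c\<phi>]])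
      (use d in \<open>auto simp: norm_mult \<phi>_def indicator_def norm_divide\<close>)
  show "cmod (local_avg w d f s) \<le> C" if C: "\<And>s. cmod (f s) \<le> C"
  proof -
    have "m \<le> (LINT h|lborel. C * (indicator {-d..d} h * (1 / (2 * d))))" unfolding m_def
      by (rule integral_mono[OF i[OF c\<phi>] integrable_mult_right[OF integral_box(1)[OF d]]])
        (use d C in \<open>auto simp: \<phi>_def indicator_def divide_right_mono\<close>)
    also have "\<dots> = C" using integral_box[OF d] by simp
    finally show ?thesis using le by simp
  qed
  \<comment> \<open>Nonnegativity of the variance of \<phi> about its mean m, expanded to give m^2
    at most the mean of \<phi>^2.\<close>
  have "0 \<le> (LINT h|lborel. indicator {-d..d} h *\<^sub>R ((1 / (2 * d)) * (\<phi> h - m)\<^sup>2))"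
    by (rule integral_nonneg_AE) (use d in auto)
  also have "\<dots> = (LINT h|lborel. indicator {-d..d} h *\<^sub>R ((1 / (2 * d)) * (\<phi> h)\<^sup>2)
      - (2 * m) * (indicator {-d..d} h *\<^sub>R ((1 / (2 * d)) * \<phi> h)) + m\<^sup>2 * (indicator {-d..d} h * (1 / (2 * d))))"
    by (rule Bochner_Integration.integral_cong)
      (auto simp: indicator_def power2_eq_square algebra_simps diff_divide_distrib add_divide_distrib)
  also have "\<dots> = (LINT h|lborel. indicator {-d..d} h *\<^sub>R ((1 / (2 * d)) * (\<phi> h)\<^sup>2)) - (2 * m) * m + m\<^sup>2 * 1"
    (is "(LINT h|lborel. ?a h - ?b h + ?c h) = _")
  proof -
    have ia: "integrable lborel ?a" and ib: "integrable lborel ?b" and ic: "integrable lborel ?c"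
      by (rule i, intro continuous_intros c\<phi>)
        (rule integrable_mult_right, rule i, rule c\<phi>, rule integrable_mult_right, rule integral_box(1)[OF d])
    have "integral\<^sup>L lborel ?b = (2 * m) * m" "integral\<^sup>L lborel ?c = m\<^sup>2 * 1"
      unfolding m_def by (simp_all only: Bochner_Integration.integral_mult_right_zero integral_box(2)[OF d])
    then show ?thesis
      by (subst Bochner_Integration.integral_add[OF Bochner_Integration.integrable_diff[OF ia ib] ic],
          subst Bochner_Integration.integral_diff[OF ia ib]) simp
  qed
  finally have "m\<^sup>2 \<le> (LINT h|lborel. indicator {-d..d} h *\<^sub>R ((1 / (2 * d)) * (\<phi> h)\<^sup>2))"
    by (simp add: power2_eq_square)
  moreover have "(cmod (local_avg w d f s))\<^sup>2 \<le> m\<^sup>2" using le by (intro power_mono) auto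
  ultimately show "(cmod (local_avg w d f s))\<^sup>2 \<le> (LINT h|lborel. indicator {-d..d} h *\<^sub>R ((1 / (2 * d)) * (cmod (f (s - h)))\<^sup>2))"
    by (simp add: \<phi>_def)
qed

lemma local_avg_csupp:
  assumes d: "d > 0" and f: "f \<in> csupp R"
  shows "local_avg w d f \<in> csupp (R + d)"
proof -
  have cf: "continuous_on UNIV f" using f by (simp add: csupp_def)
  obtain B where B: "B \<ge> 0" "\<And>s. cmod (f s) \<le> B" using csupp_bounded[OF f] by metis
  have "continuous (at s) (local_avg w d f)" for s
  proof (rule continuous_at_sequentiallyI)
    fix u :: "nat \<Rightarrow> real" assume u: "u \<longlonglongrightarrow> s"
    show "(\<lambda>n. local_avg w d f (u n)) \<longlonglongrightarrow> local_avg w d f s"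
      unfolding local_avg_def
    proof (rule integral_dominated_convergence)
      show "integrable lborel (\<lambda>h. B * (indicator {-d..d} h * (1 / (2 * d))))"
        by (intro integrable_mult_right integral_box d)
      show "AE h in lborel. (\<lambda>n. indicator {-d..d} h *\<^sub>R (complex_of_real (1 / (2 * d)) * cis (- (w * h)) * f (u n - h)))
         \<longlonglongrightarrow> indicator {-d..d} h *\<^sub>R (complex_of_real (1 / (2 * d)) * cis (- (w * h)) * f (s - h))"
        using cf u by (intro AE_I2 tendsto_intros isCont_tendsto_compose[of _ f]) (auto simp: continuous_on_eq_continuous_at)
      show "AE h in lborel. cmod (indicator {-d..d} h *\<^sub>R (complex_of_real (1 / (2 * d)) * cis (- (w * h)) * f (u n - h)))
          \<le> B * (indicator {-d..d} h * (1 / (2 * d)))" for n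
        using d B by (intro AE_I2) (auto simp: norm_mult norm_divide indicator_def divide_right_mono)
    qed (use borel_measurable_integrable[OF local_avg_integrable[OF d cf]] in auto)
  qed
  moreover have "local_avg w d f s = 0" if "R + d < \<bar>s\<bar>" for s
  proof -
    have "local_avg w d f s = (LINT h::real|lborel. 0)" unfolding local_avg_def
      by (rule Bochner_Integration.integral_cong)
        (use f that in \<open>auto simp: csupp_def indicator_def\<close>)
    then show ?thesis by simp
  qed
  ultimately show ?thesis by (auto simp: csupp_def continuous_on_eq_continuous_at)
qed

text \<open>The integrability that Fubini requires for the two convolution integrals below: h is cut
  to [-d,d], and the support in s is bounded uniformly over those h.\<close>

lemma integrable_strip:
  fixes F :: "real \<times> real \<Rightarrow> 'b::{banach, second_countable_topology}"
  assumes "continuous_on UNIV F" "\<And>h s. \<bar>h\<bar> \<le> d \<Longrightarrow> R < \<bar>s\<bar> \<Longrightarrow> F (h, s) = 0"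
  shows "integrable (lborel \<Otimes>\<^sub>M lborel) (\<lambda>(h, s). indicator {-d..d} h *\<^sub>R F (h, s))"
proof -
  have "integrable lborel (\<lambda>p. indicator ({-d..d} \<times> {-R..R}) p *\<^sub>R F p)"
    by (rule borel_integrable_compact) (auto intro!: compact_Times continuous_on_subset[OF assms(1)])
  also have "(\<lambda>p. indicator ({-d..d} \<times> {-R..R}) p *\<^sub>R F p) = (\<lambda>(h, s). indicator {-d..d} h *\<^sub>R F (h, s))"
    using assms(2) by (force simp: indicator_def fun_eq_iff)
  finally show ?thesis by (simp add: lborel_prod)
qed

lemma lborel_integral_shift:
  fixes f :: "real \<Rightarrow> 'b::{banach, second_countable_topology}"
  shows "(LINT s|lborel. f (s - h)) = (LINT s|lborel. f s)"
proof -
  have "(LINT s|lborel. f (s - h)) = \<bar>1\<bar> *\<^sub>R (LINT s|lborel. f (h + 1 * s - h))"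
    by (rule lborel_integral_real_affine) simp
  also have "\<dots> = (LINT s|lborel. f s)" unfolding abs_one scaleR_one
    by (rule Bochner_Integration.integral_cong) auto
  finally show ?thesis .
qed

text \<open>Averaging contracts L2: Cauchy-Schwarz in h, then Fubini, then translation invariance in
  s.\<close>

lemma local_avg_L2:
  assumes d: "d > 0" and f: "f \<in> csupp R"
  shows "(LINT s|lborel. (cmod (local_avg w d f s))\<^sup>2) \<le> (LINT s|lborel. (cmod (f s))\<^sup>2)"
proof -
  have cf: "continuous_on UNIV f" using f by (simp add: csupp_def)
  define F where "F = (\<lambda>(h, s). (1 / (2 * d)) * (cmod (f (s - h)))\<^sup>2)"
  have cF: "continuous_on UNIV F" unfolding F_def case_prod_beta
    by (intro continuous_intros continuous_on_compose2[OF cf]) auto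
  have F0: "F (h, s) = 0" if "\<bar>h\<bar> \<le> d" "R + d < \<bar>s\<bar>" for h s
    using f that by (auto simp: F_def csupp_def)
  note I = integrable_strip[of F d "R + d", OF cF F0]
  have "(LINT s|lborel. (cmod (local_avg w d f s))\<^sup>2) \<le> (LINT s|lborel. LINT h|lborel. indicator {-d..d} h *\<^sub>R F (h, s))"
  proof (rule integral_mono)
    show "integrable lborel (\<lambda>s. (cmod (local_avg w d f s))\<^sup>2)"
      by (rule csupp_integrable_norm2[OF local_avg_csupp[OF d f]])
    show "integrable lborel (\<lambda>s. LINT h|lborel. indicator {-d..d} h *\<^sub>R F (h, s))"
      using lborel_pair.integrable_snd[of "\<lambda>h s. indicator {-d..d} h *\<^sub>R F (h, s)"] I by simp
    show "(cmod (local_avg w d f s))\<^sup>2 \<le> (LINT h|lborel. indicator {-d..d} h *\<^sub>R F (h, s))" for s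
      using local_avg_norm(2)[OF d f, of w s] by (simp add: F_def)
  qed
  also have "\<dots> = (LINT h|lborel. LINT s|lborel. indicator {-d..d} h *\<^sub>R F (h, s))"
    using lborel_pair.Fubini_integral[of "\<lambda>h s. indicator {-d..d} h *\<^sub>R F (h, s)"] I by simp
  also have "\<dots> = (LINT h|lborel. (LINT s|lborel. (cmod (f s))\<^sup>2) * (indicator {-d..d} h * (1 / (2 * d))))"
    using lborel_integral_shift[of "\<lambda>s. (cmod (f s))\<^sup>2"]
    by (intro Bochner_Integration.integral_cong) (auto simp: F_def indicator_def)
  also have "\<dots> = (LINT s|lborel. (cmod (f s))\<^sup>2)"
    using integral_box[OF d] by simp
  finally show ?thesis .
qed

text \<open>This is sin(u d)/(u d) for u \<noteq> 0. It stays an integral because only its value at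
  0 and its real part elsewhere are needed to bound 1 minus it away from 0.\<close>

definition box_factor :: "real \<Rightarrow> real \<Rightarrow> complex" where
  "box_factor d u = (LINT h|lborel. indicator {-d..d} h *\<^sub>R (complex_of_real (1 / (2 * d)) * cis (u * h)))"

text \<open>The convolution theorem: \<open>local_avg\<close> is the convolution of f with the
  normalised box, modulated by the frequency -w.\<close>

lemma FT_local_avg:
  assumes d: "d > 0" and f: "f \<in> csupp R"
  shows "FT (local_avg w d f) z = FT f z * box_factor d (z - w)"
proof -
  have cf: "continuous_on UNIV f" using f by (simp add: csupp_def)
  define F where "F = (\<lambda>(h, s). complex_of_real (1 / (2 * d)) * cis (- (w * h)) * f (s - h) * cis (z * s))"
  have cF: "continuous_on UNIV F" unfolding F_def case_prod_beta
    by (intro continuous_intros continuous_on_compose2[OF cf]) auto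
  have F0: "F (h, s) = 0" if "\<bar>h\<bar> \<le> d" "R + d < \<bar>s\<bar>" for h s
    using f that by (auto simp: F_def csupp_def)
  note I = integrable_strip[of F d "R + d", OF cF F0]
  have "FT (local_avg w d f) z = (LINT s|lborel. LINT h|lborel. indicator {-d..d} h *\<^sub>R F (h, s))"
    unfolding FT_def
  proof (rule Bochner_Integration.integral_cong[OF refl])
    fix s
    show "local_avg w d f s * cis (z * s) = (LINT h|lborel. indicator {-d..d} h *\<^sub>R F (h, s))"
      unfolding local_avg_def F_def prod.case
      by (subst Bochner_Integration.integral_mult_left_zero[symmetric]) (simp only: mult_scaleR_left)
  qed
  also have "\<dots> = (LINT h|lborel. LINT s|lborel. indicator {-d..d} h *\<^sub>R F (h, s))"
    using lborel_pair.Fubini_integral[of "\<lambda>h s. indicator {-d..d} h *\<^sub>R F (h, s)"] I by simp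
  also have "\<dots> = (LINT h|lborel. FT f z * (indicator {-d..d} h *\<^sub>R (complex_of_real (1 / (2 * d)) * cis ((z - w) * h))))"
  proof (rule Bochner_Integration.integral_cong[OF refl])
    fix h
    have "(LINT s|lborel. f (s - h) * cis (z * s)) = (LINT s|lborel. f (s - h) * cis (z * (s - h)) * cis (z * h))"
      by (rule Bochner_Integration.integral_cong) (simp_all add: mult.assoc cis_mult algebra_simps)
    also have "\<dots> = FT f z * cis (z * h)"
      unfolding FT_def Bochner_Integration.integral_mult_left_zero
      by (subst lborel_integral_shift[of "\<lambda>s. f s * cis (z * s)" h]) rule
    finally have 1: "(LINT s|lborel. f (s - h) * cis (z * s)) = FT f z * cis (z * h)" .
    have "(LINT s|lborel. indicator {-d..d} h *\<^sub>R F (h, s)) =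
       indicator {-d..d} h *\<^sub>R (complex_of_real (1 / (2 * d)) * cis (- (w * h)) * (LINT s|lborel. f (s - h) * cis (z * s)))"
      unfolding F_def prod.case by (simp only: integral_scaleR_right mult.assoc Bochner_Integration.integral_mult_right_zero)
    also have "\<dots> = FT f z * (indicator {-d..d} h *\<^sub>R (complex_of_real (1 / (2 * d)) * (cis (- (w * h)) * cis (z * h))))"
      unfolding 1 by (simp add: mult_ac)
    finally show "(LINT s|lborel. indicator {-d..d} h *\<^sub>R F (h, s)) =
       FT f z * (indicator {-d..d} h *\<^sub>R (complex_of_real (1 / (2 * d)) * cis ((z - w) * h)))"
      by (simp add: cis_mult algebra_simps)
  qed
  also have "\<dots> = FT f z * box_factor d (z - w)"
    unfolding box_factor_def by (rule Bochner_Integration.integral_mult_right_zero)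
  finally show ?thesis .
qed

lemma box_factor_0: "d > 0 \<Longrightarrow> box_factor d 0 = 1"
proof -
  assume d: "d > 0"
  have "box_factor d 0 = complex_of_real (LINT h|lborel. indicator {-d..d} h * (1 / (2 * d)))"
    unfolding box_factor_def integral_complex_of_real[symmetric]
    by (rule Bochner_Integration.integral_cong) (auto simp: indicator_def)
  then show ?thesis by (simp only: integral_box(2)[OF d] of_real_1)
qed

lemma Re_box_factor:
  assumes d: "d > 0" and u: "u \<noteq> 0"
  shows "Re (box_factor d u) = sin (u * d) / (u * d)"
proof -
  have "integrable lborel (\<lambda>h. indicator {-d..d} h *\<^sub>R (complex_of_real (1 / (2 * d)) * cis (u * h)))"
    by (rule borel_integrable_compact) (use d in \<open>auto intro!: continuous_intros\<close>)
  then have "Re (box_factor d u) = (LINT h|lborel. indicator {-d..d} h *\<^sub>R ((1 / (2 * d)) * cos (u * h)))"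
    unfolding box_factor_def
    by (subst integral_Re[symmetric]) (auto intro!: Bochner_Integration.integral_cong)
  also have "\<dots> = (1 / (2 * d)) * (sin (u * d) / u) - (1 / (2 * d)) * (sin (u * (-d)) / u)"
  proof (rule integral_FTC_Icc)
    show "((\<lambda>h. (1 / (2 * d)) * (sin (u * h) / u)) has_vector_derivative (1 / (2 * d)) * cos (u * h)) (at h within {-d..d})" for h
      unfolding has_real_derivative_iff_has_vector_derivative[symmetric]
      using u d by (auto intro!: derivative_eq_intros)
  qed (use d in \<open>auto intro!: continuous_intros\<close>)
  also have "\<dots> = sin (u * d) / (u * d)" using d u by (simp add: field_simps)
  finally show ?thesis .
qed

text \<open>sin y < y on the compact interval from x0 to max(x0, 2) gives a strict maximum below 1,
  beyond 2 the quotient is at most 1/2, and evenness covers negative x. Since c depends on x0 alone,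
  the factor in the insertion step is bounded below uniformly.\<close>

lemma sinc_gap:
  fixes x0 :: real
  assumes x0: "x0 > 0"
  obtains c where "c > 0" "\<And>x. x0 \<le> \<bar>x\<bar> \<Longrightarrow> sin x / x \<le> 1 - c"
proof -
  define x1 where "x1 = max x0 2"
  have "compact {x0..x1}" "{x0..x1} \<noteq> {}" "continuous_on {x0..x1} (\<lambda>x. sin x / x)"
    using x0 by (auto simp: x1_def intro!: continuous_intros)
  from continuous_attains_sup[OF this]
  obtain y where y: "y \<in> {x0..x1}" "\<And>x. x \<in> {x0..x1} \<Longrightarrow> sin x / x \<le> sin y / y"
    by blast
  have y0: "y > 0" using y x0 by auto
  have "sin y < y"
  proof (cases "y \<le> 1")
    case True
    then have "y / 2 < pi" "y / 2 < 1" using pi_gt_zero pi_ge_two by linarith+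
    then have "sin (y / 2) > 0" "cos (y / 2) < cos 0"
      using y0 cos_monotone_0_pi[of 0 "y / 2"] by (auto intro!: sin_gt_zero)
    then have "sin (y / 2) * cos (y / 2) < sin (y / 2)" by simp
    also have "\<dots> \<le> y / 2" using y0 by (intro sin_x_le_x) auto
    finally show ?thesis using sin_double[of "y / 2"] by simp
  qed (use sin_le_one[of y] in linarith)
  then have y1: "sin y / y < 1" using y x0 by simp
  define m where "m = sin y / y"
  note y(2)[folded m_def] y1[folded m_def]
  note m = this
  define c where "c = min (1 / 2) (1 - m)"
  have pos: "sin x / x \<le> 1 - c" if "x0 \<le> x" for x
  proof (cases "x \<le> x1")
    case True
    then show ?thesis using m(1)[of x] that by (auto simp: c_def)
  next
    case False
    then have "x > 2" by (auto simp: x1_def)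
    then have "sin x * 2 \<le> x" using sin_le_one[of x] by linarith
    then have "sin x / x \<le> 1 / 2" using \<open>x > 2\<close> by (simp add: field_simps)
    moreover have "c \<le> 1 / 2" unfolding c_def by (rule min.cobounded1)
    ultimately show ?thesis by linarith
  qed
  show thesis
  proof (rule that[of c])
    show "c > 0" unfolding c_def using m(2) by linarith
    show "sin x / x \<le> 1 - c" if "x0 \<le> \<bar>x\<bar>" for x
    proof (cases "x \<ge> 0")
      case True
      then show ?thesis using that by (intro pos) simp
    next
      case False
      then have "x0 \<le> - x" using that by simp
      then have "sin (- x) / (- x) \<le> 1 - c" by (rule pos)
      then show ?thesis by simp
    qed
  qed
qed

lemma norm_diff_power2_le: "(norm (a - b))\<^sup>2 \<le> 2 * (norm a)\<^sup>2 + 2 * (norm b)\<^sup>2"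
  for a b :: "'a::real_normed_vector"
proof -
  have "(norm (a - b))\<^sup>2 \<le> (norm a + norm b)\<^sup>2"
    by (intro power_mono norm_triangle_ineq4) auto
  also have "\<dots> \<le> 2 * (norm a)\<^sup>2 + 2 * (norm b)\<^sup>2"
    using zero_le_power2[of "norm a - norm b"] by (simp add: power2_eq_square algebra_simps)
  finally show ?thesis .
qed

lemma norm_add_power2_le: "(norm (a + b))\<^sup>2 \<le> 2 * (norm a)\<^sup>2 + 2 * (norm b)\<^sup>2"
  for a b :: "'a::real_normed_vector"
  using norm_diff_power2_le[of a "- b"] by simp

lemma integral_norm2_bounded_support:
  assumes f: "f \<in> csupp R" and R: "R \<ge> 0" and C: "\<And>s. cmod (f s) \<le> C"
  shows "(LINT s|lborel. (cmod (f s))\<^sup>2) \<le> 2 * R * C\<^sup>2"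
proof -
  have "(LINT s|lborel. (cmod (f s))\<^sup>2) \<le> (LINT s|lborel. C\<^sup>2 * indicator {-R..R} s)"
  proof (rule integral_mono[OF csupp_integrable_norm2[OF f]])
    show "integrable lborel (\<lambda>s. C\<^sup>2 * indicator {-R..R} s :: real)"
      by (rule integrable_mult_right, rule integrable_real_indicator) (auto simp: emeasure_lborel_Icc_eq)
    show "(cmod (f s))\<^sup>2 \<le> C\<^sup>2 * indicator {-R..R} s" for s
      using f power_mono[OF C[of s], of 2] by (cases "s \<in> {-R..R}") (auto simp: csupp_def)
  qed
  also have "\<dots> = 2 * R * C\<^sup>2" using R by simp
  finally show ?thesis .
qed

text \<open>Applying L = identity minus \<open>local_avg\<close> at w multiplies transforms by
  \<mu>, which vanishes at w and has modulus at least c on A because points there are g away from w.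
  Dividing by \<mu> restores duality on A and annihilates w. The function for w itself is a window
  modulated to w, with its values on A removed by means of the modified family. Every constant is
  built from g, d, R and C.\<close>

lemma biorthogonal_family_insert:
  assumes g: "g > 0" and d: "d > 0" and R: "R > 0" and C: "C > 0"
  obtains C' where "C' > 0"
    "\<And>A w v. separated g (insert w A) \<Longrightarrow> w \<notin> A \<Longrightarrow> biorthogonal_family A R C v
       \<Longrightarrow> \<exists>v'. biorthogonal_family (insert w A) (R + d) C' v'"
proof -
  obtain c where c: "c > 0" "\<And>x. g * d \<le> \<bar>x\<bar> \<Longrightarrow> sin x / x \<le> 1 - c"
    using sinc_gap[of "g * d"] g d by (metis mult_pos_pos)
  define R' where "R' = R + d"
  have R': "R' > 0" using R d by (simp add: R'_def)
  define K where "K = pi / (4 * R')"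
  define B where "B = 2 * (pi / (R' * g))\<^sup>2"
  \<comment> \<open>Bounds for the modified family \<open>v1\<close>: L at most doubles the sup norm
    and at most quadruples the squared L2 norm, while dividing by \<mu> costs 1/c and 1/c^2
    respectively.\<close>
  define C1 where "C1 = max (2 * C / c) (4 * C / c\<^sup>2)"
  define C0 where "C0 = K + C1 * B"
  \<comment> \<open>\<open>C0\<close> bounds the new function \<open>v0\<close>, whose squared norm
    is then at most 2 R' C0^2. Splitting a combination into its \<open>v0\<close> part and the rest
    doubles both squared norms, hence 4 R' C0^2 and 2 C1.\<close>
  define C' where "C' = C0 + 2 * C1 + 4 * R' * C0\<^sup>2"
  have C1: "C1 > 0" "2 * C / c \<le> C1" "4 * C / c\<^sup>2 \<le> C1" using C c by (auto simp: C1_def less_max_iff_disj)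
  have B: "B \<ge> 0" by (simp add: B_def)
  have K: "K > 0" using R' by (simp add: K_def)
  have C0: "C0 > 0" using K C1 B by (simp add: C0_def add_pos_nonneg)
  have C'le: "C0 \<le> C'" "C1 \<le> C'" "C' > 0"
    using C0 C1 R' by (simp_all add: C'_def add_pos_nonneg)
  have main: "\<exists>v'. biorthogonal_family (insert w A) R' C' v'"
    if sep: "separated g (insert w A)" and w: "w \<notin> A" and v: "biorthogonal_family A R C v" for A w v
  proof -
    have vA: "v y \<in> csupp R" "\<And>s. cmod (v y s) \<le> C" if "y \<in> A" for y
      using v that by (auto simp: biorthogonal_family_def)
    have vFT: "FT (v x) y = (if x = y then 1 else 0)" if "x \<in> A" "y \<in> A" for x y
      using v that by (auto simp: biorthogonal_family_def)
    have vL2: "(LINT s|lborel. (cmod (\<Sum>x\<in>F. b x * v x s))\<^sup>2) \<le> C * (\<Sum>x\<in>F. (cmod (b x))\<^sup>2)"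
      if "finite F" "F \<subseteq> A" for F b
      using v that by (auto simp: biorthogonal_family_def)
    have dist: "g \<le> \<bar>y - w\<bar>" if "y \<in> A" for y
      using sep w that unfolding separated_def by (metis insertI1 insertI2)
    define L where "L f s = f s - local_avg w d f s" for f s
    define \<mu> where "\<mu> y = 1 - box_factor d (y - w)" for y
    have \<mu>: "c \<le> cmod (\<mu> y)" if y: "y \<in> A" for y
    proof -
      have "y - w \<noteq> 0" using dist[OF y] g by auto
      then have "Re (\<mu> y) = 1 - sin ((y - w) * d) / ((y - w) * d)"
        using Re_box_factor[OF d] by (simp add: \<mu>_def)
      moreover have "g * d \<le> \<bar>(y - w) * d\<bar>" using dist[OF y] d by (simp add: abs_mult)
      then have "sin ((y - w) * d) / ((y - w) * d) \<le> 1 - c" by (rule c(2))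
      ultimately show ?thesis using complex_Re_le_cmod[of "\<mu> y"] by linarith
    qed
    have \<mu>0: "\<mu> y \<noteq> 0" if "y \<in> A" for y using \<mu>[OF that] c by auto
    have Ls: "L f \<in> csupp R'" if "f \<in> csupp R" for f
      unfolding L_def R'_def by (intro csupp_diff local_avg_csupp d that csupp_mono[OF that]) (use d in simp)
    have LFT: "FT (L f) z = FT f z * \<mu> z" if "f \<in> csupp R" for f z
    proof -
      have "FT (L f) z = FT f z - FT (local_avg w d f) z"
        unfolding L_def using FT_diff[OF csupp_mono[OF that] local_avg_csupp[OF d that]] d by simp
      then show ?thesis by (simp add: FT_local_avg[OF d that] \<mu>_def algebra_simps)
    qed
    have LL2: "(LINT s|lborel. (cmod (L f s))\<^sup>2) \<le> 4 * (LINT s|lborel. (cmod (f s))\<^sup>2)" if f: "f \<in> csupp R" for f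
    proof -
      have a: "integrable lborel (\<lambda>s. 2 * (cmod (f s))\<^sup>2)" "integrable lborel (\<lambda>s. 2 * (cmod (local_avg w d f s))\<^sup>2)"
        by (intro integrable_mult_right csupp_integrable_norm2[OF f] csupp_integrable_norm2[OF local_avg_csupp[OF d f]])+
      have "(LINT s|lborel. (cmod (L f s))\<^sup>2) \<le> (LINT s|lborel. 2 * (cmod (f s))\<^sup>2 + 2 * (cmod (local_avg w d f s))\<^sup>2)"
        by (rule integral_mono[OF csupp_integrable_norm2[OF Ls[OF f]] Bochner_Integration.integrable_add[OF a]])
          (simp add: L_def norm_diff_power2_le)
      also have "\<dots> = 2 * (LINT s|lborel. (cmod (f s))\<^sup>2) + 2 * (LINT s|lborel. (cmod (local_avg w d f s))\<^sup>2)"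
        by (subst Bochner_Integration.integral_add[OF a]) simp
      also have "\<dots> \<le> 4 * (LINT s|lborel. (cmod (f s))\<^sup>2)"
        using local_avg_L2[OF d f, of w] by simp
      finally show ?thesis .
    qed
    define v1 where "v1 y s = (1 / \<mu> y) * L (v y) s" for y s
    have v1s: "v1 y \<in> csupp R'" if "y \<in> A" for y
      unfolding v1_def by (intro csupp_scale Ls vA that)
    have v1b: "cmod (v1 y s) \<le> C1" if y: "y \<in> A" for y s
    proof -
      have "cmod (L (v y) s) \<le> 2 * C"
        unfolding L_def using norm_triangle_ineq4[of "v y s" "local_avg w d (v y) s"]
          vA(2)[OF y, of s] local_avg_norm(1)[OF d vA(1)[OF y] vA(2)[OF y], of w s] by linarith
      then have "cmod (v1 y s) \<le> 2 * C / cmod (\<mu> y)"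
        by (simp add: v1_def norm_mult norm_divide divide_right_mono)
      also have "\<dots> \<le> 2 * C / c" using \<mu>[OF y] c C by (intro divide_left_mono) (auto intro!: mult_pos_pos \<mu>0[OF y])
      finally show ?thesis using C1 by linarith
    qed
    have v1FT: "FT (v1 x) y = (if x = y then 1 else 0)" if x: "x \<in> A" and y: "y \<in> insert w A" for x y
    proof -
      have "FT (v1 x) y = (1 / \<mu> x) * (FT (v x) y * \<mu> y)"
        unfolding v1_def by (simp only: FT_scale LFT[OF vA(1)[OF x]])
      then show ?thesis
        using x y w \<mu>0[OF x] box_factor_0[OF d] by (cases "y = w") (auto simp: vFT \<mu>_def)
    qed
    have v1L2: "(LINT s|lborel. (cmod (\<Sum>x\<in>F. b x * v1 x s))\<^sup>2) \<le> C1 * (\<Sum>x\<in>F. (cmod (b x))\<^sup>2)"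
      if F: "finite F" "F \<subseteq> A" for F b
    proof -
      define f where "f s = (\<Sum>x\<in>F. (b x / \<mu> x) * v x s)" for s
      have f: "f \<in> csupp R" unfolding f_def by (intro csupp_sum csupp_scale vA) (use F in auto)
      have "L f s = (\<Sum>x\<in>F. b x * v1 x s)" for s
      proof -
        have "local_avg w d f s = (\<Sum>x\<in>F. (b x / \<mu> x) * local_avg w d (v x) s)"
          unfolding f_def by (rule local_avg_sum[OF d]) (use F vA(1) in \<open>auto simp: csupp_def\<close>)
        then show ?thesis
          by (simp add: L_def f_def v1_def sum_subtractf right_diff_distrib diff_divide_distrib)
      qed
      then have "(LINT s|lborel. (cmod (\<Sum>x\<in>F. b x * v1 x s))\<^sup>2) \<le> 4 * (LINT s|lborel. (cmod (f s))\<^sup>2)"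
        using LL2[OF f] by simp
      also have "\<dots> \<le> 4 * (C * (\<Sum>x\<in>F. (cmod (b x / \<mu> x))\<^sup>2))"
        unfolding f_def by (intro mult_left_mono vL2 F) auto
      also have "\<dots> \<le> 4 * (C * (\<Sum>x\<in>F. (cmod (b x))\<^sup>2 / c\<^sup>2))"
      proof (intro mult_left_mono sum_mono)
        fix x assume "x \<in> F"
        then have "c\<^sup>2 \<le> (cmod (\<mu> x))\<^sup>2" using \<mu>[of x] c F by (intro power_mono) auto
        then show "(cmod (b x / \<mu> x))\<^sup>2 \<le> (cmod (b x))\<^sup>2 / c\<^sup>2"
          using c unfolding norm_divide power_divide
          by (intro divide_left_mono mult_pos_pos) (auto intro: less_le_trans[of 0 "c\<^sup>2"])
      qed (use C in auto)
      also have "\<dots> = (4 * C / c\<^sup>2) * (\<Sum>x\<in>F. (cmod (b x))\<^sup>2)"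
        by (simp add: sum_divide_distrib[symmetric])
      also have "\<dots> \<le> C1 * (\<Sum>x\<in>F. (cmod (b x))\<^sup>2)"
        using C1 by (intro mult_right_mono sum_nonneg) auto
      finally show ?thesis .
    qed
    define W where "W s = complex_of_real (cos_window R' s) * cis (- (w * s))" for s
    have Ws: "W \<in> csupp R'" unfolding W_def by (intro csupp_mult cos_window_csupp R' continuous_intros)
    have WFT: "FT W z = FT (\<lambda>s. complex_of_real (cos_window R' s)) (z - w)" for z
      unfolding FT_def W_def
      by (rule Bochner_Integration.integral_cong) (simp_all add: mult.assoc cis_mult algebra_simps)
    have sepA: "separated g A" by (rule separated_subset[OF sep]) auto
    note Wsum = cos_window_summable[OF g R' sepA dist, folded WFT B_def]
    \<comment> \<open>\<open>U\<close> interpolates the transform of \<open>W\<close> on A and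
      vanishes at w, as every \<open>v1 y\<close> does. So \<open>W\<close> minus \<open>U\<close>
      vanishes on A and keeps the value 1 at w.\<close>
    define U where "U s = (\<Sum>\<^sub>\<infinity>y\<in>A. FT W y * v1 y s)" for s
    have b1: "(\<lambda>s. FT W y * v1 y s) \<in> csupp R'" if "y \<in> A" for y
      by (intro csupp_scale v1s that)
    have b2: "cmod (FT W y * v1 y s) \<le> cmod (FT W y) * C1" if "y \<in> A" for y s
      using v1b[OF that, of s] by (auto simp: norm_mult intro!: mult_left_mono)
    have b3: "(\<lambda>y. cmod (FT W y) * C1) summable_on A"
      by (rule summable_on_cmult_left[OF Wsum(1)])
    note Us = csupp_series[of A "\<lambda>y s. FT W y * v1 y s" R' "\<lambda>y. cmod (FT W y) * C1", OF b1 b2 b3, folded U_def]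
    define v0 where "v0 s = W s - U s" for s
    have v0s: "v0 \<in> csupp R'" unfolding v0_def by (intro csupp_diff Ws Us)
    have v0b: "cmod (v0 s) \<le> C0" for s
    proof -
      have "cmod (U s) \<le> (\<Sum>\<^sub>\<infinity>y\<in>A. cmod (FT W y) * C1)" by (rule Us(2))
      also have "\<dots> \<le> B * C1" using Wsum(2) C1 by (simp add: infsum_cmult_left' mult_right_mono)
      finally have "cmod (U s) \<le> C1 * B" by (simp add: mult.commute)
      moreover have "cmod (W s) \<le> K"
        using cos_window_range[OF R', of s] by (simp add: W_def norm_mult K_def)
      ultimately show ?thesis
        unfolding v0_def C0_def using norm_triangle_ineq4[of "W s" "U s"] by linarith
    qed
    have v0FT: "FT v0 z = (if w = z then 1 else 0)" if z: "z \<in> insert w A" for z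
    proof -
      have "((\<lambda>y. FT W y * (if y = z then 1 else 0)) has_sum FT U z) A"
        using Us(3)[of z] v1FT[OF _ z] by (subst has_sum_cong[of _ _ "\<lambda>y. FT (\<lambda>s. FT W y * v1 y s) z"]) (auto simp: FT_scale)
      moreover have "((\<lambda>y. FT W y * (if y = z then 1 else 0)) has_sum (if z \<in> A then FT W z else 0)) A"
        by (rule has_sum_finite_neutralI[of "A \<inter> {z}"]) auto
      ultimately have "FT U z = (if z \<in> A then FT W z else 0)" by (rule has_sum_unique)
      moreover have "FT v0 z = FT W z - FT U z" unfolding v0_def by (rule FT_diff[OF Ws Us(1)])
      moreover have "FT W w = 1" unfolding WFT using FT_cos_window_0[OF R'] by simp
      ultimately show ?thesis using z w by auto
    qed
    define v' where "v' y = (if y = w then v0 else v1 y)" for y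
    have "biorthogonal_family (insert w A) R' C' v'"
      unfolding biorthogonal_family_def
    proof (intro conjI ballI allI impI)
      fix y assume y: "y \<in> insert w A"
      show "v' y \<in> csupp R'" using y v0s v1s by (auto simp: v'_def)
      show "cmod (v' y s) \<le> C'" for s
        using y v0b[of s] v1b[of y s] C'le by (auto simp: v'_def)
      fix z assume z: "z \<in> insert w A"
      show "FT (v' y) z = (if y = z then 1 else 0)"
        using y z v0FT[OF z] v1FT[of y z] by (auto simp: v'_def)
    next
      fix F and b :: "real \<Rightarrow> complex" assume F: "finite F" "F \<subseteq> insert w A"
      define F1 where "F1 = F - {w}"
      have F1: "finite F1" "F1 \<subseteq> A" using F by (auto simp: F1_def)
      define h where "h s = (\<Sum>x\<in>F1. b x * v1 x s)" for s
      have h: "h \<in> csupp R'" unfolding h_def by (intro csupp_sum csupp_scale v1s) (use F1 in auto)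
      have hL2: "(LINT s|lborel. (cmod (h s))\<^sup>2) \<le> C1 * (\<Sum>x\<in>F1. (cmod (b x))\<^sup>2)"
        unfolding h_def by (rule v1L2[OF F1])
      have e1: "(\<Sum>x\<in>F1. b x * v' x s) = h s" for s
        unfolding h_def by (rule sum.cong) (auto simp: v'_def F1_def)
      define b0 where "b0 = (if w \<in> F then b w else 0)"
      have e2: "(\<Sum>x\<in>F. b x * v' x s) = b0 * v0 s + h s" for s
        using F(1) e1[of s] by (cases "w \<in> F") (auto simp: F1_def b0_def v'_def sum.remove)
      have e3: "(\<Sum>x\<in>F. (cmod (b x))\<^sup>2) = (cmod b0)\<^sup>2 + (\<Sum>x\<in>F1. (cmod (b x))\<^sup>2)"
        using F(1) by (cases "w \<in> F") (auto simp: F1_def b0_def sum.remove)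
      have i: "integrable lborel (\<lambda>s. 2 * (cmod (b0 * v0 s))\<^sup>2)" "integrable lborel (\<lambda>s. 2 * (cmod (h s))\<^sup>2)"
        by (intro integrable_mult_right csupp_integrable_norm2[OF csupp_scale[OF v0s]] csupp_integrable_norm2[OF h])+
      have "(LINT s|lborel. (cmod (\<Sum>x\<in>F. b x * v' x s))\<^sup>2) \<le> (LINT s|lborel. 2 * (cmod (b0 * v0 s))\<^sup>2 + 2 * (cmod (h s))\<^sup>2)"
        unfolding e2
        by (rule integral_mono[OF csupp_integrable_norm2[OF csupp_add[OF csupp_scale[OF v0s] h]] Bochner_Integration.integrable_add[OF i]])
          (rule norm_add_power2_le)
      also have "\<dots> = 2 * ((cmod b0)\<^sup>2 * (LINT s|lborel. (cmod (v0 s))\<^sup>2)) + 2 * (LINT s|lborel. (cmod (h s))\<^sup>2)"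
        by (subst Bochner_Integration.integral_add[OF i]) (simp add: norm_mult power_mult_distrib)
      also have "\<dots> \<le> 2 * ((cmod b0)\<^sup>2 * (2 * R' * C0\<^sup>2)) + 2 * (C1 * (\<Sum>x\<in>F1. (cmod (b x))\<^sup>2))"
        by (intro add_mono mult_left_mono hL2 integral_norm2_bounded_support v0s v0b) (use R' in auto)
      also have "\<dots> = (4 * R' * C0\<^sup>2) * (cmod b0)\<^sup>2 + (2 * C1) * (\<Sum>x\<in>F1. (cmod (b x))\<^sup>2)" by simp
      also have "\<dots> \<le> C' * (cmod b0)\<^sup>2 + C' * (\<Sum>x\<in>F1. (cmod (b x))\<^sup>2)"
        using C0 C1 R' by (intro add_mono mult_right_mono sum_nonneg) (auto simp: C'_def)
      finally show "(LINT s|lborel. (cmod (\<Sum>x\<in>F. b x * v' x s))\<^sup>2) \<le> C' * (\<Sum>x\<in>F. (cmod (b x))\<^sup>2)"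
        by (simp add: e3 distrib_left)
    qed
    then show ?thesis by blast
  qed
  show thesis by (rule that[of C']) (use C'le main in \<open>auto simp: R'_def\<close>)
qed

text \<open>Induction on the number of exceptional frequencies. The constant depends on that number
  and not on their positions, because the insertion constant is uniform over all sets with gap
  g.\<close>

lemma biorthogonal_family_finite_small_gaps:
  assumes g: "g > 0" and G: "G > 0"
  shows "R > pi / G \<Longrightarrow> \<exists>C>0. \<forall>A F. separated G A \<longrightarrow> separated g (F \<union> A) \<longrightarrow> finite F \<longrightarrow> card F = k \<longrightarrow> F \<inter> A = {} \<longrightarrow>
     (\<exists>v. biorthogonal_family (F \<union> A) R C v)"
proof (induction k arbitrary: R)
  case 0
  obtain C where "C > 0" "\<And>A. separated G A \<Longrightarrow> \<exists>v. biorthogonal_family A R C v"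
    using biorthogonal_family_large_gap[OF G 0] by metis
  then show ?case by (intro exI[of _ C]) auto
next
  case (Suc k)
  \<comment> \<open>Each insertion spends half of the surplus of R over pi/G, so the base case is
    still reached with a radius above pi/G.\<close>
  define R0 where "R0 = (R + pi / G) / 2"
  have "p < r \<Longrightarrow> p < (r + p) / 2" "p < r \<Longrightarrow> (r + p) / 2 < r" for p r :: real by simp_all
  note R0 = this[OF Suc.prems, folded R0_def]
  have R00: "R0 > 0" using R0 G by (meson divide_pos_pos less_trans pi_gt_zero)
  obtain C where C: "C > 0" "\<And>A F. separated G A \<Longrightarrow> separated g (F \<union> A) \<Longrightarrow> finite F \<Longrightarrow> card F = k \<Longrightarrow> F \<inter> A = {} \<Longrightarrow>
     \<exists>v. biorthogonal_family (F \<union> A) R0 C v"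
    using Suc.IH[OF R0(1)] by blast
  obtain C' where C': "C' > 0"
    "\<And>A w v. separated g (insert w A) \<Longrightarrow> w \<notin> A \<Longrightarrow> biorthogonal_family A R0 C v
       \<Longrightarrow> \<exists>v'. biorthogonal_family (insert w A) (R0 + (R - R0)) C' v'"
    using biorthogonal_family_insert[OF g _ R00 C(1), of "R - R0"] R0 by (metis diff_gt_0_iff_gt)
  show ?case
  proof (intro exI[of _ C'] conjI allI impI C'(1))
    fix A F assume A: "separated G A" "separated g (F \<union> A)" "finite F" "card F = Suc k" "F \<inter> A = {}"
    then obtain w F1 where F1: "F = insert w F1" "w \<notin> F1" "card F1 = k" by (metis card_Suc_eq)
    then obtain v where v: "biorthogonal_family (F1 \<union> A) R0 C v"
      using C(2)[OF A(1) separated_subset[OF A(2)], of F1] A by auto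
    then show "\<exists>v. biorthogonal_family (F \<union> A) R C' v"
      using C'(2)[of w "F1 \<union> A", OF _ _ v] A F1 by auto
  qed
qed

section \<open>The transmutation kernel\<close>

lemma power_le_fact_exp:
  fixes x :: real
  assumes "x \<ge> 0"
  shows "x ^ n \<le> fact n * exp x"
proof -
  have s: "(\<lambda>k. x ^ k / fact k) sums exp x"
    using exp_converges[of x] by (simp add: divide_inverse mult.commute)
  have "(\<Sum>k\<in>{n}. x ^ k / fact k) \<le> exp x"
    unfolding sums_unique[OF s] by (rule sum_le_suminf) (use s assms in \<open>auto simp: sums_iff\<close>)
  then show ?thesis by (simp add: field_simps)
qed

text \<open>In the kernel series one j! compensates the factorial in Cauchy's estimate, the other
  leaves an exponential series, and 2^j cancels the 2 in (2/r)^j.\<close>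

lemma fact_square_le: "2 ^ k * (fact k)\<^sup>2 \<le> (fact (2 * k + 1) :: real)"
proof (induction k)
  case (Suc k)
  have "2 ^ Suc k * (fact (Suc k))\<^sup>2 = (2 * (real k + 1)\<^sup>2) * (2 ^ k * (fact k)\<^sup>2 :: real)"
    by (simp add: power_mult_distrib power2_eq_square algebra_simps)
  also have "\<dots> \<le> ((2 * real k + 3) * (2 * real k + 2)) * fact (2 * k + 1)"
  proof (rule mult_mono[OF _ Suc])
    have "0 \<le> real k * real k" by simp
    then show "2 * (real k + 1)\<^sup>2 \<le> (2 * real k + 3) * (2 * real k + 2)"
      by (simp add: power2_eq_square algebra_simps)
  qed auto
  also have "\<dots> = fact (2 * Suc k + 1)" by (simp add: algebra_simps)
  finally show ?case .
qed simp

section \<open>An exponential pulse flat at both ends of (0,T)\<close>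

definition pulse :: "real \<Rightarrow> real \<Rightarrow> complex \<Rightarrow> complex" where
  "pulse a T z = exp (- (of_real a * (1 / z + 1 / (of_real T - z))))"

text \<open>The derivative is the complex one, so that Cauchy's estimates apply; only then is it
  restricted to (0,T) and extended by zero.\<close>

definition pulse_deriv :: "real \<Rightarrow> real \<Rightarrow> nat \<Rightarrow> real \<Rightarrow> real" where
  "pulse_deriv a T k t = (if 0 < t \<and> t < T then Re ((deriv ^^ k) (pulse a T) (of_real t)) else 0)"

lemma pulse_holomorphic: "(deriv ^^ k) (pulse a T) holomorphic_on - {0, of_real T}"
proof -
  have "pulse a T holomorphic_on - {0, of_real T}"
    unfolding pulse_def[abs_def] by (auto intro!: holomorphic_intros)
  then show ?thesis by (rule holomorphic_higher_deriv) auto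
qed

text \<open>Inversion maps the circle with diameter [r/2, 3r/2] to the circle with diameter
  [2/(3r), 2/r]; the minimum is attained at z = 3r/2.\<close>

lemma Re_inverse_ge:
  assumes "r > 0" "cmod (z - of_real r) \<le> r / 2"
  shows "2 / (3 * r) \<le> Re (1 / z)"
proof -
  define x y where "x = Re z" and "y = Im z"
  have "(cmod (z - of_real r))\<^sup>2 \<le> (r / 2)\<^sup>2" using assms by (intro power_mono) auto
  then have 1: "(x - r)\<^sup>2 + y\<^sup>2 \<le> r\<^sup>2 / 4"
    by (simp add: cmod_power2 x_def y_def power_divide)
  have "\<bar>x - r\<bar> \<le> r / 2" using abs_Re_le_cmod[of "z - of_real r"] assms by (simp add: x_def)
  from abs_le_D1[OF this] abs_le_D2[OF this] have x: "r / 2 \<le> x" "x \<le> 3 * r / 2" by simp_all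
  have pos: "x\<^sup>2 + y\<^sup>2 > 0" using x assms by (intro add_pos_nonneg) auto
  have "r * x \<le> r * (3 * r / 2)" using x assms by (intro mult_left_mono) auto
  then have "2 * (x\<^sup>2 + y\<^sup>2) \<le> x * (3 * r)" using 1 by (simp add: power2_eq_square algebra_simps)
  then have "2 / (3 * r) \<le> x / (x\<^sup>2 + y\<^sup>2)" using pos assms by (simp add: divide_le_eq pos_le_divide_eq mult.commute)
  then show ?thesis by (simp add: Re_divide x_def y_def)
qed

text \<open>Here r is the distance from t to the nearer endpoint. The singularity there contributes
  2/(3r) to the real part, and the other one contributes something nonnegative.\<close>

lemma pulse_bound:
  assumes a: "a \<ge> 0" and r: "0 < r" "r \<le> t" "r \<le> T - t" "r = t \<or> r = T - t" and z: "cmod (z - of_real t) \<le> r / 2"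
  shows "cmod (pulse a T z) \<le> exp (- (2 * a / (3 * r)))"
proof -
  have Re0: "0 \<le> Re (1 / w)" if "Re w \<ge> 0" for w using that by (simp add: Re_divide)
  have "\<bar>Re z - t\<bar> \<le> r / 2" using abs_Re_le_cmod[of "z - of_real t"] z by simp
  note rez = abs_le_D1[OF this] abs_le_D2[OF this]
  have "2 / (3 * r) \<le> Re (1 / z) + Re (1 / (of_real T - z))"
  proof (cases "r = t")
    case True
    then have "2 / (3 * r) \<le> Re (1 / z)" using Re_inverse_ge[of r z] z r by simp
    moreover have "0 \<le> Re (1 / (of_real T - z))" by (rule Re0) (use rez r in auto)
    ultimately show ?thesis by linarith
  next
    case False
    then have "r = T - t" using r by simp
    then have "(of_real T - z) - of_real r = - (z - of_real t)" by simp
    then have "cmod ((of_real T - z) - of_real r) \<le> r / 2" using z by (metis norm_minus_cancel)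
    then have "2 / (3 * r) \<le> Re (1 / (of_real T - z))" using Re_inverse_ge r by blast
    moreover have "0 \<le> Re (1 / z)" by (rule Re0) (use rez r in auto)
    ultimately show ?thesis by linarith
  qed
  then have "a * (2 / (3 * r)) \<le> a * (Re (1 / z) + Re (1 / (of_real T - z)))"
    using a by (rule mult_left_mono)
  then show ?thesis by (simp add: pulse_def del: Re_divide_of_real)
qed

lemma pulse_deriv_bound:
  assumes a: "a \<ge> 0" and t: "0 < t" "t < T"
  defines "r \<equiv> min t (T - t)"
  shows "\<bar>pulse_deriv a T k t\<bar> \<le> fact k * exp (- (2 * a / (3 * r))) * (2 / r) ^ k"
proof -
  have r: "0 < r" "r \<le> t" "r \<le> T - t" "r = t \<or> r = T - t" using t by (auto simp: r_def)
  have sub: "cball (of_real t) (r / 2) \<subseteq> - {0, of_real T :: complex}"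
  proof (rule subsetI)
    fix z :: complex assume "z \<in> cball (of_real t) (r / 2)"
    then have "cmod (z - of_real t) \<le> r / 2" by (simp add: dist_norm norm_minus_commute)
    then have "\<bar>Re z - t\<bar> \<le> r / 2" using abs_Re_le_cmod[of "z - of_real t"] by simp
    from abs_le_D1[OF this] abs_le_D2[OF this] have "0 < Re z" "Re z < T" using r by auto
    then show "z \<in> - {0, of_real T}" by auto
  qed
  have "cmod ((deriv ^^ k) (pulse a T) (of_real t)) \<le> fact k * exp (- (2 * a / (3 * r))) / (r / 2) ^ k"
  proof (rule Cauchy_inequality)
    show "pulse a T holomorphic_on ball (of_real t) (r / 2)"
      using pulse_holomorphic[of 0 a T] sub by (auto intro: holomorphic_on_subset[OF _ order_trans[OF ball_subset_cball]])
    show "continuous_on (cball (of_real t) (r / 2)) (pulse a T)"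
      using pulse_holomorphic[of 0 a T] sub by (auto intro: holomorphic_on_imp_continuous_on holomorphic_on_subset)
    show "cmod (pulse a T x) \<le> exp (- (2 * a / (3 * r)))" if "cmod (of_real t - x) = r / 2" for x
      by (rule pulse_bound[OF a r]) (use that in \<open>simp add: norm_minus_commute\<close>)
  qed (use r in auto)
  also have "\<dots> = fact k * exp (- (2 * a / (3 * r))) * (2 / r) ^ k"
    by (simp add: power_divide)
  finally show ?thesis
    using abs_Re_le_cmod[of "(deriv ^^ k) (pulse a T) (of_real t)"] t by (simp add: pulse_deriv_def)
qed

text \<open>With u = 2a/(3r), the factor exp(-u) absorbs u^(k+1), hence the negative powers of r,
  and leaves one factor r to spare. This makes the extension by zero continuous at 0 and T.\<close>

lemma pulse_deriv_linear_bound: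
  assumes a: "a > 0"
  obtains M where "M \<ge> 0" "\<And>t. \<bar>pulse_deriv a T k t\<bar> \<le> M * \<bar>t\<bar>" "\<And>t. \<bar>pulse_deriv a T k t\<bar> \<le> M * \<bar>T - t\<bar>"
proof -
  define M where "M = fact k * fact (Suc k) * 2 ^ k * (3 / (2 * a)) ^ Suc k"
  have M: "M \<ge> 0" using a by (simp add: M_def)
  have *: "\<bar>pulse_deriv a T k t\<bar> \<le> M * min t (T - t)" if t: "0 < t" "t < T" for t
  proof -
    define r where "r = min t (T - t)"
    have r: "r > 0" using t by (simp add: r_def)
    define u where "u = 2 * a / (3 * r)"
    have u: "u > 0" using a r by (simp add: u_def)
    have "u ^ Suc k \<le> fact (Suc k) * exp u" by (rule power_le_fact_exp) (use u in simp)
    then have "exp (- u) \<le> fact (Suc k) / u ^ Suc k"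
      using u by (simp add: exp_minus field_simps del: fact_Suc power_Suc)
    then have "fact k * exp (- u) * (2 / r) ^ k \<le> fact k * (fact (Suc k) / u ^ Suc k) * (2 / r) ^ k"
      using r by (intro mult_right_mono mult_left_mono) auto
    also have "1 / u = (3 / (2 * a)) * r" by (simp add: u_def)
    then have "1 / u ^ Suc k = (3 / (2 * a)) ^ Suc k * r ^ Suc k"
      by (metis power_mult_distrib power_one_over)
    then have "fact k * (fact (Suc k) / u ^ Suc k) * (2 / r) ^ k = fact k * fact (Suc k) * ((3 / (2 * a)) ^ Suc k * r ^ Suc k) * (2 / r) ^ k"
      by (metis times_divide_eq_right mult.assoc mult.right_neutral)
    also have "\<dots> = M * r" using r by (simp add: M_def power_divide del: fact_Suc)
    finally show ?thesis using pulse_deriv_bound[of a t T k] a t by (simp add: u_def r_def)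
  qed
  show thesis
  proof (rule that[OF M])
    fix t
    show "\<bar>pulse_deriv a T k t\<bar> \<le> M * \<bar>t\<bar>" "\<bar>pulse_deriv a T k t\<bar> \<le> M * \<bar>T - t\<bar>"
    proof -
      have "\<bar>pulse_deriv a T k t\<bar> \<le> M * \<bar>t\<bar> \<and> \<bar>pulse_deriv a T k t\<bar> \<le> M * \<bar>T - t\<bar>"
      proof (cases "0 < t \<and> t < T")
        case True
        then have "M * min t (T - t) \<le> M * \<bar>t\<bar>" "M * min t (T - t) \<le> M * \<bar>T - t\<bar>"
          using M by (intro mult_left_mono; simp)+
        then show ?thesis using *[of t] True by linarith
      qed (use M in \<open>auto simp: pulse_deriv_def\<close>)
      then show "\<bar>pulse_deriv a T k t\<bar> \<le> M * \<bar>t\<bar>" "\<bar>pulse_deriv a T k t\<bar> \<le> M * \<bar>T - t\<bar>" by auto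
    qed
  qed
qed

lemma pulse_deriv_has_derivative:
  assumes t: "0 < t" "t < T"
  shows "(pulse_deriv a T k has_real_derivative pulse_deriv a T (Suc k) t) (at t)"
proof -
  have op: "open (- {0, of_real T :: complex})" by auto
  have "complex_of_real t \<in> - {0, of_real T}" using t by auto
  then have "((deriv ^^ k) (pulse a T) has_field_derivative (deriv ^^ Suc k) (pulse a T) (of_real t)) (at (of_real t))"
    using holomorphic_derivI[OF pulse_holomorphic[of k a T] op, of "of_real t"] by simp
  then have "((\<lambda>x. (deriv ^^ k) (pulse a T) (of_real x)) has_vector_derivative (deriv ^^ Suc k) (pulse a T) (of_real t)) (at t)"
    by (rule has_vector_derivative_real_field)
  then have "((\<lambda>x. Re ((deriv ^^ k) (pulse a T) (of_real x))) has_vector_derivative Re ((deriv ^^ Suc k) (pulse a T) (of_real t))) (at t)"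
    by (rule bounded_linear.has_vector_derivative[OF bounded_linear_Re])
  then have "((\<lambda>x. Re ((deriv ^^ k) (pulse a T) (of_real x))) has_real_derivative pulse_deriv a T (Suc k) t) (at t)"
    using t by (simp add: has_real_derivative_iff_has_vector_derivative pulse_deriv_def)
  then show ?thesis
    by (rule has_field_derivative_transform_within_open[of _ _ _ "{0<..<T}"])
      (use t in \<open>auto simp: pulse_deriv_def\<close>)
qed

lemma pulse_deriv_continuous:
  assumes a: "a > 0"
  shows "continuous_on UNIV (pulse_deriv a T k)"
proof -
  obtain M where M: "M \<ge> 0" "\<And>t. \<bar>pulse_deriv a T k t\<bar> \<le> M * \<bar>t\<bar>" "\<And>t. \<bar>pulse_deriv a T k t\<bar> \<le> M * \<bar>T - t\<bar>"
    using pulse_deriv_linear_bound[OF a, of T k] by blast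
  have "isCont (pulse_deriv a T k) t" for t
  proof -
    consider "0 < t \<and> t < T" | "t = 0" | "t = T" | "t < 0 \<or> t > T" by linarith
    then show ?thesis
    proof cases
      case 1
      then show ?thesis using pulse_deriv_has_derivative DERIV_isCont by blast
    next
      case 2
      have l: "((\<lambda>x. M * \<bar>x\<bar>) \<longlongrightarrow> 0) (at 0)" by (auto intro!: tendsto_eq_intros)
      have "(pulse_deriv a T k \<longlongrightarrow> 0) (at 0)"
        by (rule Lim_null_comparison[OF always_eventually l]) (use M(2) in simp)
      then show ?thesis using 2 by (simp add: isCont_def pulse_deriv_def[of _ _ _ 0])
    next
      case 3
      have l: "((\<lambda>x. M * \<bar>T - x\<bar>) \<longlongrightarrow> 0) (at T)" by (auto intro!: tendsto_eq_intros)
      have "(pulse_deriv a T k \<longlongrightarrow> 0) (at T)"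
        by (rule Lim_null_comparison[OF always_eventually l]) (use M(3) in simp)
      then show ?thesis using 3 by (simp add: isCont_def pulse_deriv_def[of _ _ _ T])
    next
      case 4
      have "eventually (\<lambda>x. x \<in> {..<0} \<union> {T<..}) (nhds t)"
        by (rule eventually_nhds_in_open) (use 4 in auto)
      then have "eventually (\<lambda>x. pulse_deriv a T k x = 0) (nhds t)"
        by eventually_elim (auto simp: pulse_deriv_def)
      then show ?thesis using isCont_cong[of "pulse_deriv a T k" "\<lambda>_. 0" t] by simp
    qed
  qed
  then show ?thesis by (simp add: continuous_on_eq_continuous_at)
qed

lemma pulse_deriv_exp_integrable:
  assumes "a > 0"
  shows "integrable lborel (\<lambda>t. pulse_deriv a T k t * exp (- l * t))"
proof (rule integrable_bounded_support[of _ "\<bar>T\<bar>"])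
  show "continuous_on UNIV (\<lambda>t. pulse_deriv a T k t * exp (- l * t))"
    by (intro continuous_intros pulse_deriv_continuous assms)
qed (auto simp: pulse_deriv_def)

text \<open>Integration by parts without boundary terms, since all derivatives vanish at 0 and T;
  each derivative yields a factor l.\<close>

lemma pulse_deriv_laplace:
  assumes a: "a > 0" and T: "T > 0"
  shows "(LINT t|lborel. pulse_deriv a T k t * exp (- l * t)) = l ^ k * (LINT t|lborel. pulse_deriv a T 0 t * exp (- l * t))"
proof (induction k)
  case (Suc k)
  note i = pulse_deriv_exp_integrable[OF a]
  define F where "F t = pulse_deriv a T k t * exp (- l * t)" for t
  define f where "f t = pulse_deriv a T (Suc k) t * exp (- l * t) - l * (pulse_deriv a T k t * exp (- l * t))" for t
  have "(f has_integral (F T - F 0)) {0..T}"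
  proof (rule fundamental_theorem_of_calculus_interior)
    show "continuous_on {0..T} F" unfolding F_def
      by (intro continuous_intros continuous_on_subset[OF pulse_deriv_continuous[OF a]]) auto
    show "(F has_vector_derivative f t) (at t)" if "t \<in> {0<..<T}" for t
      unfolding F_def f_def has_real_derivative_iff_has_vector_derivative[symmetric]
      using that by (auto intro!: derivative_eq_intros pulse_deriv_has_derivative)
  qed (use T in auto)
  then have "(f has_integral 0) {0..T}" by (simp add: F_def pulse_deriv_def)
  then have "(f has_integral 0) UNIV"
    by (rule has_integral_on_superset) (auto simp: f_def pulse_deriv_def)
  moreover have "integrable lborel f" unfolding f_def by (intro Bochner_Integration.integrable_diff integrable_mult_right i)
  then have "(f has_integral integral\<^sup>L lborel f) UNIV" by (rule has_integral_integral_lborel)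
  ultimately have "integral\<^sup>L lborel f = 0" by (rule has_integral_unique[symmetric])
  moreover have "integral\<^sup>L lborel f = (LINT t|lborel. pulse_deriv a T (Suc k) t * exp (- l * t)) - l * (LINT t|lborel. pulse_deriv a T k t * exp (- l * t))"
    unfolding f_def by (subst Bochner_Integration.integral_diff[OF i integrable_mult_right[OF i]]) (simp only: Bochner_Integration.integral_mult_right_zero)
  ultimately show ?case using Suc by simp
qed simp

text \<open>Only the middle half of (0,T) is kept, of length T/2; there t (T - t) is at least 3
  T^2/16, and exp(-l t) is at least exp(-l T).\<close>

lemma pulse_laplace_ge:
  assumes a: "a > 0" and T: "T > 0" and l: "l \<ge> 0"
  shows "T / 2 * exp (- (16 * a / (3 * T))) * exp (- l * T) \<le> (LINT t|lborel. pulse_deriv a T 0 t * exp (- l * t))"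
proof -
  define c where "c = exp (- (16 * a / (3 * T))) * exp (- l * T)"
  have val: "pulse_deriv a T 0 t = exp (- (a * (1 / t + 1 / (T - t))))" if "0 < t" "t < T" for t
  proof -
    have "pulse a T (of_real t) = of_real (exp (- (a * (1 / t + 1 / (T - t)))))"
      unfolding pulse_def by (simp flip: exp_of_real)
    then show ?thesis using that by (simp add: pulse_deriv_def)
  qed
  have "T / 2 * c = (LINT t|lborel. indicator {T/4..3*T/4} t * c)" using T by simp
  also have "\<dots> \<le> (LINT t|lborel. pulse_deriv a T 0 t * exp (- l * t))"
  proof (rule integral_mono[OF _ pulse_deriv_exp_integrable[OF a]])
    show "integrable lborel (\<lambda>t. indicator {T/4..3*T/4} t * c)"
      by (rule integrable_mult_left, rule integrable_real_indicator) (auto simp: emeasure_lborel_Icc_eq)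
    fix t
    show "indicator {T/4..3*T/4} t * c \<le> pulse_deriv a T 0 t * exp (- l * t)"
    proof (cases "t \<in> {T/4..3*T/4}")
      case True
      then have t: "T / 4 \<le> t" "t \<le> 3 * T / 4" "0 < t" "t < T" using T by auto
      have "0 \<le> (t - T / 4) * (3 * T / 4 - t)" using t by (intro mult_nonneg_nonneg) auto
      then have "3 * T\<^sup>2 / 16 \<le> t * (T - t)"
        by (simp add: power2_eq_square algebra_simps add_divide_distrib diff_divide_distrib)
      then have "T / (t * (T - t)) \<le> T / (3 * T\<^sup>2 / 16)"
        using t T by (intro divide_left_mono mult_pos_pos) auto
      also have "\<dots> = 16 / (3 * T)" using T by (simp add: power2_eq_square)
      also have "T / (t * (T - t)) = 1 / t + 1 / (T - t)" using t by (simp add: field_simps)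
      finally have "a * (1 / t + 1 / (T - t)) \<le> a * (16 / (3 * T))" using a by (intro mult_left_mono) auto
      then have "exp (- (16 * a / (3 * T))) \<le> pulse_deriv a T 0 t" by (simp add: val t mult.commute)
      moreover have "exp (- l * T) \<le> exp (- l * t)" using t l by (simp add: mult_left_mono)
      moreover have "0 \<le> pulse_deriv a T 0 t" using val[OF t(3,4)] by simp
      ultimately have "c \<le> pulse_deriv a T 0 t * exp (- l * t)" unfolding c_def by (intro mult_mono) auto
      then show ?thesis using True by simp
    next
      case False
      have "0 \<le> pulse_deriv a T 0 t"
        using val[of t] by (cases "0 < t \<and> t < T") (auto simp: pulse_deriv_def[of _ _ _ t])
      then show ?thesis using False by simp
    qed
  qed
  finally show ?thesis by (simp add: c_def mult.assoc)
qed

text \<open>The series is the formal power series solution in s of k_ss = -k_t with k = 0 and k_s =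
  g at s = 0. Tested against exp(-b^2 t), the j-th derivative of g gives b^(2j) A(b), so the series
  becomes the sine series of b s divided by b.\<close>

lemma transmutation_kernel:
  fixes S T :: real
  assumes S: "S > 0" and T: "T > 0"
  obtains k :: "real \<Rightarrow> real \<Rightarrow> real" and A :: "real \<Rightarrow> real"
  where "(\<lambda>(t, s). k t s) \<in> borel_measurable (lborel \<Otimes>\<^sub>M lborel)"
    "\<And>t s. \<bar>k t s\<bar> \<le> S" "\<And>t s. \<not> (0 < t \<and> t < T) \<Longrightarrow> k t s = 0"
    "\<And>b s. b > 0 \<Longrightarrow> \<bar>s\<bar> \<le> S \<Longrightarrow> (LINT t|lborel. k t s * exp (- (b\<^sup>2) * t)) = A b * sin (b * s) / b"
    "\<And>b. T / 2 * exp (- (8 * S\<^sup>2 / T)) * exp (- (b\<^sup>2) * T) \<le> A b"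
proof -
  \<comment> \<open>Chosen so that the exponent 2a/(3r) equals S^2/r.\<close>
  define a where "a = 3 * S\<^sup>2 / 2"
  have a: "a > 0" using S by (simp add: a_def)
  define g where "g = pulse_deriv a T"
  define c where "c j s = (- 1) ^ j / fact (2 * j + 1) * s ^ (2 * j + 1)" for j and s :: real
  \<comment> \<open>Setting k to 0 for |s| > S, where convergence is not controlled, makes the bound
    and joint measurability hold on the whole plane.\<close>
  define k where "k t s = (if \<bar>s\<bar> \<le> S then (\<Sum>j. c j s * g j t) else 0)" for t s
  define A where "A b = (LINT t|lborel. g 0 t * exp (- (b\<^sup>2) * t))" for b
  have g0: "g j t = 0" if "\<not> (0 < t \<and> t < T)" for j t using that by (auto simp: g_def pulse_deriv_def)
  \<comment> \<open>The terms are dominated by S times the Poisson weights with parameter x = S^2/r.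
    These weights sum to 1 whatever x is, which is why the bound S is uniform in t although the
    derivatives of g are not.\<close>
  have trm: "\<exists>x\<ge>0. \<forall>j s. \<bar>s\<bar> \<le> S \<longrightarrow> \<bar>c j s * g j t\<bar> \<le> S * exp (- x) * (x ^ j / fact j)" for t
  proof (cases "0 < t \<and> t < T")
    case False
    then show ?thesis using g0[OF False] S by (intro exI[of _ 0]) auto
  next
    case True
    define r where "r = min t (T - t)"
    have r: "r > 0" using True by (simp add: r_def)
    define x where "x = S\<^sup>2 / r"
    have x: "x \<ge> 0" using r by (simp add: x_def)
    have "\<bar>c j s * g j t\<bar> \<le> S * exp (- x) * (x ^ j / fact j)" if s: "\<bar>s\<bar> \<le> S" for j s
    proof -
      have "2 * a / (3 * r) = x" by (simp add: a_def x_def)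
      then have 1: "\<bar>g j t\<bar> \<le> fact j * exp (- x) * (2 / r) ^ j"
        using pulse_deriv_bound[of a t T j] a True by (simp add: g_def r_def)
      have "\<bar>c j s\<bar> = \<bar>s\<bar> ^ (2 * j + 1) / fact (2 * j + 1)"
        by (simp add: c_def abs_mult power_abs del: fact_Suc)
      also have "\<dots> \<le> S ^ (2 * j + 1) / (2 ^ j * (fact j)\<^sup>2)"
        by (intro frac_le power_mono s fact_square_le) (use S in auto)
      finally have "\<bar>c j s * g j t\<bar> \<le> S ^ (2 * j + 1) / (2 ^ j * (fact j)\<^sup>2) * (fact j * exp (- x) * (2 / r) ^ j)"
        unfolding abs_mult by (intro mult_mono 1) (use S in auto)
      also have "\<dots> = S * exp (- x) * (x ^ j / fact j)"
        by (simp add: x_def power_divide power_mult power2_eq_square field_simps)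
      finally show ?thesis .
    qed
    then show ?thesis using x by blast
  qed
  have sumexp: "(\<lambda>j. S * exp (- x) * (x ^ j / fact j)) sums S" for x
  proof -
    have "(\<lambda>j. S * exp (- x) * (x ^ j / fact j)) sums (S * exp (- x) * exp x)"
      by (rule sums_mult) (use exp_converges[of x] in \<open>simp add: divide_inverse mult.commute\<close>)
    also have "S * exp (- x) * exp x = S" by (simp add: exp_minus)
    finally show ?thesis .
  qed
  have part: "summable (\<lambda>j. c j s * g j t)" "\<bar>\<Sum>j<n. c j s * g j t\<bar> \<le> S" "\<bar>\<Sum>j. c j s * g j t\<bar> \<le> S"
    if s: "\<bar>s\<bar> \<le> S" for s t n
  proof -
    obtain x where x: "x \<ge> 0" "\<And>j. \<bar>c j s * g j t\<bar> \<le> S * exp (- x) * (x ^ j / fact j)"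
      using trm[of t] s by blast
    have sm: "summable (\<lambda>j. \<bar>c j s * g j t\<bar>)"
      by (rule summable_comparison_test[OF _ sums_summable[OF sumexp[of x]]]) (use x in auto)
    then show "summable (\<lambda>j. c j s * g j t)" by (rule summable_rabs_cancel)
    have "\<bar>\<Sum>j<n. c j s * g j t\<bar> \<le> (\<Sum>j<n. S * exp (- x) * (x ^ j / fact j))"
      by (rule order_trans[OF sum_abs]) (intro sum_mono x)
    also have "\<dots> \<le> S"
      using sum_le_suminf[OF sums_summable[OF sumexp[of x]], of "{..<n}"] sums_unique[OF sumexp[of x]] x S by simp
    finally show "\<bar>\<Sum>j<n. c j s * g j t\<bar> \<le> S" .
    have "\<bar>\<Sum>j. c j s * g j t\<bar> \<le> (\<Sum>j. \<bar>c j s * g j t\<bar>)" by (rule summable_rabs[OF sm])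
    also have "\<dots> \<le> (\<Sum>j. S * exp (- x) * (x ^ j / fact j))"
      by (rule suminf_le[OF x(2) sm sums_summable[OF sumexp]])
    also have "\<dots> = S" using sums_unique[OF sumexp[of x]] by simp
    finally show "\<bar>\<Sum>j. c j s * g j t\<bar> \<le> S" .
  qed
  show thesis
  proof (rule that[of k A])
    have gm[measurable]: "g j \<in> borel_measurable borel" for j
      unfolding g_def by (rule borel_measurable_continuous_onI[OF pulse_deriv_continuous[OF a]])
    have cm[measurable]: "c j \<in> borel_measurable borel" for j
      unfolding c_def[abs_def] by measurable
    show "(\<lambda>(t, s). k t s) \<in> borel_measurable (lborel \<Otimes>\<^sub>M lborel)"
      unfolding k_def by measurable
    show "\<bar>k t s\<bar> \<le> S" for t s using part(3)[of s t] S by (simp add: k_def)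
    show "k t s = 0" if "\<not> (0 < t \<and> t < T)" for t s using g0[OF that] by (simp add: k_def)
    show "T / 2 * exp (- (8 * S\<^sup>2 / T)) * exp (- (b\<^sup>2) * T) \<le> A b" for b
      using pulse_laplace_ge[OF a T, of "b\<^sup>2"] by (simp add: A_def g_def a_def)
    fix b s :: real assume b: "b > 0" and s: "\<bar>s\<bar> \<le> S"
    \<comment> \<open>The partial sums obey the same bound S and vanish outside (0,T), so dominated
      convergence allows integrating term by term.\<close>
    have "(\<lambda>n. LINT t|lborel. (\<Sum>j<n. c j s * g j t) * exp (- (b\<^sup>2) * t)) \<longlonglongrightarrow> (LINT t|lborel. k t s * exp (- (b\<^sup>2) * t))"
    proof (rule integral_dominated_convergence[where w="\<lambda>t. indicator {0..T} t * S"])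
      show "integrable lborel (\<lambda>t. indicator {0..T} t * S)"
        by (rule integrable_mult_left, rule integrable_real_indicator) (auto simp: emeasure_lborel_Icc_eq)
      show "AE t in lborel. (\<lambda>n. (\<Sum>j<n. c j s * g j t) * exp (- (b\<^sup>2) * t)) \<longlonglongrightarrow> k t s * exp (- (b\<^sup>2) * t)"
        using s by (intro AE_I2 tendsto_intros) (simp add: k_def summable_LIMSEQ part(1))
      show "AE t in lborel. norm ((\<Sum>j<n. c j s * g j t) * exp (- (b\<^sup>2) * t)) \<le> indicator {0..T} t * S" for n
      proof (rule AE_I2)
        fix t
        show "norm ((\<Sum>j<n. c j s * g j t) * exp (- (b\<^sup>2) * t)) \<le> indicator {0..T} t * S"
        proof (cases "0 < t \<and> t < T")
          case True
          then have "\<bar>\<Sum>j<n. c j s * g j t\<bar> * exp (- (b\<^sup>2) * t) \<le> S * 1"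
            by (intro mult_mono part(2) s) (use S in auto)
          then show ?thesis using True by (simp add: abs_mult)
        qed (use g0 S in auto)
      qed
    qed (simp_all add: k_def)
    moreover have "(LINT t|lborel. (\<Sum>j<n. c j s * g j t) * exp (- (b\<^sup>2) * t)) = A b / b * (\<Sum>j<n. (- 1) ^ j / fact (2 * j + 1) * (b * s) ^ (2 * j + 1))" for n
    proof -
      have "(LINT t|lborel. (\<Sum>j<n. c j s * g j t) * exp (- (b\<^sup>2) * t)) = (LINT t|lborel. (\<Sum>j<n. c j s * (g j t * exp (- (b\<^sup>2) * t))))"
        by (simp only: sum_distrib_right mult.assoc)
      also have "\<dots> = (\<Sum>j<n. (LINT t|lborel. c j s * (g j t * exp (- (b\<^sup>2) * t))))"
        unfolding g_def by (intro Bochner_Integration.integral_sum integrable_mult_right pulse_deriv_exp_integrable a)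
      also have "\<dots> = (\<Sum>j<n. c j s * ((b\<^sup>2) ^ j * A b))"
        unfolding Bochner_Integration.integral_mult_right_zero g_def A_def
        by (subst pulse_deriv_laplace[OF a T]) rule
      also have "\<dots> = A b / b * (\<Sum>j<n. (- 1) ^ j / fact (2 * j + 1) * (b * s) ^ (2 * j + 1))"
        unfolding sum_distrib_left
        using b by (intro sum.cong) (auto simp: c_def power_mult_distrib power_mult power2_eq_square simp del: fact_Suc)
      finally show ?thesis .
    qed
    moreover have "(\<lambda>n. A b / b * (\<Sum>j<n. (- 1) ^ j / fact (2 * j + 1) * (b * s) ^ (2 * j + 1))) \<longlonglongrightarrow> A b / b * sin (b * s)"
      using sin_paired[of "b * s"] unfolding sums_def by (intro tendsto_intros)
    ultimately show "(LINT t|lborel. k t s * exp (- (b\<^sup>2) * t)) = A b * sin (b * s) / b"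
      using LIMSEQ_unique by fastforce
  qed
qed

section \<open>From sines to heat exponentials\<close>

text \<open>The functions are real, but the Bessel bound is asked for complex coefficients because
  the a_n are complex.\<close>

definition sine_biorthogonal :: "(nat \<Rightarrow> real) \<Rightarrow> real \<Rightarrow> real \<Rightarrow> (nat \<Rightarrow> real \<Rightarrow> real) \<Rightarrow> bool" where
  "sine_biorthogonal \<beta> S C V \<longleftrightarrow>
     (\<forall>n\<ge>1. continuous_on UNIV (V n) \<and> (\<forall>s. S < \<bar>s\<bar> \<longrightarrow> V n s = 0)) \<and>
     (\<forall>n\<ge>1. \<forall>l\<ge>1. (LINT s|lborel. V n s * sin (\<beta> l * s)) = (if n = l then 1 else 0)) \<and>
     (\<forall>F (c :: nat \<Rightarrow> complex). finite F \<longrightarrow> F \<subseteq> {1..} \<longrightarrow>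
        (LINT s|lborel. (cmod (\<Sum>n\<in>F. c n * complex_of_real (V n s)))\<^sup>2) \<le> C * (\<Sum>n\<in>F. (cmod (c n))\<^sup>2))"

text \<open>A sine is a combination of two exponentials, so duality is taken against all frequencies
  \<beta>_n and -\<beta>_n together. Symmetrising creates a gap around 0 that must also be
  controlled.\<close>

lemma sine_biorthogonal_family:
  fixes G g S :: real and N :: nat
  assumes G: "G > 0" and g: "g > 0" and S: "S > pi / G"
  obtains C where "C > 0"
    "\<And>\<beta> :: nat \<Rightarrow> real. (\<And>n. n \<ge> 1 \<Longrightarrow> g \<le> \<beta> (n + 1) - \<beta> n) \<Longrightarrow> g \<le> \<beta> 1 \<Longrightarrow>
       (\<And>n. n \<ge> 1 \<Longrightarrow> n \<ge> N \<Longrightarrow> G \<le> \<beta> (n + 1) - \<beta> n) \<Longrightarrow>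
       \<exists>V. sine_biorthogonal \<beta> S C V"
proof -
  \<comment> \<open>The tail from N' on must have gaps G after symmetrisation. Since \<beta>_n is at
    least n g, the distance between positive and negative tail is at least 2 N' g; N' is at least 1
    because the sequence starts there.\<close>
  define N' where "N' = Max {1, N, nat \<lceil>G / (2 * g)\<rceil>}"
  have N': "1 \<le> N'" "N \<le> N'" "G \<le> 2 * (real N' * g)"
  proof -
    show "1 \<le> N'" "N \<le> N'" by (auto simp: N'_def)
    have "G / (2 * g) \<le> real (nat \<lceil>G / (2 * g)\<rceil>)" by linarith
    also have "\<dots> \<le> real N'" unfolding of_nat_le_iff N'_def by (rule Max_ge) auto
    finally show "G \<le> 2 * (real N' * g)" using g by (simp add: field_simps)
  qed
  \<comment> \<open>The number 2 (N' - 1) of exceptional frequencies, written as a disjoint sum to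
    match the two images that form \<open>F\<close>.\<close>
  define k where "k = card ({1..<N'} <+> {1..<N'})"
  obtain C where C: "C > 0" "\<And>A F. separated G A \<Longrightarrow> separated g (F \<union> A) \<Longrightarrow> finite F \<Longrightarrow> card F = k \<Longrightarrow> F \<inter> A = {} \<Longrightarrow>
     \<exists>v. biorthogonal_family (F \<union> A) S C v"
    using biorthogonal_family_finite_small_gaps[OF g G S, of k] by blast
  have main: "\<exists>V. sine_biorthogonal \<beta> S (4 * C) V"
    if b1: "\<And>n. n \<ge> 1 \<Longrightarrow> g \<le> \<beta> (n + 1) - \<beta> n" and b0: "g \<le> \<beta> 1"
      and b2: "\<And>n. n \<ge> 1 \<Longrightarrow> n \<ge> N \<Longrightarrow> G \<le> \<beta> (n + 1) - \<beta> n" for \<beta> :: "nat \<Rightarrow> real"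
  proof -
    have lin: "real n * g \<le> \<beta> n" if "n \<ge> 1" for n
      using that
    proof (induction n rule: dec_induct)
      case (step n)
      then show ?case using b1[of n] by (simp add: algebra_simps)
    qed (use b0 in simp)
    have pos: "g \<le> \<beta> n" if "n \<ge> 1" for n
    proof -
      have "1 * g \<le> real n * g" using that g by (intro mult_right_mono) auto
      then show ?thesis using lin[OF that] by simp
    qed
    have gap: "\<beta> m + g \<le> \<beta> n" if "1 \<le> m" "m < n" for m n
    proof -
      have "Suc m \<le> n" using that by simp
      then show ?thesis
      proof (induction n rule: dec_induct)
        case (step n)
        then show ?case using b1[of n] g by simp
      qed (use b1[of m] that in simp)
    qed
    have gapG: "\<beta> m + G \<le> \<beta> n" if "N' \<le> m" "m < n" for m n
    proof -
      have "Suc m \<le> n" using that by simp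
      then show ?thesis
      proof (induction n rule: dec_induct)
        case (step n)
        then show ?case using b1[of n] g by simp
      qed (use b2[of m] N' that in simp)
    qed
    define A where "A = \<beta> ` {N'..} \<union> (\<lambda>n. - \<beta> n) ` {N'..}"
    define F where "F = \<beta> ` {1..<N'} \<union> (\<lambda>n. - \<beta> n) ` {1..<N'}"
    have inj: "\<beta> m = \<beta> n \<longleftrightarrow> m = n" if "1 \<le> m" "1 \<le> n" for m n
      using gap[of m n] gap[of n m] that g by (cases m n rule: linorder_cases) auto
    have nneg: "\<beta> m \<noteq> - \<beta> n" if "1 \<le> m" "1 \<le> n" for m n
      using pos[OF that(1)] pos[OF that(2)] g by auto
    have FA: "F \<union> A = \<beta> ` {1..} \<union> (\<lambda>n. - \<beta> n) ` {1..}"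
    proof -
      have "{1..<N'} \<union> {N'..} = {1..}" using N' by auto
      then show ?thesis unfolding F_def A_def by (metis (no_types, lifting) image_Un Un_assoc Un_left_commute)
    qed
    have sepA: "separated G A"
      unfolding separated_def
    proof (intro ballI impI)
      have d1: "G \<le> \<bar>\<beta> m - \<beta> n\<bar>" if "N' \<le> m" "N' \<le> n" "m \<noteq> n" for m n
        using gapG[of m n] gapG[of n m] that by (cases m n rule: linorder_cases) auto
      have d2: "G \<le> \<beta> m + \<beta> n" if "N' \<le> m" "N' \<le> n" for m n
      proof -
        have "real N' * g \<le> real m * g" "real N' * g \<le> real n * g" using that g by auto
        then show ?thesis using lin[of m] lin[of n] N' that by linarith
      qed
      fix x y assume "x \<in> A" "y \<in> A" "x \<noteq> y"
      then show "G \<le> \<bar>x - y\<bar>" unfolding A_def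
        apply (elim UnE imageE) 
        subgoal for m n using d1[of m n] by auto
        subgoal for m n using d2[of m n] by auto
        subgoal for m n using d2[of m n] by auto
        subgoal for m n using d1[of n m] by auto
        done
    qed
    have sepFA: "separated g (F \<union> A)"
      unfolding separated_def FA
    proof (intro ballI impI)
      have d1: "g \<le> \<bar>\<beta> m - \<beta> n\<bar>" if "1 \<le> m" "1 \<le> n" "m \<noteq> n" for m n
        using gap[of m n] gap[of n m] that by (cases m n rule: linorder_cases) auto
      have d2: "g \<le> \<beta> m + \<beta> n" if "1 \<le> m" "1 \<le> n" for m n
        using pos[of m] pos[of n] that g by linarith
      fix x y assume "x \<in> \<beta> ` {1..} \<union> (\<lambda>n. - \<beta> n) ` {1..}" "y \<in> \<beta> ` {1..} \<union> (\<lambda>n. - \<beta> n) ` {1..}" "x \<noteq> y"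
      then show "g \<le> \<bar>x - y\<bar>"
        apply (elim UnE imageE) 
        subgoal for m n using d1[of m n] by auto
        subgoal for m n using d2[of m n] by auto
        subgoal for m n using d2[of m n] by auto
        subgoal for m n using d1[of n m] by auto
        done
    qed
    have disj: "F \<inter> A = {}"
    proof (rule equals0I)
      fix x assume "x \<in> F \<inter> A"
      then obtain m n where m: "1 \<le> m" "m < N'" "x = \<beta> m \<or> x = - \<beta> m"
        and n: "N' \<le> n" "x = \<beta> n \<or> x = - \<beta> n"
        unfolding F_def A_def by fastforce
      then have "1 \<le> n" "m \<noteq> n" using N' by auto
      then show False
        using m(3) n(2) inj[of m n] nneg[of m n] nneg[of n m] m(1) by (metis minus_minus)
    qed
    have card: "card F = k"
    proof -
      have "inj_on \<beta> {1..<N'}" "inj_on (\<lambda>n. - \<beta> n) {1..<N'}"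
        using inj by (auto simp: inj_on_def)
      moreover have "\<beta> ` {1..<N'} \<inter> (\<lambda>n. - \<beta> n) ` {1..<N'} = {}" using nneg by auto
      ultimately show ?thesis unfolding F_def k_def
        by (subst card_Un_disjoint) (auto simp: card_image card_Plus)
    qed
    obtain v where v: "biorthogonal_family (F \<union> A) S C v"
      using C(2)[OF sepA sepFA _ card disj] by (auto simp: F_def)
    have inFA: "\<beta> n \<in> F \<union> A" "- \<beta> n \<in> F \<union> A" if "n \<ge> 1" for n using that unfolding FA by auto
    define f where "f n = v (\<beta> n)" for n
    have f: "f n \<in> csupp S" if "n \<ge> 1" for n
      using v inFA[OF that] unfolding biorthogonal_family_def f_def by blast
    have FTf: "FT (f n) (\<beta> l) = (if n = l then 1 else 0)" "FT (f n) (- \<beta> l) = 0" if "n \<ge> 1" "l \<ge> 1" for n l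
      using v inFA[OF that(1)] inFA[OF that(2)] inj[OF that] nneg[OF that]
      unfolding biorthogonal_family_def f_def by auto
    \<comment> \<open>If f_n is dual to the exponentials, pairing with 2i sin(\<beta>_l s) gives the
      Kronecker symbol, so pairing with the sine gives -i/2 times it. Taking -2 times the imaginary
      part yields a real function with the right pairing.\<close>
    define V where "V n s = - 2 * Im (f n s)" for n s
    have Vc: "complex_of_real (V n s) = \<i> * f n s - \<i> * cnj (f n s)" for n s
      by (simp add: V_def complex_eq_iff)
    show ?thesis
    proof (rule exI[of _ V], unfold sine_biorthogonal_def, intro conjI allI impI)
      fix n :: nat assume n: "n \<ge> 1"
      show "continuous_on UNIV (V n)" unfolding V_def
        using f[OF n] by (auto simp: csupp_def intro!: continuous_intros)
      show "V n s = 0" if "S < \<bar>s\<bar>" for s using f[OF n] that by (auto simp: V_def csupp_def)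
      fix l :: nat assume l: "l \<ge> 1"
      have i: "integrable lborel (\<lambda>s. f n s * complex_of_real (sin (\<beta> l * s)))"
        by (rule csupp_integrable[OF csupp_mult[OF f[OF n]]]) (intro continuous_intros)
      have "FT (f n) (\<beta> l) - FT (f n) (- \<beta> l) = (LINT s|lborel. f n s * cis (\<beta> l * s) - f n s * cis (- \<beta> l * s))"
        unfolding FT_def by (rule Bochner_Integration.integral_diff[symmetric]) (rule csupp_integrable_cis[OF f[OF n]])+
      also have "\<dots> = (LINT s|lborel. (2 * \<i>) * (f n s * complex_of_real (sin (\<beta> l * s))))"
        by (rule Bochner_Integration.integral_cong) (auto simp: complex_eq_iff)
      also have "\<dots> = (2 * \<i>) * (LINT s|lborel. f n s * complex_of_real (sin (\<beta> l * s)))"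
        by (rule Bochner_Integration.integral_mult_right_zero)
      finally have e: "(2 * \<i>) * (LINT s|lborel. f n s * complex_of_real (sin (\<beta> l * s))) = (if n = l then 1 else 0)"
        using FTf[OF n l] by simp
      have "(LINT s|lborel. V n s * sin (\<beta> l * s)) = (LINT s|lborel. (- 2) * Im (f n s * complex_of_real (sin (\<beta> l * s))))"
        by (rule Bochner_Integration.integral_cong) (auto simp: V_def)
      also have "\<dots> = - 2 * Im (LINT s|lborel. f n s * complex_of_real (sin (\<beta> l * s)))"
        unfolding integral_Im[OF i, symmetric] by (rule Bochner_Integration.integral_mult_right_zero)
      also have "\<dots> = Re ((2 * \<i>) * (LINT s|lborel. f n s * complex_of_real (sin (\<beta> l * s))))"
        by simp
      finally show "(LINT s|lborel. V n s * sin (\<beta> l * s)) = (if n = l then 1 else 0)"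
        unfolding e by simp
    next
      fix J :: "nat set" and c :: "nat \<Rightarrow> complex" assume J: "finite J" "J \<subseteq> {1..}"
      define h where "h d s = (\<Sum>n\<in>J. d n * f n s)" for d :: "nat \<Rightarrow> complex" and s
      have h: "h d \<in> csupp S" for d unfolding h_def by (intro csupp_sum csupp_scale f) (use J in auto)
      have L2: "(LINT s|lborel. (cmod (h c s))\<^sup>2) \<le> C * (\<Sum>n\<in>J. (cmod (c n))\<^sup>2)" for c
      proof -
        have inv: "inj_on \<beta> J" using inj J by (auto simp: inj_on_def subset_iff)
        define b where "b = (\<lambda>x. c (the_inv_into J \<beta> x))"
        have bn: "b (\<beta> n) = c n" if "n \<in> J" for n using that inv by (simp add: b_def the_inv_into_f_f)
        have "\<beta> ` J \<subseteq> F \<union> A" using inFA(1) J by auto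
        then have "(LINT s|lborel. (cmod (\<Sum>x\<in>\<beta> ` J. b x * v x s))\<^sup>2) \<le> C * (\<Sum>x\<in>\<beta> ` J. (cmod (b x))\<^sup>2)"
          using v J(1) unfolding biorthogonal_family_def by blast
        then show ?thesis
          by (simp add: sum.reindex[OF inv] bn h_def f_def)
      qed
      have i: "integrable lborel (\<lambda>s. 2 * (cmod (h c s))\<^sup>2)" for c
        by (rule integrable_mult_right[OF csupp_integrable_norm2[OF h]])
      \<comment> \<open>Conjugating f_n forces conjugation of the coefficients. Both parts obey the
        same Bessel bound, and splitting the square gives 2C + 2C.\<close>
      have eq: "(\<Sum>n\<in>J. c n * complex_of_real (V n s)) = \<i> * h c s - \<i> * cnj (h (\<lambda>n. cnj (c n)) s)" for s
        by (simp add: Vc h_def sum_distrib_left sum_subtractf algebra_simps)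
      have "(LINT s|lborel. (cmod (\<Sum>n\<in>J. c n * complex_of_real (V n s)))\<^sup>2) \<le> (LINT s|lborel. 2 * (cmod (h c s))\<^sup>2 + 2 * (cmod (h (\<lambda>n. cnj (c n)) s))\<^sup>2)"
      proof (rule integral_mono[OF _ Bochner_Integration.integrable_add[OF i i]])
        have "(\<lambda>s. \<i> * h c s - \<i> * cnj (h (\<lambda>n. cnj (c n)) s)) \<in> csupp S"
          using h by (auto simp: csupp_def intro!: continuous_intros)
        then show "integrable lborel (\<lambda>s. (cmod (\<Sum>n\<in>J. c n * complex_of_real (V n s)))\<^sup>2)"
          unfolding eq by (rule csupp_integrable_norm2)
        show "(cmod (\<Sum>n\<in>J. c n * complex_of_real (V n s)))\<^sup>2 \<le> 2 * (cmod (h c s))\<^sup>2 + 2 * (cmod (h (\<lambda>n. cnj (c n)) s))\<^sup>2" for s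
          unfolding eq using norm_diff_power2_le[of "\<i> * h c s" "\<i> * cnj (h (\<lambda>n. cnj (c n)) s)"] by (simp add: norm_mult)
      qed
      also have "\<dots> = 2 * (LINT s|lborel. (cmod (h c s))\<^sup>2) + 2 * (LINT s|lborel. (cmod (h (\<lambda>n. cnj (c n)) s))\<^sup>2)"
        by (subst Bochner_Integration.integral_add[OF i i]) simp
      also have "\<dots> \<le> 4 * C * (\<Sum>n\<in>J. (cmod (c n))\<^sup>2)"
        using L2[of c] L2[of "\<lambda>n. cnj (c n)"] by simp
      finally show "(LINT s|lborel. (cmod (\<Sum>n\<in>J. c n * complex_of_real (V n s)))\<^sup>2) \<le> 4 * C * (\<Sum>n\<in>J. (cmod (c n))\<^sup>2)" .
    qed
  qed
  show thesis by (rule that[of "4 * C"]) (use C(1) main in auto)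
qed

section \<open>Borel functions on the line as elements of L2(0,T)\<close>

lemma integral_lebesgue_on_interval:
  fixes f :: "real \<Rightarrow> 'b::{banach, second_countable_topology}"
  assumes "f \<in> borel_measurable borel" and "\<And>t. \<not> (0 < t \<and> t < T) \<Longrightarrow> f t = 0"
  shows "(LINT t|lebesgue_on {0<..<T}. f t) = (LINT t|lborel. f t)"
proof -
  have "(LINT t|lebesgue_on {0<..<T}. f t) = (LINT t|lebesgue. indicator {0<..<T} t *\<^sub>R f t)"
    by (rule integral_restrict_space) auto
  also have "(\<lambda>t. indicator {0<..<T} t *\<^sub>R f t) = f"
    using assms(2) by (force simp: indicator_def fun_eq_iff)
  also have "integral\<^sup>L lebesgue f = integral\<^sup>L lborel f"
    by (rule integral_completion) (use assms(1) in simp)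
  finally show ?thesis .
qed

text \<open>Integrating a pointwise bound over (0,T) costs a factor T, which turns the T^(-2) of the
  pointwise estimate into T^(-1).\<close>

lemma bounded_in_L2:
  fixes f :: "real \<Rightarrow> 'b::{banach, second_countable_topology}"
  assumes f: "f \<in> borel_measurable borel" and B: "\<And>t. (norm (f t))\<^sup>2 \<le> B" and T: "T > 0"
  shows "f \<in> L2 T" and "(L2_norm T f)\<^sup>2 \<le> T * B"
proof -
  interpret finite_measure "lebesgue_on {0<..<T}" by (rule finite_measure_lebesgue_on) auto
  have m: "f \<in> borel_measurable (lebesgue_on {0<..<T})"
    by (intro measurable_restrict_space1 measurable_completion) (use f in simp)
  have m2: "(\<lambda>t. (norm (f t))\<^sup>2) \<in> borel_measurable (lebesgue_on {0<..<T})" using m by measurable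
  have i: "integrable (lebesgue_on {0<..<T}) (\<lambda>t. (norm (f t))\<^sup>2)"
    by (rule integrable_const_bound[of _ B]) (use B m2 in auto)
  show "f \<in> L2 T" using m i by (simp add: L2_def)
  have "(L2_norm T f)\<^sup>2 = (LINT t|lebesgue_on {0<..<T}. (norm (f t))\<^sup>2)"
    by (simp add: L2_norm_def)
  also have "\<dots> \<le> (LINT t|lebesgue_on {0<..<T}. B)"
    by (rule integral_mono[OF i]) (use B in auto)
  also have "\<dots> = T * B" using T by (simp add: measure_restrict_space)
  finally show "(L2_norm T f)\<^sup>2 \<le> T * B" .
qed

text \<open>Cauchy-Schwarz on [-S,S]: |k| \<le> S contributes S^2, and the length of the interval
  contributes 2S. It is again derived from a nonnegative variance, with mean m/(2S).\<close>

lemma integral_mult_bounded_square: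
  assumes f: "f \<in> csupp S" and S: "S > 0" and k: "k \<in> borel_measurable borel" "\<And>s. \<bar>k s\<bar> \<le> S"
  shows "(cmod (LINT s|lborel. f s * complex_of_real (k s)))\<^sup>2 \<le> 2 * S ^ 3 * (LINT s|lborel. (cmod (f s))\<^sup>2)"
proof -
  define m where "m = (LINT s|lborel. cmod (f s))"
  have i1: "integrable lborel (\<lambda>s. cmod (f s))" using csupp_integrable[OF f] by simp
  note i2 = csupp_integrable_norm2[OF f]
  have fm: "f \<in> borel_measurable borel" using borel_measurable_integrable[OF csupp_integrable[OF f]] by simp
  have le: "cmod (LINT s|lborel. f s * complex_of_real (k s)) \<le> S * m"
  proof -
    have b: "cmod (f s * complex_of_real (k s)) \<le> S * cmod (f s)" for s
      using mult_left_mono[OF k(2)[of s], of "cmod (f s)"] by (simp add: norm_mult mult.commute)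
    have "integrable lborel (\<lambda>s. f s * complex_of_real (k s))"
      by (rule Bochner_Integration.integrable_bound[OF integrable_mult_right[OF i1, of S]])
        (use fm k b S in \<open>auto simp: abs_mult\<close>)
    then have "cmod (LINT s|lborel. f s * complex_of_real (k s)) \<le> (LINT s|lborel. S * cmod (f s))"
      by (rule Bochner_Integration.integral_norm_bound_integral[OF _ integrable_mult_right[OF i1]]) (rule b)
    then show ?thesis by (simp add: m_def)
  qed
  have "0 \<le> (LINT s|lborel. indicator {-S..S} s * (cmod (f s) - m / (2 * S))\<^sup>2)"
    by (rule integral_nonneg_AE) auto
  also have "\<dots> = (LINT s|lborel. (cmod (f s))\<^sup>2 - (m / S) * cmod (f s) + (m / (2 * S))\<^sup>2 * indicator {-S..S} s)"
  proof (rule Bochner_Integration.integral_cong[OF refl])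
    fix s
    show "indicator {-S..S} s * (cmod (f s) - m / (2 * S))\<^sup>2 = (cmod (f s))\<^sup>2 - (m / S) * cmod (f s) + (m / (2 * S))\<^sup>2 * indicator {-S..S} s"
      using f S by (cases "s \<in> {-S..S}") (auto simp: csupp_def power2_diff)
  qed
  also have "\<dots> = (LINT s|lborel. (cmod (f s))\<^sup>2) - (m / S) * m + (m / (2 * S))\<^sup>2 * (2 * S)"
  proof -
    have i3: "integrable lborel (\<lambda>s. (m / (2 * S))\<^sup>2 * indicator {-S..S} s)"
      by (rule integrable_mult_right, rule integrable_real_indicator) (auto simp: emeasure_lborel_Icc_eq)
    have "(LINT s|lborel. (m / (2 * S))\<^sup>2 * indicator {-S..S} s) = (m / (2 * S))\<^sup>2 * (2 * S)" using S by simp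
    moreover have "(LINT s|lborel. (m / S) * cmod (f s)) = (m / S) * m"
      unfolding m_def by (rule Bochner_Integration.integral_mult_right_zero)
    ultimately show ?thesis
      by (subst Bochner_Integration.integral_add[OF Bochner_Integration.integrable_diff[OF i2 integrable_mult_right[OF i1]] i3],
          subst Bochner_Integration.integral_diff[OF i2 integrable_mult_right[OF i1]]) (simp only:)
  qed
  also have "\<dots> = (LINT s|lborel. (cmod (f s))\<^sup>2) - m\<^sup>2 / (2 * S)"
    using S by (simp add: power2_eq_square field_simps)
  finally have "m\<^sup>2 \<le> 2 * S * (LINT s|lborel. (cmod (f s))\<^sup>2)"
    using S by (simp add: pos_divide_le_eq mult.commute)
  note m2 = this
  have "(cmod (LINT s|lborel. f s * complex_of_real (k s)))\<^sup>2 \<le> (S * m)\<^sup>2"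
    using le by (intro power_mono) auto
  also have "\<dots> = S\<^sup>2 * m\<^sup>2" by (rule power_mult_distrib)
  also have "\<dots> \<le> S\<^sup>2 * (2 * S * (LINT s|lborel. (cmod (f s))\<^sup>2))"
    using m2 by (rule mult_left_mono) simp
  also have "\<dots> = 2 * S ^ 3 * (LINT s|lborel. (cmod (f s))\<^sup>2)"
    by (simp add: power2_eq_square power3_eq_cube)
  finally show ?thesis .
qed

text \<open>The estimate holds at every single t, since k is bounded. Its constant is 2 S^3 from
  Cauchy-Schwarz, C from the Bessel bound, and 4/T^2 with the exponentials from the lower bound on
  A.\<close>

lemma moment_solution:
  fixes \<beta> :: "nat \<Rightarrow> real" and V :: "nat \<Rightarrow> real \<Rightarrow> real" and S T C :: real
  assumes S: "S > 0" and T: "T > 0" and C: "C > 0"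
    and \<beta>: "\<And>n. n \<ge> 1 \<Longrightarrow> \<beta> n > 0"
    and V: "sine_biorthogonal \<beta> S C V"
  obtains u :: "nat \<Rightarrow> real \<Rightarrow> real"
  where "\<And>n. n \<ge> 1 \<Longrightarrow> u n \<in> borel_measurable borel"
    "\<And>n t. n \<ge> 1 \<Longrightarrow> \<not> (0 < t \<and> t < T) \<Longrightarrow> u n t = 0"
    "\<And>n l. n \<ge> 1 \<Longrightarrow> l \<ge> 1 \<Longrightarrow> (LINT t|lborel. u n t * exp (- ((\<beta> l)\<^sup>2) * t)) = (if n = l then 1 else 0)"
    "\<And>F (a :: nat \<Rightarrow> complex) t. finite F \<Longrightarrow> F \<subseteq> {1..} \<Longrightarrow>
       (cmod (\<Sum>n\<in>F. a n * complex_of_real (u n t)))\<^sup>2 \<le>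
       8 * S ^ 3 * C / T\<^sup>2 * exp (16 * S\<^sup>2 / T) * (\<Sum>n\<in>F. (\<beta> n)\<^sup>2 * exp (2 * (\<beta> n)\<^sup>2 * T) * (cmod (a n))\<^sup>2)"
proof -
  have V: "continuous_on UNIV (V n)" "\<And>s. S < \<bar>s\<bar> \<Longrightarrow> V n s = 0" if "n \<ge> 1" for n
    using V that by (simp_all add: sine_biorthogonal_def)
  have Vsin: "(LINT s|lborel. V n s * sin (\<beta> l * s)) = (if n = l then 1 else 0)" if "n \<ge> 1" "l \<ge> 1" for n l
    using \<open>sine_biorthogonal \<beta> S C V\<close> that by (simp add: sine_biorthogonal_def)
  have VL2: "(LINT s|lborel. (cmod (\<Sum>n\<in>F. c n * complex_of_real (V n s)))\<^sup>2) \<le> C * (\<Sum>n\<in>F. (cmod (c n))\<^sup>2)"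
    if "finite F" "F \<subseteq> {1..}" for F and c :: "nat \<Rightarrow> complex"
    using \<open>sine_biorthogonal \<beta> S C V\<close> that unfolding sine_biorthogonal_def by blast
  obtain k A where km: "(\<lambda>(t, s). k t s) \<in> borel_measurable (lborel \<Otimes>\<^sub>M lborel)"
    and kS: "\<And>t s. \<bar>k t s\<bar> \<le> S" and k0: "\<And>t s. \<not> (0 < t \<and> t < T) \<Longrightarrow> k t s = 0"
    and kA: "\<And>b s. b > 0 \<Longrightarrow> \<bar>s\<bar> \<le> S \<Longrightarrow> (LINT t|lborel. k t s * exp (- (b\<^sup>2) * t)) = A b * sin (b * s) / b"
    and A: "\<And>b. T / 2 * exp (- (8 * S\<^sup>2 / T)) * exp (- (b\<^sup>2) * T) \<le> A b"
    using transmutation_kernel[OF S T] by blast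
  have Apos: "A b > 0" for b
    by (rule less_le_trans[OF _ A[of b]]) (use T in simp)
  have kt: "k t \<in> borel_measurable borel" for t
    using measurable_Pair2[OF km, of t] by simp
  define I where "I n t = (LINT s|lborel. V n s * k t s)" for n t
  define u where "u n t = \<beta> n / A (\<beta> n) * I n t" for n t
  have Vm: "V n \<in> borel_measurable borel" if "n \<ge> 1" for n
    using borel_measurable_continuous_onI[OF V(1)[OF that]] .
  have um: "u n \<in> borel_measurable borel" if n: "n \<ge> 1" for n
  proof -
    have "(\<lambda>p. V n (snd p) * (case p of (t, s) \<Rightarrow> k t s)) \<in> borel_measurable (lborel \<Otimes>\<^sub>M lborel)"
      by (intro borel_measurable_times km measurable_compose[OF measurable_snd]) (use Vm[OF n] in simp)
    then have "(\<lambda>(t, s). V n s * k t s) \<in> borel_measurable (lborel \<Otimes>\<^sub>M lborel)"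
      by (simp add: case_prod_beta)
    then have "I n \<in> borel_measurable lborel"
      unfolding I_def[abs_def] by (rule lborel.borel_measurable_lebesgue_integral)
    then show ?thesis unfolding u_def[abs_def] by simp
  qed
  have u0: "u n t = 0" if "\<not> (0 < t \<and> t < T)" for n t
    using k0[OF that] by (simp add: u_def I_def)
  have Vc: "(\<lambda>s. complex_of_real (V n s)) \<in> csupp S" if "n \<ge> 1" for n
    using V[OF that] by (auto simp: csupp_def intro!: continuous_intros)
  have Vi: "integrable lborel (V n)" if "n \<ge> 1" for n
    by (rule integrable_bounded_support[of _ S]) (use V[OF that] in auto)
  have Vki: "integrable lborel (\<lambda>s. V n s * k t s)" if n: "n \<ge> 1" for n t
  proof (rule Bochner_Integration.integrable_bound[OF integrable_mult_right[OF integrable_norm[OF Vi[OF n]], of S]])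
    show "AE s in lborel. norm (V n s * k t s) \<le> norm (S * norm (V n s))"
    proof (rule AE_I2)
      fix s
      show "norm (V n s * k t s) \<le> norm (S * norm (V n s))"
        using mult_left_mono[OF kS[of t s], of "\<bar>V n s\<bar>"] S by (simp add: abs_mult mult.commute)
    qed
  qed (use Vm[OF n] kt in simp)
  show thesis
  proof (rule that[of u])
    show "u n \<in> borel_measurable borel" if "n \<ge> 1" for n by (rule um[OF that])
    show "u n t = 0" if "n \<ge> 1" "\<not> (0 < t \<and> t < T)" for n t by (rule u0[OF that(2)])
  next
    fix n l :: nat assume n: "n \<ge> 1" and l: "l \<ge> 1"
    define E where "E t = exp (- ((\<beta> l)\<^sup>2) * t)" for t
    obtain B where B: "B \<ge> 0" "\<And>s. cmod (complex_of_real (V n s)) \<le> B"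
      using csupp_bounded[OF Vc[OF n]] by metis
    \<comment> \<open>For Fubini: the integrand lives on [0,T] x [-S,S] and is at most B S there, as
      the exponential is at most 1 for t > 0.\<close>
    have I: "integrable (lborel \<Otimes>\<^sub>M lborel) (\<lambda>(t, s). V n s * k t s * E t)"
    proof (rule Bochner_Integration.integrable_bound)
      have "integrable lborel (\<lambda>p. indicator ({0..T} \<times> {-S..S}) p *\<^sub>R (B * S))"
        by (rule borel_integrable_compact) (auto intro!: compact_Times)
      then show "integrable (lborel \<Otimes>\<^sub>M lborel) (\<lambda>p :: real \<times> real. indicator ({0..T} \<times> {-S..S}) p *\<^sub>R (B * S))"
        by (simp add: lborel_prod)
      have "(\<lambda>p. V n (snd p) * (case p of (t, s) \<Rightarrow> k t s) * E (fst p)) \<in> borel_measurable (lborel \<Otimes>\<^sub>M lborel)"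
        by (intro borel_measurable_times km measurable_compose[OF measurable_snd] measurable_compose[OF measurable_fst])
          (use Vm[OF n] in \<open>simp_all add: E_def\<close>)
      then show "(\<lambda>(t, s). V n s * k t s * E t) \<in> borel_measurable (lborel \<Otimes>\<^sub>M lborel)"
        by (simp add: case_prod_beta)
      show "AE p in lborel \<Otimes>\<^sub>M lborel. norm (case p of (t, s) \<Rightarrow> V n s * k t s * E t)
         \<le> norm (indicator ({0..T} \<times> {-S..S}) p *\<^sub>R (B * S))"
      proof (rule AE_I2)
        fix p :: "real \<times> real"
        obtain t s where p: "p = (t, s)" by (cases p)
        show "norm (case p of (t, s) \<Rightarrow> V n s * k t s * E t) \<le> norm (indicator ({0..T} \<times> {-S..S}) p *\<^sub>R (B * S))"
        proof (cases "0 < t \<and> t < T \<and> \<bar>s\<bar> \<le> S")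
          case True
          have "E t \<le> 1" "0 \<le> E t" using True by (auto simp: E_def)
          then have "\<bar>V n s\<bar> * \<bar>k t s\<bar> * E t \<le> B * S * 1"
            using B(2)[of s] kS[of t s] B(1) S by (intro mult_mono) auto
          moreover have "(t, s) \<in> {0..T} \<times> {-S..S}" using True by (auto simp: abs_le_iff)
          ultimately show ?thesis using \<open>0 \<le> E t\<close> B(1) S by (simp add: p abs_mult)
        next
          case False
          then have "V n s = 0 \<or> k t s = 0" using V(2)[OF n, of s] k0[of t s] by auto
          then show ?thesis by (auto simp: p)
        qed
      qed
    qed
    have "(LINT t|lborel. u n t * E t) = (LINT t|lborel. \<beta> n / A (\<beta> n) * (LINT s|lborel. V n s * k t s * E t))"
      by (simp only: Bochner_Integration.integral_mult_left_zero) (simp add: u_def I_def mult.assoc)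
    also have "\<dots> = \<beta> n / A (\<beta> n) * (LINT t|lborel. LINT s|lborel. V n s * k t s * E t)"
      by (rule Bochner_Integration.integral_mult_right_zero)
    also have "(LINT t|lborel. LINT s|lborel. V n s * k t s * E t) = (LINT s|lborel. LINT t|lborel. V n s * k t s * E t)"
      using lborel_pair.Fubini_integral[of "\<lambda>t s. V n s * k t s * E t"] I by simp
    also have "\<dots> = (LINT s|lborel. A (\<beta> l) / \<beta> l * (V n s * sin (\<beta> l * s)))"
    proof (rule Bochner_Integration.integral_cong[OF refl])
      fix s
      have "(LINT t|lborel. V n s * k t s * E t) = V n s * (LINT t|lborel. k t s * E t)"
        by (simp add: mult.assoc)
      also have "\<dots> = A (\<beta> l) / \<beta> l * (V n s * sin (\<beta> l * s))"
        using kA[OF \<beta>[OF l], of s] V(2)[OF n, of s] by (cases "\<bar>s\<bar> \<le> S") (simp_all add: E_def)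
      finally show "(LINT t|lborel. V n s * k t s * E t) = A (\<beta> l) / \<beta> l * (V n s * sin (\<beta> l * s))" .
    qed
    also have "\<dots> = A (\<beta> l) / \<beta> l * (if n = l then 1 else 0)"
      by (simp only: Bochner_Integration.integral_mult_right_zero Vsin[OF n l])
    also have "\<beta> n / A (\<beta> n) * \<dots> = (if n = l then 1 else 0)"
      using \<beta>[OF n] Apos[of "\<beta> n"] by (cases "n = l") auto
    finally show "(LINT t|lborel. u n t * exp (- ((\<beta> l)\<^sup>2) * t)) = (if n = l then 1 else 0)"
      by (simp add: E_def)
  next
    fix F :: "nat set" and a :: "nat \<Rightarrow> complex" and t assume F: "finite F" "F \<subseteq> {1..}"
    define c where "c n = a n * complex_of_real (\<beta> n / A (\<beta> n))" for n
    define f where "f s = (\<Sum>n\<in>F. c n * complex_of_real (V n s))" for s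
    have f: "f \<in> csupp S" unfolding f_def by (intro csupp_sum csupp_scale Vc) (use F in auto)
    have "(\<Sum>n\<in>F. a n * complex_of_real (u n t)) = (\<Sum>n\<in>F. c n * (LINT s|lborel. complex_of_real (V n s * k t s)))"
      unfolding integral_complex_of_real by (simp add: u_def c_def I_def mult.assoc)
    also have "\<dots> = (\<Sum>n\<in>F. (LINT s|lborel. c n * complex_of_real (V n s * k t s)))"
      by simp
    also have "\<dots> = (LINT s|lborel. (\<Sum>n\<in>F. c n * complex_of_real (V n s * k t s)))"
      by (rule Bochner_Integration.integral_sum[symmetric])
        (intro integrable_mult_right integrable_of_real Vki, use F in auto)
    also have "\<dots> = (LINT s|lborel. f s * complex_of_real (k t s))"
      by (simp add: f_def sum_distrib_right mult.assoc)
    finally have "(cmod (\<Sum>n\<in>F. a n * complex_of_real (u n t)))\<^sup>2 \<le> 2 * S ^ 3 * (LINT s|lborel. (cmod (f s))\<^sup>2)"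
      using integral_mult_bounded_square[OF f S kt kS] by simp
    also have "\<dots> \<le> 2 * S ^ 3 * (C * (\<Sum>n\<in>F. (cmod (c n))\<^sup>2))"
      unfolding f_def by (intro mult_left_mono VL2 F) (use S in auto)
    also have "\<dots> \<le> 2 * S ^ 3 * (C * (\<Sum>n\<in>F. 4 / T\<^sup>2 * exp (16 * S\<^sup>2 / T) * ((\<beta> n)\<^sup>2 * exp (2 * (\<beta> n)\<^sup>2 * T) * (cmod (a n))\<^sup>2)))"
    proof (intro mult_left_mono sum_mono)
      fix n assume "n \<in> F"
      \<comment> \<open>\<open>L\<close> is the lower bound for A(\<beta>_n); squaring its inverse
        doubles both exponents, giving 16 S^2/T and the weight exp(2 \<beta>_n^2 T).\<close>
      define L where "L = T / 2 * exp (- (8 * S\<^sup>2 / T)) * exp (- ((\<beta> n)\<^sup>2) * T)"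
      have L: "0 < L" "L \<le> A (\<beta> n)" using T A[of "\<beta> n"] by (auto simp: L_def)
      have Linv: "1 / L\<^sup>2 = 4 / T\<^sup>2 * exp (16 * S\<^sup>2 / T) * exp (2 * (\<beta> n)\<^sup>2 * T)"
      proof -
        have e: "1 / (exp (- x))\<^sup>2 = exp (2 * x)" for x :: real
          by (simp add: exp_minus exp_double power_divide inverse_eq_divide)
        have "1 / L\<^sup>2 = 4 / T\<^sup>2 * (1 / (exp (- (8 * S\<^sup>2 / T)))\<^sup>2) * (1 / (exp (- ((\<beta> n)\<^sup>2 * T)))\<^sup>2)"
          by (simp add: L_def power_mult_distrib power_divide)
        then show ?thesis unfolding e by (simp add: mult.assoc)
      qed
      have "(cmod (c n))\<^sup>2 = (cmod (a n))\<^sup>2 * (\<beta> n)\<^sup>2 * (1 / (A (\<beta> n))\<^sup>2)"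
        by (simp add: c_def norm_mult norm_divide power_mult_distrib power_divide)
      also have "\<dots> \<le> (cmod (a n))\<^sup>2 * (\<beta> n)\<^sup>2 * (1 / L\<^sup>2)"
        using L by (intro mult_left_mono divide_left_mono power_mono mult_pos_pos zero_less_power) auto
      finally show "(cmod (c n))\<^sup>2 \<le> 4 / T\<^sup>2 * exp (16 * S\<^sup>2 / T) * ((\<beta> n)\<^sup>2 * exp (2 * (\<beta> n)\<^sup>2 * T) * (cmod (a n))\<^sup>2)"
        unfolding Linv by (simp add: mult_ac)
    qed (use S C in auto)
    also have "\<dots> = 8 * S ^ 3 * C / T\<^sup>2 * exp (16 * S\<^sup>2 / T) * (\<Sum>n\<in>F. (\<beta> n)\<^sup>2 * exp (2 * (\<beta> n)\<^sup>2 * T) * (cmod (a n))\<^sup>2)"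
      unfolding sum_distrib_left[symmetric] by simp
    finally show "(cmod (\<Sum>n\<in>F. a n * complex_of_real (u n t)))\<^sup>2 \<le>
       8 * S ^ 3 * C / T\<^sup>2 * exp (16 * S\<^sup>2 / T) * (\<Sum>n\<in>F. (\<beta> n)\<^sup>2 * exp (2 * (\<beta> n)\<^sup>2 * T) * (cmod (a n))\<^sup>2)" .
  qed
qed

text \<open>Applied to blocks of consecutive indices, the bound makes the partial sums Cauchy
  uniformly in t. The limit therefore exists at every point, and the tail estimate gives convergence
  in norm.\<close>

lemma L2_series_sum_of_pointwise_bound:
  fixes f :: "nat \<Rightarrow> real \<Rightarrow> complex" and w :: "nat \<Rightarrow> real"
  assumes T: "T > 0" and K: "K \<ge> 0" and f: "\<And>n. n \<ge> 1 \<Longrightarrow> f n \<in> borel_measurable borel"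
    and w: "w summable_on {1..}" "\<And>n. n \<ge> 1 \<Longrightarrow> 0 \<le> w n"
    and bound: "\<And>F t. finite F \<Longrightarrow> F \<subseteq> {1..} \<Longrightarrow> (cmod (\<Sum>n\<in>F. f n t))\<^sup>2 \<le> K * (\<Sum>n\<in>F. w n)"
  obtains z where "L2_series_sum T f z" "(L2_norm T z)\<^sup>2 \<le> T * (K * (\<Sum>\<^sub>\<infinity>n\<in>{1..}. w n))"
proof -
  have ev: "((\<lambda>n. w (Suc n)) has_sum (\<Sum>\<^sub>\<infinity>n\<in>{1..}. w n)) UNIV"
  proof -
    have "(w has_sum (\<Sum>\<^sub>\<infinity>n\<in>{1..}. w n)) (range Suc)"
      using has_sum_infsum[OF w(1)] by (simp add: atLeast_Suc_greaterThan greaterThan_0)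
    then show ?thesis by (subst (asm) has_sum_reindex) (auto simp: o_def)
  qed
  define W where "W = (\<Sum>\<^sub>\<infinity>n\<in>{1..}. w n)"
  have ws: "(\<lambda>n. w (Suc n)) sums W" using has_sum_imp_sums[OF ev] by (simp add: W_def)
  have w0: "0 \<le> w (Suc n)" for n using w(2) by simp
  have blk: "(cmod (\<Sum>j=m..<n. f (Suc j) t))\<^sup>2 \<le> K * (\<Sum>j=m..<n. w (Suc j))" for m n t
  proof -
    have s: "(\<Sum>j=m..<n. h (Suc j)) = (\<Sum>i\<in>Suc ` {m..<n}. h i)" for h :: "nat \<Rightarrow> 'c::comm_monoid_add"
      by (subst sum.reindex) (simp_all add: o_def)
    show ?thesis unfolding s[of w] s[of "\<lambda>i. f i t"] by (rule bound) auto
  qed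
  have sm: "summable (\<lambda>j. f (Suc j) t)" for t
    unfolding summable_Cauchy
  proof (intro allI impI)
    fix e :: real assume e: "e > 0"
    \<comment> \<open>Dividing by K + 1 keeps this meaningful for K = 0.\<close>
    define d where "d = e\<^sup>2 / (K + 1)"
    have d: "d > 0" using e K by (simp add: d_def)
    obtain N where N: "\<And>m n. m \<ge> N \<Longrightarrow> norm (\<Sum>j=m..<n. w (Suc j)) < d"
      using sums_summable[OF ws] d unfolding summable_Cauchy by blast
    have "cmod (\<Sum>j=m..<n. f (Suc j) t) < e" if "m \<ge> N" for m n
    proof -
      have "K * (\<Sum>j=m..<n. w (Suc j)) \<le> K * d"
        using N[OF that, of n] K by (intro mult_left_mono) auto
      also have "\<dots> < (K + 1) * d" using d by simp
      also have "\<dots> = e\<^sup>2" using K by (simp add: d_def)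
      finally have "(cmod (\<Sum>j=m..<n. f (Suc j) t))\<^sup>2 < e\<^sup>2" using blk[where m=m and n=n and t=t] by linarith
      then show ?thesis using e by (meson power_less_imp_less_base less_imp_le)
    qed
    then show "\<exists>N. \<forall>m\<ge>N. \<forall>n. norm (\<Sum>j=m..<n. f (Suc j) t) < e" by blast
  qed
  define z where "z t = (\<Sum>j. f (Suc j) t)" for t
  have lim: "(\<lambda>n. \<Sum>j<n. f (Suc j) t) \<longlonglongrightarrow> z t" for t
    unfolding z_def by (rule summable_LIMSEQ[OF sm])
  have shift: "(\<Sum>n=1..M. f n t) = (\<Sum>j<M. f (Suc j) t)" for M t
    by (simp add: sum.atLeast1_atMost_eq)
  \<comment> \<open>The block estimate from M to n, with n tending to infinity; M = 0 bounds z
    itself.\<close>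
  have tail: "(cmod ((\<Sum>n=1..M. f n t) - z t))\<^sup>2 \<le> K * (W - (\<Sum>j<M. w (Suc j)))" for M t
  proof (rule LIMSEQ_le_const2)
    show "(\<lambda>n. (cmod ((\<Sum>n=1..M. f n t) - (\<Sum>j<n. f (Suc j) t)))\<^sup>2) \<longlonglongrightarrow> (cmod ((\<Sum>n=1..M. f n t) - z t))\<^sup>2"
      by (intro tendsto_intros lim)
    have "(cmod ((\<Sum>n=1..M. f n t) - (\<Sum>j<n. f (Suc j) t)))\<^sup>2 \<le> K * (W - (\<Sum>j<M. w (Suc j)))" if "n \<ge> M" for n
    proof -
      have d: "(\<Sum>j<n. h j) - (\<Sum>j<M. h j) = (\<Sum>j=M..<n. h j)" for h :: "nat \<Rightarrow> 'c::ab_group_add"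
        using that by (metis atLeast0LessThan le0 sum_diff_nat_ivl)
      have "(cmod ((\<Sum>n=1..M. f n t) - (\<Sum>j<n. f (Suc j) t)))\<^sup>2 = (cmod (\<Sum>j=M..<n. f (Suc j) t))\<^sup>2"
        unfolding shift d[symmetric] by (simp add: norm_minus_commute)
      also have "\<dots> \<le> K * (\<Sum>j=M..<n. w (Suc j))" by (rule blk)
      also have "\<dots> \<le> K * (W - (\<Sum>j<M. w (Suc j)))"
      proof (rule mult_left_mono[OF _ K])
        have "(\<Sum>j<n. w (Suc j)) \<le> W"
          using sum_le_suminf[OF sums_summable[OF ws], of "{..<n}"] w0 sums_unique[OF ws] by simp
        then show "(\<Sum>j=M..<n. w (Suc j)) \<le> W - (\<Sum>j<M. w (Suc j))" by (simp flip: d)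
      qed
      finally show ?thesis .
    qed
    then show "\<exists>N. \<forall>n\<ge>N. (cmod ((\<Sum>n=1..M. f n t) - (\<Sum>j<n. f (Suc j) t)))\<^sup>2 \<le> K * (W - (\<Sum>j<M. w (Suc j)))"
      by blast
  qed
  have zb: "(cmod (z t))\<^sup>2 \<le> K * W" for t using tail[where M=0 and t=t] by simp
  have fm: "f (Suc j) \<in> borel_measurable borel" for j by (rule f) simp
  have zm: "z \<in> borel_measurable borel"
    unfolding z_def[abs_def] by (rule borel_measurable_suminf) (rule fm)
  have dm: "(\<lambda>t. (\<Sum>n=1..M. f n t) - z t) \<in> borel_measurable borel" for M
    unfolding shift by (intro borel_measurable_diff borel_measurable_sum fm zm)
  show thesis
  proof (rule that[of z])
    show "(L2_norm T z)\<^sup>2 \<le> T * (K * (\<Sum>\<^sub>\<infinity>n\<in>{1..}. w n))"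
      using bounded_in_L2(2)[OF zm zb T] by (simp add: W_def)
    show "L2_series_sum T f z"
      unfolding L2_series_sum_def
    proof (intro conjI)
      show "z \<in> L2 T" by (rule bounded_in_L2(1)[OF zm zb T])
      show "AE t in lebesgue_on {0<..<T}. (\<lambda>M. \<Sum>n=1..M. f n t) \<longlonglongrightarrow> z t"
        unfolding shift by (rule AE_I2) (rule lim)
      have "(\<lambda>M. sqrt (T * (K * (W - (\<Sum>j<M. w (Suc j)))))) \<longlonglongrightarrow> sqrt (T * (K * (W - W)))"
        using ws unfolding sums_def by (intro tendsto_intros)
      then have lim0: "(\<lambda>M. sqrt (T * (K * (W - (\<Sum>j<M. w (Suc j)))))) \<longlonglongrightarrow> 0" by simp
      have "norm (L2_norm T (\<lambda>t. (\<Sum>n=1..M. f n t) - z t)) \<le> sqrt (T * (K * (W - (\<Sum>j<M. w (Suc j)))))" for M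
      proof -
        have "0 \<le> L2_norm T h" for h :: "real \<Rightarrow> complex" by (simp add: L2_norm_def)
        moreover have "L2_norm T (\<lambda>t. (\<Sum>n=1..M. f n t) - z t) \<le> sqrt (T * (K * (W - (\<Sum>j<M. w (Suc j)))))"
          by (rule real_le_rsqrt) (rule bounded_in_L2(2)[OF dm tail T])
        ultimately show ?thesis by simp
      qed
      then show "(\<lambda>M. L2_norm T (\<lambda>t. (\<Sum>n=1..M. f n t) - z t)) \<longlonglongrightarrow> 0"
        by (rule Lim_null_comparison[OF always_eventually[OF allI] lim0])
    qed
  qed
qed

theorem propositionB1:
  fixes \<gamma>_inf \<gamma> S \<epsilon> :: real and N :: nat
  assumes "\<gamma>_inf > 0" and "\<gamma> > 0" and "S > pi / \<gamma>_inf" and "\<epsilon> > 0"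
  shows "\<exists>C::real. C > 0 \<and>
    (\<forall>\<beta> :: nat \<Rightarrow> real. \<forall>T::real.
      (\<forall>n\<ge>1. \<beta> (n + 1) - \<beta> n \<ge> \<gamma>) \<and> \<beta> 1 \<ge> \<gamma> \<and>
      (\<forall>n\<ge>1. n \<ge> N \<longrightarrow> \<beta> (n + 1) - \<beta> n \<ge> \<gamma>_inf) \<and>
      0 < T \<and> T \<le> 1 \<longrightarrow>
      (\<exists>u :: nat \<Rightarrow> real \<Rightarrow> real.
        (\<forall>n\<ge>1. u n \<in> L2 T) \<and>
        (\<forall>l\<ge>1. \<forall>n\<ge>1.
          (LINT t|lebesgue_on {0<..<T}. u n t * exp (- ((\<beta> l)\<^sup>2) * t)) = (if n = l then 1 else 0)) \<and>
        (\<forall>a :: nat \<Rightarrow> complex.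
          (\<lambda>n. (cmod ((\<beta> n)\<^sup>2 * exp ((\<beta> n)\<^sup>2 * T) * a n))\<^sup>2) summable_on {1..} \<longrightarrow>
          (\<exists>z :: real \<Rightarrow> complex.
            L2_series_sum T (\<lambda>n t. a n * complex_of_real (u n t)) z \<and>
            (L2_norm T z)\<^sup>2 \<le> C / T ^ 3 * exp ((16 + \<epsilon>) * S\<^sup>2 / T) *
              (\<Sum>\<^sub>\<infinity>n\<in>{1..}. (\<beta> n)\<^sup>2 * exp (2 * (\<beta> n)\<^sup>2 * T) * (cmod (a n))\<^sup>2)))))"
proof -
  obtain C where C: "C > 0" and VC:
    "\<And>\<beta> :: nat \<Rightarrow> real. (\<And>n. n \<ge> 1 \<Longrightarrow> \<gamma> \<le> \<beta> (n + 1) - \<beta> n) \<Longrightarrow> \<gamma> \<le> \<beta> 1 \<Longrightarrow>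
       (\<And>n. n \<ge> 1 \<Longrightarrow> n \<ge> N \<Longrightarrow> \<gamma>_inf \<le> \<beta> (n + 1) - \<beta> n) \<Longrightarrow>
       \<exists>V. sine_biorthogonal \<beta> S C V"
    using sine_biorthogonal_family[OF assms(1-3), of N] by blast
  have S: "S > 0" using assms(1,3) by (meson divide_pos_pos less_trans pi_gt_zero)
  show ?thesis
  \<comment> \<open>The factor in front of the exponential in \<open>moment_solution\<close>,
    without its power of T.\<close>
  proof (intro exI[of _ "8 * S ^ 3 * C"] conjI allI impI)
    show "8 * S ^ 3 * C > 0" using S C by simp
    fix \<beta> :: "nat \<Rightarrow> real" and T :: real
    assume H: "(\<forall>n\<ge>1. \<beta> (n + 1) - \<beta> n \<ge> \<gamma>) \<and> \<beta> 1 \<ge> \<gamma> \<and>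
      (\<forall>n\<ge>1. n \<ge> N \<longrightarrow> \<beta> (n + 1) - \<beta> n \<ge> \<gamma>_inf) \<and> 0 < T \<and> T \<le> 1"
    then have T: "T > 0" "T \<le> 1" by auto
    have bg: "\<gamma> \<le> \<beta> n" if "n \<ge> 1" for n
      using that
    proof (induction n rule: dec_induct)
      case (step n)
      then have "\<gamma> \<le> \<beta> (n + 1) - \<beta> n" using H by blast
      then show ?case using step assms(2) by simp
    qed (use H in simp)
    have bpos: "\<beta> n > 0" if "n \<ge> 1" for n using bg[OF that] assms(2) by simp
    have "\<exists>V. sine_biorthogonal \<beta> S C V" by (rule VC) (use H in auto)
    then obtain V where V: "sine_biorthogonal \<beta> S C V" ..
    define K where "K = 8 * S ^ 3 * C / T\<^sup>2 * exp (16 * S\<^sup>2 / T)"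
    have K: "K \<ge> 0" using S C by (simp add: K_def)
    show "\<exists>u :: nat \<Rightarrow> real \<Rightarrow> real.
        (\<forall>n\<ge>1. u n \<in> L2 T) \<and>
        (\<forall>l\<ge>1. \<forall>n\<ge>1.
          (LINT t|lebesgue_on {0<..<T}. u n t * exp (- ((\<beta> l)\<^sup>2) * t)) = (if n = l then 1 else 0)) \<and>
        (\<forall>a :: nat \<Rightarrow> complex.
          (\<lambda>n. (cmod ((\<beta> n)\<^sup>2 * exp ((\<beta> n)\<^sup>2 * T) * a n))\<^sup>2) summable_on {1..} \<longrightarrow>
          (\<exists>z :: real \<Rightarrow> complex.
            L2_series_sum T (\<lambda>n t. a n * complex_of_real (u n t)) z \<and>
            (L2_norm T z)\<^sup>2 \<le> 8 * S ^ 3 * C / T ^ 3 * exp ((16 + \<epsilon>) * S\<^sup>2 / T) *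
              (\<Sum>\<^sub>\<infinity>n\<in>{1..}. (\<beta> n)\<^sup>2 * exp (2 * (\<beta> n)\<^sup>2 * T) * (cmod (a n))\<^sup>2)))"
    proof (rule moment_solution[OF S T(1) C bpos V])
      fix u :: "nat \<Rightarrow> real \<Rightarrow> real"
      assume u: "\<And>n. n \<ge> 1 \<Longrightarrow> u n \<in> borel_measurable borel"
        "\<And>n t. n \<ge> 1 \<Longrightarrow> \<not> (0 < t \<and> t < T) \<Longrightarrow> u n t = 0"
        "\<And>n l. n \<ge> 1 \<Longrightarrow> l \<ge> 1 \<Longrightarrow> (LINT t|lborel. u n t * exp (- ((\<beta> l)\<^sup>2) * t)) = (if n = l then 1 else 0)"
        "\<And>F (a :: nat \<Rightarrow> complex) t. finite F \<Longrightarrow> F \<subseteq> {1..} \<Longrightarrow>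
           (cmod (\<Sum>n\<in>F. a n * complex_of_real (u n t)))\<^sup>2 \<le>
           8 * S ^ 3 * C / T\<^sup>2 * exp (16 * S\<^sup>2 / T) * (\<Sum>n\<in>F. (\<beta> n)\<^sup>2 * exp (2 * (\<beta> n)\<^sup>2 * T) * (cmod (a n))\<^sup>2)"
      show ?thesis
      proof (intro exI[of _ u] conjI allI impI)
        fix n :: nat assume n: "n \<ge> 1"
        show "u n \<in> L2 T"
        proof (rule bounded_in_L2(1)[OF u(1)[OF n] _ T(1)])
          show "(norm (u n t))\<^sup>2 \<le> K * ((\<beta> n)\<^sup>2 * exp (2 * (\<beta> n)\<^sup>2 * T))" for t
            using u(4)[of "{n}" "\<lambda>_. 1" t] n by (simp add: K_def)
        qed
      next
        fix l n :: nat assume l: "l \<ge> 1" and n: "n \<ge> 1"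
        have "(LINT t|lebesgue_on {0<..<T}. u n t * exp (- ((\<beta> l)\<^sup>2) * t)) = (LINT t|lborel. u n t * exp (- ((\<beta> l)\<^sup>2) * t))"
          by (rule integral_lebesgue_on_interval) (use u(1)[OF n] u(2)[OF n] in auto)
        then show "(LINT t|lebesgue_on {0<..<T}. u n t * exp (- ((\<beta> l)\<^sup>2) * t)) = (if n = l then 1 else 0)"
          using u(3)[OF n l] by simp
      next
        fix a :: "nat \<Rightarrow> complex"
        assume a: "(\<lambda>n. (cmod ((\<beta> n)\<^sup>2 * exp ((\<beta> n)\<^sup>2 * T) * a n))\<^sup>2) summable_on {1..}"
        define w where "w n = (\<beta> n)\<^sup>2 * exp (2 * (\<beta> n)\<^sup>2 * T) * (cmod (a n))\<^sup>2" for n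
        \<comment> \<open>The assumption carries the weight \<beta>_n^4 exp(2 \<beta>_n^2 T); since
          \<beta>_n \<ge> \<gamma>, it dominates \<gamma>^2 times the weight with
          \<beta>_n^2.\<close>
        have w: "w summable_on {1..}"
        proof (rule summable_on_comparison_test[OF summable_on_cmult_right[OF a, of "1 / \<gamma>\<^sup>2"]])
          fix n :: nat assume "n \<in> {1..}"
          then have n: "\<gamma> \<le> \<beta> n" by (intro bg) simp
          have "\<gamma>\<^sup>2 * w n \<le> (\<beta> n)\<^sup>2 * w n"
            using n assms(2) by (intro mult_right_mono power_mono) (auto simp: w_def)
          also have "\<dots> = (cmod ((\<beta> n)\<^sup>2 * exp ((\<beta> n)\<^sup>2 * T) * a n))\<^sup>2"
          proof -
            have "exp (2 * (\<beta> n)\<^sup>2 * T) = (exp ((\<beta> n)\<^sup>2 * T))\<^sup>2"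
              by (simp add: mult.assoc flip: exp_double)
            then show ?thesis
              by (simp add: w_def norm_mult norm_power power_mult_distrib power2_eq_square[of "(\<beta> n)\<^sup>2"])
          qed
          finally show "w n \<le> 1 / \<gamma>\<^sup>2 * (cmod ((\<beta> n)\<^sup>2 * exp ((\<beta> n)\<^sup>2 * T) * a n))\<^sup>2"
            using assms(2) by (simp add: field_simps)
          show "0 \<le> w n" by (simp add: w_def)
        qed
        have fm: "(\<lambda>t. a n * complex_of_real (u n t)) \<in> borel_measurable borel" if "n \<ge> 1" for n
          using u(1)[OF that] by measurable
        have bd: "(cmod (\<Sum>n\<in>F. a n * complex_of_real (u n t)))\<^sup>2 \<le> K * (\<Sum>n\<in>F. w n)" if "finite F" "F \<subseteq> {1..}" for F t
          using u(4)[OF that, of a t] by (simp add: K_def w_def)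
        obtain z where z: "L2_series_sum T (\<lambda>n t. a n * complex_of_real (u n t)) z"
          "(L2_norm T z)\<^sup>2 \<le> T * (K * (\<Sum>\<^sub>\<infinity>n\<in>{1..}. w n))"
          by (rule L2_series_sum_of_pointwise_bound[OF T(1) K fm w _ bd]) (auto simp: w_def)
        have W: "0 \<le> (\<Sum>\<^sub>\<infinity>n\<in>{1..}. w n)" by (rule infsum_nonneg) (simp add: w_def)
        \<comment> \<open>The argument gives T^(-1) exp(16 S^2/T) up to the constant; T \<le> 1
          raises the power to T^(-3), and \<epsilon> > 0 enlarges the exponent.\<close>
        have TK: "T * K \<le> 8 * S ^ 3 * C / T ^ 3 * exp ((16 + \<epsilon>) * S\<^sup>2 / T)"
        proof -
          have "T * K = 8 * S ^ 3 * C / T * exp (16 * S\<^sup>2 / T)"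
            using T by (simp add: K_def power2_eq_square)
          also have "\<dots> \<le> 8 * S ^ 3 * C / T ^ 3 * exp ((16 + \<epsilon>) * S\<^sup>2 / T)"
          proof (intro mult_mono)
            have "T ^ 3 \<le> T ^ 1" using T by (intro power_decreasing) auto
            then show "8 * S ^ 3 * C / T \<le> 8 * S ^ 3 * C / T ^ 3"
              using T S C by (intro divide_left_mono) auto
            have "16 * S\<^sup>2 \<le> (16 + \<epsilon>) * S\<^sup>2" using assms(4) by (intro mult_right_mono) auto
            then show "exp (16 * S\<^sup>2 / T) \<le> exp ((16 + \<epsilon>) * S\<^sup>2 / T)" using T by (simp add: divide_right_mono)
          qed (use S C T in auto)
          finally show ?thesis .
        qed
        have "(L2_norm T z)\<^sup>2 \<le> 8 * S ^ 3 * C / T ^ 3 * exp ((16 + \<epsilon>) * S\<^sup>2 / T) * (\<Sum>\<^sub>\<infinity>n\<in>{1..}. w n)"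
          using z(2) mult_right_mono[OF TK W] by (simp add: mult.assoc)
        then show "\<exists>z. L2_series_sum T (\<lambda>n t. a n * complex_of_real (u n t)) z \<and>
              (L2_norm T z)\<^sup>2 \<le> 8 * S ^ 3 * C / T ^ 3 * exp ((16 + \<epsilon>) * S\<^sup>2 / T) *
                (\<Sum>\<^sub>\<infinity>n\<in>{1..}. (\<beta> n)\<^sup>2 * exp (2 * (\<beta> n)\<^sup>2 * T) * (cmod (a n))\<^sup>2)"
          using z(1) unfolding w_def by blast
      qed
    qed
  qed
qed

end
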